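(* Let $\Gamma\subset\mathrm{PSU}(1,1)$ be a cofinite Fuchsian group and $Q\in A_\infty(\Delta,\Gamma)$ a tangent vector to $T(\Gamma)$ at the origin. Then $\|Q\|_V^2=\|Q\|_{WP}^2$.
   Context: $\Delta$ is the open unit disc, $\Delta^*=\hat{\mathbb C}\setminus\overline\Delta$; $\Gamma\subset\mathrm{PSU}(1,1)$ acts on both, and is cofinite if $\Gamma\backslash\Delta$ has finite hyperbolic area. $A_\infty(\Delta)$: holomorphic $Q$ on $\Delta$ with $\sup|Q(z)(1-|z|^2)^2|<\infty$; $A_\infty(\Delta,\Gamma)$: those with $(Q\circ\gamma)(\gamma')^2=Q$ for all $\gamma\in\Gamma$. Weil–Petersson norm: $\|Q\|_{WP}^2=\frac14\iint_{\Gamma\backslash\Delta}|Q(w)|^2(1-|w|^2)^2dx\,dy$, $w=x+iy$. Universal Teichmüller space $T(1)$: the open unit ball of $L^\infty(\Delta^* )$ (Beltrami differentials) modulo $\mu\sim\nu\iff w^\mu|_\Delta=w^\nu|_\Delta$, where $w^\mu$ is the quasiconformal map of $\hat{\mathbb C}$ with Beltrami coefficient $\mu$ on $\Delta^*$ and $0$ on $\Delta$, normalized by $w^\mu(0)=0,(w^\mu)'(0)=1,(w^\mu)''(0)=0$. The embedding $[\mu]\mapsto\mathcal S(w^\mu|_\Delta)$ ($\mathcal S$ the Schwarzian derivative) identifies it with an open subset of $A_\infty(\Delta)$. $T(\Gamma)\subset T(1)$ is the set of classes of $\mu$ with $\mu\circ\gamma\,\overline{\gamma'}/\gamma'=\mu$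 for all $\gamma\in\Gamma$; its tangent space at the origin is $A_\infty(\Delta,\Gamma)$. Universal Teichmüller curve: $\mathcal T(1)=\{([\mu],z):[\mu]\in T(1),z\in w^\mu(\Delta^* )\}$, a complex manifold via $([\mu],z)\mapsto(\mathcal S(w^\mu|_\Delta),1/z)\in A_\infty(\Delta)\oplus\mathbb C$, with origin $(0,\infty)$. It is identified with the quotient $\mathrm{Homeo}_{qs}(S^1)/S^1$ of orientation preserving quasisymmetric homeomorphisms of $S^1$ by post-composition with rotations: $([\mu],z)$ corresponds to the class of $g^{-1}\circ f|_{S^1}$, where $f=\frac{w^\mu}{1-w^\mu/z}|_\Delta$ and $g$ is the conformal map of $\Delta^*$ onto the exterior of $f(\Delta)$ with $g(\infty)=\infty,g'(\infty)>0$. Right translations act biholomorphically. Velling–Kirillov metric: the right invariant Kähler metric on $\mathcal T(1)$ which at the origin, on the holomorphic tangent vector represented by $\dot f=\sum_{n\ge1}a_nz^{n+1}$, equals $\|\upsilon\|^2=\sum_{n\ge1}n|a_n|^2$; its symplectic form $\kappa$ is normalized by $\kappa(\upsilon,\bar\upsilon)=\frac i2\|\upsilon\|^2$ for holomorphic $\upsilon$. The Bers fiber space $\mathcal{BF}(\Gamma)$ is the inverse image of $T(\Gamma)$ in $\mathcal T(1)$; the quasi-Fuchsian group $w^\mu\Gamma(w^\mu)^{-1}$ acts on the fiber $w^\mu(\Delta^* )$ over $[\mu]$, and the fiberwise quotient is the Teichmüller curve $\mathcal F(\Gamma)\to T(\Gamma)$. The restriction of $\kappa$ to $\mathcal{BF}(\Gamma)$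 descends to $\mathcal F(\Gamma)$. Let $\omega$ be the $(1,1)$-form on $T(\Gamma)$ obtained by integrating $\kappa\wedge\kappa$ over the fibers of $\mathcal F(\Gamma)\to T(\Gamma)$, and $\|Q\|_V^2:=-2i\,\omega(Q,\bar Q)$. Explicitly, with $\gamma_w(z)=\frac{z+w}{1+\bar wz}$, $Q_w=(Q\circ\gamma_w)(\gamma_w')^2=\sum_{n\ge2}(n^3-n)a_n^wz^{n-2}$ and $\|Q_w\|_S^2=\sum_{n\ge2}n|a_n^w|^2$, one has $\|Q\|_V^2=\frac12\iint_{\Gamma\backslash\Delta}\|Q_w\|_S^2\frac{4\,dx\,dy}{(1-|w|^2)^2}$. *)

theory Defs
  imports "HOL-Complex_Analysis.Complex_Analysis" "HOL-Algebra.Bij"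
begin

section \<open>Fuchsian groups and quadratic differentials\<close>

abbreviation unit_disc :: "complex set" where
  "unit_disc \<equiv> ball 0 1"

definition su11 :: "(complex \<times> complex) set" where
  "su11 = {(a, b). (cmod a)\<^sup>2 - (cmod b)\<^sup>2 = 1}"

text \<open>The pair \<open>(a, b)\<close> stands for the matrix with rows \<open>(a, b)\<close>, \<open>(cnj b, cnj a)\<close>. Its action
  is made extensional on the disc, so that equality of maps is equality in \<open>PSU(1,1)\<close>.\<close>

definition su11_action :: "complex \<times> complex \<Rightarrow> complex \<Rightarrow> complex" where
  "su11_action = (\<lambda>(a, b). \<lambda>z\<in>unit_disc. (a * z + b) / (cnj b * z + cnj a))"

definition PSU11 :: "(complex \<Rightarrow> complex) set" where
  "PSU11 = su11_action ` su11"

text \<open>A subgroup of \<open>PSU(1,1)\<close> is discrete iff its preimage in \<open>SU(1,1)\<close> is.\<close>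

definition fuchsian_group :: "(complex \<Rightarrow> complex) set \<Rightarrow> bool" where
  "fuchsian_group G \<longleftrightarrow>
     subgroup G (BijGroup unit_disc) \<and> G \<subseteq> PSU11 \<and> discrete {m \<in> su11. su11_action m \<in> G}"

definition fundamental_domain :: "(complex \<Rightarrow> complex) set \<Rightarrow> complex set \<Rightarrow> bool" where
  "fundamental_domain G F \<longleftrightarrow>
     F \<in> sets lebesgue \<and> F \<subseteq> unit_disc \<and>
     negligible (unit_disc - (\<Union>\<gamma>\<in>G. \<gamma> ` F)) \<and>
     (\<forall>\<gamma>\<in>G. \<gamma> \<noteq> (\<lambda>z\<in>unit_disc. z) \<longrightarrow> negligible (\<gamma> ` F \<inter> F))"

definition cofinite_group :: "(complex \<Rightarrow> complex) set \<Rightarrow> bool" where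
  "cofinite_group G \<longleftrightarrow>
     (\<exists>F. fundamental_domain G F \<and> set_integrable lebesgue F (\<lambda>w. 4 / (1 - (cmod w)\<^sup>2)\<^sup>2))"

text \<open>The integral over the quotient of the disc of the invariant 2-form \<open>h w dx dy\<close>, where
  \<open>w = x + i y\<close>. As \<open>h w dx dy\<close> is assumed to be invariant, the value does not depend on the
  choice of the fundamental domain.\<close>

definition quotient_integral ::
    "(complex \<Rightarrow> complex) set \<Rightarrow> (complex \<Rightarrow> 'a::{banach,second_countable_topology}) \<Rightarrow> 'a" where
  "quotient_integral G h = (LINT w : (SOME F. fundamental_domain G F) | lebesgue. h w)"

definition A_inf :: "(complex \<Rightarrow> complex) set" where
  "A_inf = {Q. Q holomorphic_on unit_disc \<and>
     (\<exists>B. \<forall>z\<in>unit_disc. cmod (Q z * complex_of_real ((1 - (cmod z)\<^sup>2)\<^sup>2)) \<le> B)}"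

definition A_inf_inv :: "(complex \<Rightarrow> complex) set \<Rightarrow> (complex \<Rightarrow> complex) set" where
  "A_inf_inv G = {Q \<in> A_inf. \<forall>\<gamma>\<in>G. \<forall>z\<in>unit_disc. Q (\<gamma> z) * (deriv \<gamma> z)\<^sup>2 = Q z}"

definition WP_norm_sq :: "(complex \<Rightarrow> complex) set \<Rightarrow> (complex \<Rightarrow> complex) \<Rightarrow> real" where
  "WP_norm_sq G Q =
     1/4 * quotient_integral G (\<lambda>w. (cmod (Q w))\<^sup>2 * (1 - (cmod w)\<^sup>2)\<^sup>2)"


section \<open>The universal Teichmueller curve along the fiber over the origin\<close>

text \<open>A point \<open>([\<mu>], z)\<close> of the universal Teichmueller curve is represented by the univalent function
  \<open>f = w\<^sup>\<mu> / (1 - w\<^sup>\<mu> / z)\<close> on the disc, which satisfies \<open>f 0 = 0\<close> and \<open>f' 0 = 1\<close>. Since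
  \<open>S f = S w\<^sup>\<mu>\<close> and \<open>f'' 0 / 2 = 1/z\<close>, the coordinates \<open>(S w\<^sup>\<mu>, 1/z)\<close> of the point are
  \<open>(S f, f'' 0 / 2)\<close>. Tangent vectors at \<open>f\<close> are holomorphic functions \<open>v\<close> on the disc with
  \<open>v 0 = v' 0 = 0\<close>; the curve \<open>f + t v\<close> has tangent \<open>v\<close> at \<open>t = 0\<close>.\<close>

definition schwarzian :: "(complex \<Rightarrow> complex) \<Rightarrow> complex \<Rightarrow> complex" where
  "schwarzian f z =
     (deriv ^^ 3) f z / deriv f z - 3/2 * ((deriv ^^ 2) f z / deriv f z)\<^sup>2"

text \<open>The points over the origin of \<open>T(1)\<close>, where \<open>w\<^sup>\<mu>\<close> is the identity, in the fiber
  coordinate \<open>\<zeta> = 1/z\<close>, which ranges over the unit disc. The origin of the curve is \<open>\<zeta> = 0\<close>.\<close>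

definition fiber_point :: "complex \<Rightarrow> complex \<Rightarrow> complex" where
  "fiber_point \<zeta> x = x / (1 - \<zeta> * x)"

text \<open>The tangent vector at \<open>f\<close> whose components in the coordinates \<open>(S f, f'' 0 / 2)\<close> are \<open>(Q, c)\<close>.
  Derivatives in the Banach space of quadratic differentials are taken pointwise on the disc.\<close>

definition tangent_vector ::
    "(complex \<Rightarrow> complex) \<Rightarrow> (complex \<Rightarrow> complex) \<Rightarrow> complex \<Rightarrow> complex \<Rightarrow> complex" where
  "tangent_vector f Q c = (SOME v. v holomorphic_on unit_disc \<and> v 0 = 0 \<and> deriv v 0 = 0 \<and>
     (\<forall>x\<in>unit_disc. ((\<lambda>t. schwarzian (\<lambda>y. f y + t * v y) x) has_field_derivative Q x) (at 0)) \<and>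
     (deriv ^^ 2) v 0 / 2 = c)"

text \<open>Right translation by \<open>\<gamma> \<in> PSU(1,1)\<close>. If \<open>f\<close> corresponds to the class of \<open>g\<inverse> \<circ> f\<close> on the circle
  and \<open>A\<close> is the affine map for which \<open>A \<circ> f \<circ> \<gamma>\<close> is normalized at \<open>0\<close>, then \<open>A \<circ> g\<close> precomposed with a
  rotation is the normalized exterior map of \<open>A \<circ> f \<circ> \<gamma>\<close>. Hence \<open>A \<circ> f \<circ> \<gamma>\<close> corresponds to the class
  of \<open>g\<inverse> \<circ> f \<circ> \<gamma>\<close> modulo post-composition with rotations.\<close>

definition right_translate ::
    "(complex \<Rightarrow> complex) \<Rightarrow> (complex \<Rightarrow> complex) \<Rightarrow> complex \<Rightarrow> complex" where
  "right_translate \<gamma> f x = (f (\<gamma> x) - f (\<gamma> 0)) / deriv (\<lambda>y. f (\<gamma> y)) 0"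

definition d_right_translate ::
    "(complex \<Rightarrow> complex) \<Rightarrow> (complex \<Rightarrow> complex) \<Rightarrow> (complex \<Rightarrow> complex) \<Rightarrow> complex \<Rightarrow> complex" where
  "d_right_translate \<gamma> f v x = deriv (\<lambda>t. right_translate \<gamma> (\<lambda>y. f y + t * v y) x) 0"

definition disc_shift :: "complex \<Rightarrow> complex \<Rightarrow> complex" where
  "disc_shift w z = (z + w) / (1 + cnj w * z)"

lemma disc_shift_in_PSU11:
  assumes "w \<in> unit_disc"
  shows "(\<lambda>z\<in>unit_disc. disc_shift w z) \<in> PSU11"
proof -
  define s where "s = 1 / sqrt (1 - (cmod w)\<^sup>2)"
  have "(cmod w)\<^sup>2 < 1"
    using assms by (simp add: abs_square_less_1)
  then have s: "s > 0" "s\<^sup>2 * (1 - (cmod w)\<^sup>2) = 1"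
    by (auto simp: s_def power_divide)
  have "(of_real s, of_real s * w) \<in> su11"
    using s by (simp add: su11_def norm_mult power_mult_distrib algebra_simps)
  moreover have "(\<lambda>z\<in>unit_disc. disc_shift w z) = su11_action (of_real s, of_real s * w)"
  proof -
    have "disc_shift w z = (of_real s * z + of_real s * w) / (of_real s * cnj w * z + of_real s)" for z
    proof -
      have "(of_real s * z + of_real s * w) / (of_real s * cnj w * z + of_real s)
          = (of_real s * (z + w)) / (of_real s * (1 + cnj w * z))"
        by (simp add: algebra_simps)
      then show ?thesis
        using s(1) by (simp add: disc_shift_def)
    qed
    then show ?thesis
      by (simp add: su11_action_def)
  qed
  ultimately show ?thesis
    by (auto simp: PSU11_def)
qed

text \<open>Right translation by \<open>disc_shift (cnj \<zeta>)\<close> takes the fiber point \<open>\<zeta>\<close> to the origin.\<close>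

lemma right_translate_fiber_point:
  assumes "\<zeta> \<in> unit_disc" "x \<in> unit_disc"
  shows "right_translate (disc_shift (cnj \<zeta>)) (fiber_point \<zeta>) x = fiber_point 0 x"
proof -
  define k where "k = 1 - \<zeta> * cnj \<zeta>"
  have k: "k \<noteq> 0"
  proof
    assume "k = 0"
    then have "complex_of_real ((cmod \<zeta>)\<^sup>2) = 1"
      using complex_norm_square[of \<zeta>] by (simp add: k_def)
    then have "(cmod \<zeta>)\<^sup>2 = 1"
      using of_real_eq_1_iff by blast
    moreover have "(cmod \<zeta>)\<^sup>2 < 1"
      using assms(1) by (simp add: abs_square_less_1)
    ultimately show False
      by simp
  qed
  have *: "fiber_point \<zeta> (disc_shift (cnj \<zeta>) y) = (y + cnj \<zeta>) / k" if "y \<in> unit_disc" for y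
  proof -
    have "cmod (\<zeta> * y) < 1"
      using assms(1) that mult_strict_mono'[of "cmod \<zeta>" 1 "cmod y" 1] by (simp add: norm_mult)
    then have d: "1 + \<zeta> * y \<noteq> 0"
      by (metis add_eq_0_iff norm_minus_cancel norm_one order_less_irrefl)
    have "1 - \<zeta> * ((y + cnj \<zeta>) / (1 + \<zeta> * y)) = k / (1 + \<zeta> * y)"
      using d by (simp add: k_def divide_simps) (simp add: algebra_simps)
    then show ?thesis
      using d k by (simp add: fiber_point_def disc_shift_def)
  qed
  have "((\<lambda>y. (y + cnj \<zeta>) / k) has_field_derivative 1 / k) (at 0)"
    using k by (auto intro!: derivative_eq_intros simp: field_simps)
  then have "((\<lambda>y. fiber_point \<zeta> (disc_shift (cnj \<zeta>) y)) has_field_derivative 1 / k) (at 0)"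
    by (rule has_field_derivative_transform_within_open[where S = unit_disc]) (auto simp: *)
  then have "deriv (\<lambda>y. fiber_point \<zeta> (disc_shift (cnj \<zeta>) y)) 0 = 1 / k"
    by (rule DERIV_imp_deriv)
  then show ?thesis
    using assms(2) k by (simp add: right_translate_def *) (simp add: fiber_point_def field_simps)
qed


section \<open>The Velling--Kirillov form and its fiber integral\<close>

text \<open>The Hermitian form polarizing \<open>\<parallel>\<upsilon>\<parallel>\<^sup>2 = (\<Sum>n\<ge>1. n * \<bar>a\<^sub>n\<bar>\<^sup>2)\<close> for
  \<open>\<upsilon> = (\<Sum>n\<ge>1. a\<^sub>n * z^(n+1))\<close>. The term at \<open>n = 0\<close> vanishes.\<close>

definition tangent_coeff :: "(complex \<Rightarrow> complex) \<Rightarrow> nat \<Rightarrow> complex" where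
  "tangent_coeff v n = (deriv ^^ (n + 1)) v 0 / fact (n + 1)"

definition VK_hermitian_origin :: "(complex \<Rightarrow> complex) \<Rightarrow> (complex \<Rightarrow> complex) \<Rightarrow> complex" where
  "VK_hermitian_origin u v = (\<Sum>n. of_nat n * tangent_coeff u n * cnj (tangent_coeff v n))"

text \<open>A complexified tangent vector is a pair \<open>(u, v)\<close> of holomorphic tangent vectors, which stands for
  the sum of \<open>u\<close> and the complex conjugate of \<open>v\<close>.\<close>

type_synonym ctangent = "(complex \<Rightarrow> complex) \<times> (complex \<Rightarrow> complex)"

definition hol_part :: "(complex \<Rightarrow> complex) \<Rightarrow> ctangent" where
  "hol_part v = (v, \<lambda>_. 0)"

definition conj_part :: "(complex \<Rightarrow> complex) \<Rightarrow> ctangent" where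
  "conj_part v = (\<lambda>_. 0, v)"

definition kappa_origin :: "ctangent \<Rightarrow> ctangent \<Rightarrow> complex" where
  "kappa_origin X Y =
     \<i>/2 * (VK_hermitian_origin (fst X) (snd Y) - VK_hermitian_origin (fst Y) (snd X))"

text \<open>The right invariant extension of \<open>kappa_origin\<close>, at the point \<open>\<zeta>\<close> of the fiber over the
  origin of \<open>T(1)\<close>. Any other element of \<open>PSU(1,1)\<close> which translates this point to the origin differs from
  \<open>disc_shift (cnj \<zeta>)\<close> by a rotation of the disc, and \<open>kappa_origin\<close> is invariant under rotations.\<close>

definition kappa :: "complex \<Rightarrow> ctangent \<Rightarrow> ctangent \<Rightarrow> complex" where
  "kappa \<zeta> X Y =
     (let D = d_right_translate (disc_shift (cnj \<zeta>)) (fiber_point \<zeta>)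
      in kappa_origin (map_prod D D X) (map_prod D D Y))"

definition wedge_2_2 ::
    "('v \<Rightarrow> 'v \<Rightarrow> complex) \<Rightarrow> ('v \<Rightarrow> 'v \<Rightarrow> complex) \<Rightarrow> 'v \<Rightarrow> 'v \<Rightarrow> 'v \<Rightarrow> 'v \<Rightarrow> complex" where
  "wedge_2_2 \<alpha> \<beta> X1 X2 X3 X4 =
       \<alpha> X1 X2 * \<beta> X3 X4 - \<alpha> X1 X3 * \<beta> X2 X4 + \<alpha> X1 X4 * \<beta> X2 X3
     + \<alpha> X2 X3 * \<beta> X1 X4 - \<alpha> X2 X4 * \<beta> X1 X3 + \<alpha> X3 X4 * \<beta> X1 X2"

text \<open>The coefficient of \<open>d\<zeta> \<and> d(cnj \<zeta>)\<close> in the restriction to the fiber of \<open>\<kappa> \<and> \<kappa>\<close> contracted with lifts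
  of \<open>Q\<close> and of the conjugate of \<open>P\<close>. Both are lifted with constant fiber coordinate; other lifts give the
  same value, as they differ by vertical vectors.\<close>

definition fiber_density :: "(complex \<Rightarrow> complex) \<Rightarrow> (complex \<Rightarrow> complex) \<Rightarrow> complex \<Rightarrow> complex" where
  "fiber_density Q P \<zeta> =
     (let lift = (\<lambda>R. tangent_vector (fiber_point \<zeta>) R 0);
          vert = tangent_vector (fiber_point \<zeta>) (\<lambda>_. 0) 1
      in wedge_2_2 (kappa \<zeta>) (kappa \<zeta>)
           (hol_part (lift Q)) (conj_part (lift P)) (hol_part vert) (conj_part vert))"

text \<open>The value \<open>\<omega>(Q, cnj P)\<close> at the origin of \<open>T(\<Gamma>)\<close>. The fiber is the quotient by \<open>\<Gamma>\<close> of the exterior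
  of the disc. The reflection \<open>z \<mapsto> 1 / cnj z\<close> commutes with \<open>PSU(1,1)\<close> and takes \<open>z = 1/\<zeta>\<close> to
  \<open>w = cnj \<zeta>\<close> in the disc, so one may integrate over the quotient of the disc. The fiber is oriented by its
  complex coordinate \<open>\<zeta>\<close>, for which \<open>d\<zeta> \<and> d(cnj \<zeta>)\<close> is \<open>- 2 * \<i>\<close> times the area element.\<close>

definition omega_origin ::
    "(complex \<Rightarrow> complex) set \<Rightarrow> (complex \<Rightarrow> complex) \<Rightarrow> (complex \<Rightarrow> complex) \<Rightarrow> complex" where
  "omega_origin G Q P = quotient_integral G (\<lambda>w. fiber_density Q P (cnj w) * (- 2 * \<i>))"

definition V_norm_sq :: "(complex \<Rightarrow> complex) set \<Rightarrow> (complex \<Rightarrow> complex) \<Rightarrow> complex" where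
  "V_norm_sq G Q = - 2 * \<i> * omega_origin G Q Q"

end

theory Submission
  imports Defs
begin

text \<open>At the point \<open>w\<close> of the fiber the integrand of the fiber integral is
  \<open>(\<Sum>m. S_weight m * \<bar>b m w\<bar>^2) / (1 - \<bar>w\<bar>^2)^2\<close> up to a constant, where \<open>b m w\<close> are the Taylor coefficients
  of \<open>Q_w\<close>. The function \<open>h = \<bar>Q\<bar>^2 (1 - \<bar>w\<bar>^2)^4\<close> is \<open>\<Gamma>\<close>-invariant and \<open>\<bar>Q_w z\<bar>^2 (1 - \<bar>z\<bar>^2)^4\<close> is its value at
  \<open>disc_shift w z\<close>. Averaging operators given by symmetric point-pair invariant kernels multiply the
  integral over the quotient by the total mass of the kernel, by unfolding twice. For the kernels cut
  off at hyperbolic discs this reads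
  \<open>(\<Sum>m. B m * \<rho>^(m+1) / (m+1)) = B 0 * (\<Sum>m. C(m+3,3) * \<rho>^(m+1) / (m+1))\<close> for \<open>0 < \<rho> < 1\<close>, where \<open>B m\<close> is the
  integral of \<open>\<bar>b m\<bar>^2\<close> over the quotient with respect to hyperbolic area. Hence \<open>B m = C(m+3,3) * B 0\<close>,
  and the theorem reduces to \<open>(\<Sum>m. S_weight m * C(m+3,3)) = (\<Sum>m. 1 / (6 (m+1) (m+3))) = 1/8\<close>.\<close>

subsection \<open>Change of variables for holomorphic maps\<close>

text \<open>The cut-off is forced: without it the kernel has infinite mass, and the series diverge
  at \<rho> = 1. With \<rho> as a free parameter the averaging identity equates two power series in
  \<rho>, so all \<open>B m\<close> are found at once and arbitrary weights can be inserted
  afterwards. The numbers C(m+3,3) are the coefficients of (1 - s)^(-4): the square of \<bar>Q_w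
  z\<bar> is an invariant function times (1 - \<bar>z\<bar>^2)^(-4), and the constant function 1 in
  its place gives the mass of the kernel. On the geometric side, the linearised Schwarzian at a
  Moebius map is the third derivative of a vector field, and third derivatives intertwine the
  Moebius transport of vector fields with that of quadratic differentials (Bol's lemma). Hence the
  modes n > 1 of a transported lift are Taylor coefficients of \<open>Q_w\<close> up to explicit
  factors. The vertical direction has only the mode n = 1, which the Gram determinant in \<kappa>
  \<and> \<kappa> removes. Integrals take values in [0,\<infinity>], so that Tonelli applies freely;
  finiteness is needed to compare coefficients and to return to real integrals.\<close>

definition vec2_to_complex :: "real^2 \<Rightarrow> complex" where
  "vec2_to_complex v = Complex (v $ 1) (v $ 2)"

definition complex_to_vec2 :: "complex \<Rightarrow> real^2" where
  "complex_to_vec2 z = vector [Re z, Im z]"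

lemma vec2_complex_inverse [simp]:
  "vec2_to_complex (complex_to_vec2 z) = z" "complex_to_vec2 (vec2_to_complex v) = v"
  by (auto simp: vec2_to_complex_def complex_to_vec2_def vec_eq_iff forall_2)

lemma linear_vec2_complex: "linear vec2_to_complex" "linear complex_to_vec2"
  by (auto intro!: linearI simp: vec2_to_complex_def complex_to_vec2_def complex_eq_iff vec_eq_iff forall_2)

lemma borel_measurable_vec2_complex [measurable]:
  "vec2_to_complex \<in> borel_measurable borel" "complex_to_vec2 \<in> borel_measurable borel"
  using linear_vec2_complex by (auto intro!: borel_measurable_continuous_onI linear_continuous_on simp: linear_conv_bounded_linear)

lemma vec2_to_complex_vimage: "vec2_to_complex -` A = complex_to_vec2 ` A"
  by (auto simp: image_iff) (metis vec2_complex_inverse(2))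

text \<open>The area formula used below is one for maps of \<open>real^2\<close>, so Lebesgue
  measure on the plane is identified with an image measure from there. By \<open>lborel_eqI\<close>
  it is enough to compare the two on boxes.\<close>

lemma lborel_complex_eq_distr: "lborel = distr lborel borel vec2_to_complex"
proof (rule lborel_eqI)
  fix l u :: complex
  assume le: "\<And>b. b \<in> Basis \<Longrightarrow> l \<bullet> b \<le> u \<bullet> b"
  have "vec2_to_complex -` box l u = box (complex_to_vec2 l) (complex_to_vec2 u)"
    by (auto simp: vec2_to_complex_def complex_to_vec2_def in_box_complex_iff mem_box_cart forall_2)
  moreover have "emeasure lborel (box (complex_to_vec2 l) (complex_to_vec2 u)) =
      (\<Prod>b\<in>Basis. (complex_to_vec2 u - complex_to_vec2 l) \<bullet> b)"
  proof (rule emeasure_lborel_box)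
    have "\<forall>i. complex_to_vec2 l $ i \<le> complex_to_vec2 u $ i"
      using le[of 1] le[of \<i>] by (simp add: forall_2 complex_to_vec2_def)
    then show "complex_to_vec2 l \<bullet> b \<le> complex_to_vec2 u \<bullet> b" if "b \<in> Basis" for b
      using that by (auto simp: Basis_vec_def inner_axis)
  qed
  moreover have "\<dots> = (\<Prod>b\<in>Basis. (u - l) \<bullet> b)"
  proof -
    have B: "(Basis :: (real^2) set) = {axis 1 1, axis 2 1}"
      by (auto simp: Basis_vec_def UNIV_2)
    have "axis (1::2) (1::real) \<noteq> axis 2 1"
      by (simp add: axis_eq_axis)
    then show ?thesis
      by (simp add: B Basis_complex_def complex_to_vec2_def inner_axis)
  qed
  ultimately show "emeasure (distr lborel borel vec2_to_complex) (box l u) = (\<Prod>b\<in>Basis. (u - l) \<bullet> b)"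
    by (simp add: emeasure_distr)
qed simp

lemma emeasure_vec2_to_complex_vimage:
  "A \<in> sets borel \<Longrightarrow> emeasure lborel (vec2_to_complex -` A) = emeasure lborel A"
  by (subst lborel_complex_eq_distr) (simp add: emeasure_distr)

text \<open>Cauchy-Riemann: multiplication by \<open>c\<close> has the matrix with rows (Re c, - Im
  c) and (Im c, Re c). Hence the Jacobian of a holomorphic map is the squared modulus of its
  derivative.\<close>

lemma det_complex_mult:
  "det (matrix (\<lambda>v. complex_to_vec2 (c * vec2_to_complex v))) = (cmod c)\<^sup>2"
  by (simp add: det_2 matrix_def complex_to_vec2_def vec2_to_complex_def axis_def cmod_power2)
     (simp add: power2_eq_square)

lemma nn_integral_vec2_to_complex:
  "f \<in> borel_measurable borel \<Longrightarrow> (\<integral>\<^sup>+x. f (vec2_to_complex x) \<partial>lborel) = (\<integral>\<^sup>+z. f z \<partial>lborel)"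
  by (subst lborel_complex_eq_distr) (simp add: nn_integral_distr)

lemma borel_measurable_deriv_sq:
  assumes "f holomorphic_on S" "open S"
  shows "(\<lambda>z. ennreal ((cmod (deriv f z))\<^sup>2) * indicator S z) \<in> borel_measurable borel"
proof -
  have contd: "continuous_on S (deriv f)"
    by (meson assms holomorphic_deriv holomorphic_on_imp_continuous_on)
  have "(\<lambda>z. if z \<in> S then (cmod (deriv f z))\<^sup>2 else 0) \<in> borel_measurable borel"
    using assms(2) by (intro borel_measurable_continuous_on_if continuous_intros contd) auto
  then have "(\<lambda>z. ennreal (if z \<in> S then (cmod (deriv f z))\<^sup>2 else 0)) \<in> borel_measurable borel"
    by measurable
  then show ?thesis
    by (rule measurable_cong[THEN iffD1, rotated]) (auto simp: indicator_def)
qed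

text \<open>The real area formula for injective differentiable maps, applied to \<open>f\<close>
  read in \<open>real^2\<close> coordinates.\<close>

lemma emeasure_holomorphic_image:
  assumes f: "f holomorphic_on S" "open S" "inj_on f S"
    and A: "A \<in> sets borel" "A \<subseteq> S" "f ` A \<in> sets borel"
  shows "emeasure lborel (f ` A) = (\<integral>\<^sup>+z. ennreal ((cmod (deriv f z))\<^sup>2) * indicator A z \<partial>lborel)"
proof -
  define F where "F = (\<lambda>x. complex_to_vec2 (f (vec2_to_complex x)))"
  define F' where "F' = (\<lambda>x v. complex_to_vec2 (deriv f (vec2_to_complex x) * vec2_to_complex v))"
  define A' where "A' = vec2_to_complex -` A"
  define h where "h = (\<lambda>x. (cmod (deriv f (vec2_to_complex x)))\<^sup>2)"
  have bl: "bounded_linear vec2_to_complex" "bounded_linear complex_to_vec2"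
    using linear_vec2_complex by (auto simp: linear_conv_bounded_linear)
  have A'[measurable]: "A' \<in> sets borel"
    unfolding A'_def by (rule measurable_sets_borel[OF borel_measurable_vec2_complex(1) A(1)])
  have der: "(F has_derivative F' x) (at x within A')" if "x \<in> A'" for x
  proof -
    have "(f has_field_derivative deriv f (vec2_to_complex x)) (at (vec2_to_complex x))"
      using that A(2) f(1,2) by (auto simp: A'_def intro!: holomorphic_derivI)
    then have 1: "(f has_derivative (*) (deriv f (vec2_to_complex x))) (at (vec2_to_complex x))"
      by (simp add: has_field_derivative_def)
    have 2: "(vec2_to_complex has_derivative vec2_to_complex) (at x)"
      by (rule bounded_linear_imp_has_derivative[OF bl(1)])
    from bounded_linear.has_derivative[OF bl(2) has_derivative_compose[OF 2 1]]
    show ?thesis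
      by (simp add: F_def F'_def has_derivative_at_withinI)
  qed
  have inj: "inj_on F A'"
    using f(3) A(2) unfolding F_def A'_def inj_on_def
    by (metis subsetD vec2_complex_inverse vimage_eq)
  have img: "F ` A' = vec2_to_complex -` (f ` A)"
    by (simp add: F_def A'_def vec2_to_complex_vimage image_image)
  have [measurable]: "F ` A' \<in> sets borel"
    unfolding img by (rule measurable_sets_borel[OF borel_measurable_vec2_complex(1) A(3)])
  have det: "\<bar>det (matrix (F' x))\<bar> = h x" for x
    unfolding F'_def h_def by (subst det_complex_mult) simp
  have A'_leb: "A' \<in> sets lebesgue"
    by (metis A' sets_completionI_sets sets_lborel)
  note key = has_measure_differentiable_image[OF A'_leb der inj, unfolded det]
  have meas: "(\<lambda>z. ennreal ((cmod (deriv f z))\<^sup>2) * indicator A z) \<in> borel_measurable borel"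
  proof -
    note [measurable] = borel_measurable_deriv_sq[OF f(1,2)] A(1)
    have "(\<lambda>z. (ennreal ((cmod (deriv f z))\<^sup>2) * indicator S z) * indicator A z) \<in> borel_measurable borel"
      by measurable
    then show ?thesis
      by (rule measurable_cong[THEN iffD1, rotated]) (use A(2) in \<open>auto simp: indicator_def\<close>)
  qed
  have eq: "(\<integral>\<^sup>+z. ennreal ((cmod (deriv f z))\<^sup>2) * indicator A z \<partial>lborel) = (\<integral>\<^sup>+x. ennreal (h x) * indicator A' x \<partial>lborel)"
    by (subst nn_integral_vec2_to_complex[OF meas, symmetric]) (simp add: h_def A'_def indicator_def vimage_def)
  have meas': "(\<lambda>x. ennreal (h x) * indicator A' x) \<in> borel_measurable borel"
    using measurable_compose[OF borel_measurable_vec2_complex(1) meas]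
    by (simp add: h_def A'_def indicator_def vimage_def)
  have "emeasure lborel (F ` A') = (\<integral>\<^sup>+x. ennreal (h x) * indicator A' x \<partial>lborel)"
  \<comment> \<open>The area formula says that the image has finite measure iff \<open>h\<close> is
    integrable, and only then gives the value. In the other case both sides are shown to be
    infinite.\<close>
  proof (cases "h integrable_on A'")
    case True
    then obtain m where m: "(h has_integral m) A'"
      by blast
    then have "F ` A' \<in> lmeasurable" "measure lebesgue (F ` A') = m"
      using key by auto
    then have "emeasure lebesgue (F ` A') = ennreal m"
      by (metis emeasure_eq_measure2 )
    moreover have "(\<integral>\<^sup>+x. ennreal (indicator A' x * h x) \<partial>lborel) = ennreal m"
      by (rule nn_integral_has_integral_lebesgue[OF _ m]) (simp add: h_def)
    ultimately show ?thesis
      by (simp add: ennreal_mult'' mult.commute ennreal_indicator)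
  next
    case False
    then have "F ` A' \<notin> lmeasurable"
      using key by blast
    then have 1: "emeasure lborel (F ` A') = \<infinity>"
      by (simp add: fmeasurable_def less_top[symmetric] )
    have "(\<integral>\<^sup>+x. ennreal (h x) * indicator A' x \<partial>lborel) = \<infinity>"
    proof (rule ccontr)
      assume "\<not> ?thesis"
      then have fin: "(\<integral>\<^sup>+x. ennreal (h x * indicator A' x) \<partial>lborel) < \<infinity>"
        by (simp add: ennreal_mult'' ennreal_indicator less_top)
      have "(\<lambda>x. enn2real (ennreal (h x) * indicator A' x)) \<in> borel_measurable borel"
        using meas' by measurable
      also have "(\<lambda>x. enn2real (ennreal (h x) * indicator A' x)) = (\<lambda>x. h x * indicator A' x)"
        by (auto simp: fun_eq_iff indicator_def h_def)
      finally have "integrable lborel (\<lambda>x. h x * indicator A' x)"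
        using fin by (intro integrableI_nonneg) (auto simp: h_def indicator_def)
      then have "(\<lambda>x. h x * indicator A' x) integrable_on UNIV"
        by (rule integrable_on_lborel)
      also have "(\<lambda>x. h x * indicator A' x) = (\<lambda>x. if x \<in> A' then h x else 0)"
        by (auto simp: indicator_def fun_eq_iff)
      finally have "h integrable_on A'"
        by (simp add: integrable_restrict_UNIV)
      with False show False ..
    qed
    with 1 show ?thesis by simp
  qed
  then show ?thesis
    unfolding eq img by (simp add: emeasure_vec2_to_complex_vimage[OF A(3)])
qed

text \<open>The density given by the squared modulus of the derivative on \<open>S\<close> is pushed
  forward by \<open>f\<close> to Lebesgue measure on the image.
  \<open>emeasure_holomorphic_image\<close> verifies this on sets, and equal measures have equal
  integrals.\<close>

lemma nn_integral_holomorphic_image: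
  assumes f: "f holomorphic_on S" "open S" "inj_on f S"
    and [measurable]: "f \<in> borel_measurable borel" "f ` S \<in> sets borel" "u \<in> borel_measurable borel"
  shows "(\<integral>\<^sup>+z. u (f z) * (ennreal ((cmod (deriv f z))\<^sup>2) * indicator S z) \<partial>lborel) =
    (\<integral>\<^sup>+y. u y * indicator (f ` S) y \<partial>lborel)"
proof -
  define J where "J z = ennreal ((cmod (deriv f z))\<^sup>2) * indicator S z" for z
  have [measurable]: "J \<in> borel_measurable borel"
    unfolding J_def[abs_def] by (rule borel_measurable_deriv_sq[OF f(1,2)])
  have [measurable]: "S \<in> sets borel"
    using f(2) by simp
  have "distr (density lborel J) borel f = density lborel (indicator (f ` S))"
  proof (rule measure_eqI)
    fix B assume "B \<in> sets (distr (density lborel J) borel f)"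
    then have B[measurable]: "B \<in> sets borel"
      by simp
    have fB[measurable]: "f -` B \<in> sets borel"
      by (rule measurable_sets_borel[OF assms(4) B])
    have im: "f ` (S \<inter> f -` B) = f ` S \<inter> B"
      by auto
    have "emeasure (distr (density lborel J) borel f) B = (\<integral>\<^sup>+z. J z * indicator (f -` B) z \<partial>lborel)"
      by (simp add: emeasure_distr emeasure_density)
    also have "\<dots> = (\<integral>\<^sup>+z. ennreal ((cmod (deriv f z))\<^sup>2) * indicator (S \<inter> f -` B) z \<partial>lborel)"
      by (intro nn_integral_cong) (auto simp: J_def indicator_def)
    also have "\<dots> = emeasure lborel (f ` (S \<inter> f -` B))"
      by (rule emeasure_holomorphic_image[symmetric, OF f]) (use im in simp_all)
    also have "\<dots> = emeasure (density lborel (indicator (f ` S))) B"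
      by (subst emeasure_density) (simp_all add: im indicator_inter_arith[symmetric])
    finally show "emeasure (distr (density lborel J) borel f) B = emeasure (density lborel (indicator (f ` S))) B" .
  qed simp
  then have "integral\<^sup>N (distr (density lborel J) borel f) u = integral\<^sup>N (density lborel (indicator (f ` S))) u"
    by simp
  then show ?thesis
    unfolding J_def[symmetric] by (simp add: nn_integral_distr nn_integral_density mult.commute[of "u _"])
qed

subsection \<open>The hyperbolic measure\<close>

text \<open>Hyperbolic area in the normalization of curvature -4, which is the density that the
  fiber integral produces. It is a measure on the whole plane that vanishes off the disc, so that
  measurability can be stated over \<open>borel\<close>.\<close>

definition hyp :: "complex measure" where
  "hyp = density lborel (\<lambda>z. ennreal (1 / (1 - (cmod z)\<^sup>2)\<^sup>2) * indicator unit_disc z)"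

lemma unit_disc_borel [measurable]: "unit_disc \<in> sets borel"
  by simp

lemma sets_hyp [simp, measurable_cong]: "sets hyp = sets borel"
  by (simp add: hyp_def)

lemma space_hyp [simp]: "space hyp = UNIV"
  by (simp add: hyp_def)

lemma nn_integral_hyp:
  assumes [measurable]: "u \<in> borel_measurable borel"
  shows "integral\<^sup>N hyp u = (\<integral>\<^sup>+z. ennreal (1 / (1 - (cmod z)\<^sup>2)\<^sup>2) * indicator unit_disc z * u z \<partial>lborel)"
  unfolding hyp_def by (rule nn_integral_density) measurable

lemma AE_hyp_iff: "(AE z in hyp. P z) \<longleftrightarrow> (AE z in lborel. z \<in> unit_disc \<longrightarrow> P z)"
proof -
  have "1 - (cmod z)\<^sup>2 \<noteq> 0" if "cmod z < 1" for z
    using that abs_square_less_1[of "cmod z"] by auto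
  then have *: "0 < ennreal (1 / (1 - (cmod z)\<^sup>2)\<^sup>2) * indicator unit_disc z \<longleftrightarrow> z \<in> unit_disc" for z
    by (auto simp: indicator_def)
  show ?thesis
    unfolding hyp_def by (subst AE_density) (auto simp: * simp del: mem_ball)
qed

lemma AE_hyp_unit_disc: "AE z in hyp. z \<in> unit_disc"
  by (simp add: AE_hyp_iff)

lemma sigma_finite_hyp: "sigma_finite_measure hyp"
  unfolding hyp_def
  by (subst sigma_finite_measure.sigma_finite_iff_density_finite[OF sigma_finite_lborel]) (auto simp: ennreal_mult_eq_top_iff indicator_def)

interpretation hyp: sigma_finite_measure hyp
  by (rule sigma_finite_hyp)

section \<open>Moebius automorphisms of the disc and invariance of hyperbolic area\<close>

lemma su11_den:
  assumes "(a, b) \<in> su11" "z \<in> unit_disc"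
  shows "cnj b * z + cnj a \<noteq> 0"
proof
  assume 0: "cnj b * z + cnj a = 0"
  then have "cmod a = cmod b * cmod z"
    by (metis add_eq_0_iff complex_mod_cnj norm_minus_cancel norm_mult)
  also have "\<dots> \<le> cmod b"
    using assms(2) by (simp add: mult_left_le)
  finally have "(cmod a)\<^sup>2 \<le> (cmod b)\<^sup>2"
    by (simp add: power_mono)
  with assms(1) show False
    by (simp add: su11_def)
qed

text \<open>Polarised form of \<open>1 - \<bar>m z\<bar>\<^sup>2 = (1 - \<bar>z\<bar>\<^sup>2) \<bar>m' z\<bar>\<close> for a disc automorphism \<open>m\<close>.\<close>

lemma su11_polarized:
  assumes "(a, b) \<in> su11" "z \<in> unit_disc" "w \<in> unit_disc"
  shows "1 - cnj ((a * w + b) / (cnj b * w + cnj a)) * ((a * z + b) / (cnj b * z + cnj a)) =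
    (1 - cnj w * z) / (cnj (cnj b * w + cnj a) * (cnj b * z + cnj a))"
proof -
  have d: "cnj b * z + cnj a \<noteq> 0" "cnj (cnj b * w + cnj a) \<noteq> 0"
    using su11_den[OF assms(1,2)] su11_den[OF assms(1,3)] by (simp_all only: complex_cnj_zero_iff not_False_eq_True)
  have "a * cnj a - b * cnj b = 1"
    using assms(1) by (simp add: su11_def complex_norm_square[symmetric] of_real_diff[symmetric] del: of_real_diff of_real_power)
  then have "cnj (cnj b * w + cnj a) * (cnj b * z + cnj a) - cnj (a * w + b) * (a * z + b) = 1 - cnj w * z"
    by (simp, algebra)
  with d show ?thesis
    by (simp add: divide_simps)
qed

lemma cmod_sq_eq: "complex_of_real (1 - (cmod z)\<^sup>2) = 1 - cnj z * z"
  by (simp add: complex_norm_square mult.commute del: of_real_power)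

lemma su11_one_minus_cmod_sq:
  assumes "(a, b) \<in> su11" "z \<in> unit_disc"
  shows "1 - (cmod ((a * z + b) / (cnj b * z + cnj a)))\<^sup>2 = (1 - (cmod z)\<^sup>2) / (cmod (cnj b * z + cnj a))\<^sup>2"
proof -
  have "complex_of_real (1 - (cmod ((a * z + b) / (cnj b * z + cnj a)))\<^sup>2) =
      complex_of_real ((1 - (cmod z)\<^sup>2) / (cmod (cnj b * z + cnj a))\<^sup>2)"
    unfolding cmod_sq_eq su11_polarized[OF assms(1,2,2)] of_real_divide
    by (simp only: complex_norm_square mult.commute)
  then show ?thesis
    using of_real_eq_iff by blast
qed

lemma su11_maps_disc:
  assumes "(a, b) \<in> su11" "z \<in> unit_disc"
  shows "(a * z + b) / (cnj b * z + cnj a) \<in> unit_disc"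
proof -
  have "(cmod z)\<^sup>2 < 1"
    using assms(2) by (simp add: abs_square_less_1)
  then have "1 - (cmod ((a * z + b) / (cnj b * z + cnj a)))\<^sup>2 > 0"
    unfolding su11_one_minus_cmod_sq[OF assms] using su11_den[OF assms] by (simp del: norm_divide)
  then show ?thesis
    by (simp add: abs_square_less_1 del: norm_divide)
qed

lemma su11_has_field_derivative:
  assumes "(a, b) \<in> su11" "z \<in> unit_disc"
  shows "((\<lambda>z. (a * z + b) / (cnj b * z + cnj a)) has_field_derivative 1 / (cnj b * z + cnj a)\<^sup>2) (at z)"
proof -
  have "a * cnj a - b * cnj b = 1"
    using assms(1) by (simp add: su11_def complex_norm_square[symmetric] of_real_diff[symmetric] del: of_real_diff of_real_power)
  then have "a * (cnj b * z + cnj a) - (a * z + b) * cnj b = 1"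
    by algebra
  then show ?thesis
    using su11_den[OF assms] by (auto intro!: derivative_eq_intros simp: power2_eq_square)
qed

lemma PSU11_cases:
  assumes "g \<in> PSU11"
  obtains a b where "(a, b) \<in> su11" "g = (\<lambda>z\<in>unit_disc. (a * z + b) / (cnj b * z + cnj a))"
  using assms by (auto simp: PSU11_def su11_action_def)

lemma PSU11_borel_measurable [measurable_dest]:
  assumes "g \<in> PSU11"
  shows "g \<in> borel_measurable borel"
proof -
  obtain a b where g: "g = (\<lambda>z\<in>unit_disc. (a * z + b) / (cnj b * z + cnj a))"
    using assms by (rule PSU11_cases)
  show ?thesis
    unfolding g restrict_def by measurable
qed

lemma PSU11_maps_disc: "g \<in> PSU11 \<Longrightarrow> z \<in> unit_disc \<Longrightarrow> g z \<in> unit_disc"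
  by (erule PSU11_cases) (use su11_maps_disc in auto)

text \<open>The modulus of the derivative is the case of equality in the Schwarz-Pick lemma. The
  invariance of \<open>hyp\<close> and that of \<open>WP_density\<close> both rest on it.\<close>

lemma PSU11_has_field_derivative:
  assumes "g \<in> PSU11" "z \<in> unit_disc"
  shows "(g has_field_derivative deriv g z) (at z)"
    and "cmod (deriv g z) = (1 - (cmod (g z))\<^sup>2) / (1 - (cmod z)\<^sup>2)"
proof -
  obtain a b where ab: "(a, b) \<in> su11" and g: "g = (\<lambda>z\<in>unit_disc. (a * z + b) / (cnj b * z + cnj a))"
    using assms(1) by (rule PSU11_cases)
  have *: "(g has_field_derivative 1 / (cnj b * z + cnj a)\<^sup>2) (at z)"
    using su11_has_field_derivative[OF ab assms(2)]
    by (rule has_field_derivative_transform_within_open[where S = unit_disc]) (use assms(2) g in auto)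
  then show "(g has_field_derivative deriv g z) (at z)"
    by (simp add: DERIV_imp_deriv)
  have "(cmod z)\<^sup>2 < 1"
    using assms(2) by (simp add: abs_square_less_1)
  moreover have "1 - (cmod (g z))\<^sup>2 = (1 - (cmod z)\<^sup>2) / (cmod (cnj b * z + cnj a))\<^sup>2"
    using su11_one_minus_cmod_sq[OF ab assms(2)] assms(2) by (simp add: g)
  ultimately show "cmod (deriv g z) = (1 - (cmod (g z))\<^sup>2) / (1 - (cmod z)\<^sup>2)"
    using DERIV_imp_deriv[OF *] by (simp add: norm_divide norm_power)
qed

lemma PSU11_holomorphic: "g \<in> PSU11 \<Longrightarrow> g holomorphic_on unit_disc"
  unfolding holomorphic_on_open[OF open_ball] using PSU11_has_field_derivative(1) by blast

text \<open>The matrix has determinant 1, so its inverse is the adjugate, with first row (cnj a, -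
  b).\<close>

lemma su11_action_inverse:
  assumes ab: "(a, b) \<in> su11" and z: "z \<in> unit_disc"
  shows "su11_action (cnj a, - b) (su11_action (a, b) z) = z"
proof -
  have den: "cnj b * z + cnj a \<noteq> 0"
    by (rule su11_den[OF assms])
  have "a * cnj a - b * cnj b = 1"
    using assms(1) by (simp add: su11_def complex_norm_square[symmetric] of_real_diff[symmetric] del: of_real_diff of_real_power)
  then have "cnj a * (a * z + b) - b * (cnj b * z + cnj a) = z" "a * (cnj b * z + cnj a) - cnj b * (a * z + b) = 1"
    by algebra+
  with den su11_maps_disc[OF assms] z show ?thesis
    by (simp add: su11_action_def divide_simps mult.commute del: mem_ball)
qed

lemma PSU11_inverse:
  assumes "g \<in> PSU11"
  obtains h where "h \<in> PSU11" "\<And>z. z \<in> unit_disc \<Longrightarrow> h (g z) = z" "\<And>z. z \<in> unit_disc \<Longrightarrow> g (h z) = z"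
proof -
  obtain a b where ab: "(a, b) \<in> su11" "g = su11_action (a, b)"
    using assms by (auto simp: PSU11_def)
  then have ba: "(cnj a, - b) \<in> su11"
    by (simp add: su11_def)
  show ?thesis
    using that[of "su11_action (cnj a, - b)"] su11_action_inverse[OF ab(1)] su11_action_inverse[OF ba] ba ab(2)
    by (auto simp: PSU11_def)
qed

lemma PSU11_image_disc:
  assumes "g \<in> PSU11"
  shows "g ` unit_disc = unit_disc"
proof -
  obtain h where h: "h \<in> PSU11" "\<And>z. z \<in> unit_disc \<Longrightarrow> g (h z) = z"
    using PSU11_inverse[OF assms] by metis
  show ?thesis
  proof
    show "g ` unit_disc \<subseteq> unit_disc"
      using PSU11_maps_disc[OF assms] by blast
    show "unit_disc \<subseteq> g ` unit_disc"
      using PSU11_maps_disc[OF h(1)] h(2) by (metis image_eqI subsetI)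
  qed
qed

lemma PSU11_inj_on:
  assumes "g \<in> PSU11"
  shows "inj_on g unit_disc"
proof -
  obtain h where "\<And>z. z \<in> unit_disc \<Longrightarrow> h (g z) = z"
    using PSU11_inverse[OF assms] by metis
  then show ?thesis
    by (rule inj_on_inverseI)
qed

text \<open>By Schwarz-Pick equality the Jacobian, the squared modulus of \<open>deriv g\<close>, is
  exactly the quotient of the densities of \<open>hyp\<close> at \<open>z\<close> and at
  \<open>g z\<close>.\<close>

lemma nn_integral_hyp_PSU11:
  assumes g: "g \<in> PSU11" and u[measurable]: "u \<in> borel_measurable borel"
  shows "(\<integral>\<^sup>+z. u (g z) \<partial>hyp) = (\<integral>\<^sup>+z. u z \<partial>hyp)"
proof -
  note [measurable] = PSU11_borel_measurable[OF g]
  define U where "U = (\<lambda>z. ennreal (1 / (1 - (cmod z)\<^sup>2)\<^sup>2) * u z)"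
  have [measurable]: "U \<in> borel_measurable borel"
    unfolding U_def by measurable
  have J: "ennreal (1 / (1 - (cmod z)\<^sup>2)\<^sup>2) = ennreal (1 / (1 - (cmod (g z))\<^sup>2)\<^sup>2) * ennreal ((cmod (deriv g z))\<^sup>2)"
    if "z \<in> unit_disc" for z
  proof -
    have "(cmod (g z))\<^sup>2 < 1"
      using PSU11_maps_disc[OF g that] by (simp add: abs_square_less_1)
    then show ?thesis
      using PSU11_has_field_derivative(2)[OF g that]
      by (simp add: ennreal_mult'[symmetric] power_divide)
  qed
  have "(\<integral>\<^sup>+z. u (g z) \<partial>hyp) = (\<integral>\<^sup>+z. U (g z) * (ennreal ((cmod (deriv g z))\<^sup>2) * indicator unit_disc z) \<partial>lborel)"
    by (subst nn_integral_hyp) (auto intro!: nn_integral_cong simp: indicator_def J U_def mult_ac)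
  also have "\<dots> = (\<integral>\<^sup>+y. U y * indicator (g ` unit_disc) y \<partial>lborel)"
    by (rule nn_integral_holomorphic_image) (use g in \<open>auto simp: PSU11_holomorphic PSU11_inj_on PSU11_image_disc\<close>)
  also have "\<dots> = (\<integral>\<^sup>+z. u z \<partial>hyp)"
    unfolding PSU11_image_disc[OF g] by (subst nn_integral_hyp) (auto intro!: nn_integral_cong simp: U_def mult_ac)
  finally show ?thesis .
qed

subsection \<open>Unfolding\<close>

text \<open>A member of a countable basis that isolates a point of \<open>X\<close> determines this
  point, so that choosing one for each point embeds \<open>X\<close> into the basis.\<close>

lemma discrete_imp_countable:
  fixes X :: "'a::second_countable_topology set"
  assumes "discrete X"
  shows "countable X"
proof -
  obtain B :: "'a set set" where B: "countable B" "topological_basis B"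
    using ex_countable_basis by blast
  have "\<exists>b\<in>B. b \<inter> X = {x}" if x: "x \<in> X" for x
  proof -
    obtain T where T: "open T" "T \<inter> X = {x}"
      using discreteD[OF assms x] by (auto simp: isolated_in_def)
    then obtain b where "b \<in> B" "x \<in> b" "b \<subseteq> T"
      using topological_basisE[OF B(2) T(1), of x] by blast
    with T x show ?thesis
      by blast
  qed
  then obtain b where b: "\<And>x. x \<in> X \<Longrightarrow> b x \<in> B \<and> b x \<inter> X = {x}"
    by metis
  then have "inj_on b X"
    by (intro inj_onI) (metis singleton_inject)
  moreover have "countable (b ` X)"
    using b by (intro countable_subset[OF _ B(1)]) auto
  ultimately show ?thesis
    by (simp add: countable_image_inj_eq)
qed

locale fuchsian =
  fixes \<Gamma> :: "(complex \<Rightarrow> complex) set"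
  assumes fuchsian: "fuchsian_group \<Gamma>"
begin

lemma PSU: "\<gamma> \<in> \<Gamma> \<Longrightarrow> \<gamma> \<in> PSU11"
  using fuchsian by (auto simp: fuchsian_group_def)

lemma maps_disc: "\<gamma> \<in> \<Gamma> \<Longrightarrow> z \<in> unit_disc \<Longrightarrow> \<gamma> z \<in> unit_disc"
  by (rule PSU11_maps_disc[OF PSU])

text \<open>Discreteness is a condition on the preimage in SU(1,1), from which countability passes
  to the image. It is needed to exchange sums over the group with integrals and to form unions of
  null sets.\<close>

lemma countable_group: "countable \<Gamma>"
proof -
  have "countable {m \<in> su11. su11_action m \<in> \<Gamma>}"
    using fuchsian by (intro discrete_imp_countable) (auto simp: fuchsian_group_def)
  then have "countable (su11_action ` {m \<in> su11. su11_action m \<in> \<Gamma>})"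
    by (rule countable_image)
  moreover have "\<Gamma> \<subseteq> su11_action ` {m \<in> su11. su11_action m \<in> \<Gamma>}"
    using PSU by (fastforce simp: PSU11_def)
  ultimately show ?thesis
    by (rule countable_subset[rotated])
qed

text \<open>The inverse in \<open>BijGroup unit_disc\<close>, written out with its restriction to
  the disc because group elements are extensional functions.\<close>

definition ginv :: "(complex \<Rightarrow> complex) \<Rightarrow> complex \<Rightarrow> complex" where
  "ginv \<gamma> = (\<lambda>z\<in>unit_disc. inv_into unit_disc \<gamma> z)"

lemma group_subgroup: "subgroup \<Gamma> (BijGroup unit_disc)"
  using fuchsian by (simp add: fuchsian_group_def)

lemma Bij: "\<gamma> \<in> \<Gamma> \<Longrightarrow> \<gamma> \<in> Bij unit_disc"
  using subgroup.subset[OF group_subgroup] by (auto simp: BijGroup_def)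

lemma ginv_in: "\<gamma> \<in> \<Gamma> \<Longrightarrow> ginv \<gamma> \<in> \<Gamma>"
  using subgroup.m_inv_closed[OF group_subgroup, of \<gamma>] inv_BijGroup[OF Bij, of \<gamma>] by (simp add: ginv_def)

lemma compose_in: "\<gamma> \<in> \<Gamma> \<Longrightarrow> \<delta> \<in> \<Gamma> \<Longrightarrow> compose unit_disc \<gamma> \<delta> \<in> \<Gamma>"
  using subgroup.m_closed[OF group_subgroup, of \<gamma> \<delta>] Bij by (simp add: BijGroup_def)

lemma ginv_left: "\<gamma> \<in> \<Gamma> \<Longrightarrow> z \<in> unit_disc \<Longrightarrow> ginv \<gamma> (\<gamma> z) = z"
  unfolding ginv_def using maps_disc PSU11_inj_on[OF PSU] by (metis inv_into_f_f restrict_apply')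

lemma ginv_right: "\<gamma> \<in> \<Gamma> \<Longrightarrow> z \<in> unit_disc \<Longrightarrow> \<gamma> (ginv \<gamma> z) = z"
  unfolding ginv_def using PSU11_image_disc[OF PSU] by (metis f_inv_into_f restrict_apply')

lemma group_eqI:
  assumes "\<gamma> \<in> \<Gamma>" "\<delta> \<in> \<Gamma>" "\<And>z. z \<in> unit_disc \<Longrightarrow> \<gamma> z = \<delta> z"
  shows "\<gamma> = \<delta>"
  using Bij[OF assms(1)] Bij[OF assms(2)] assms(3) by (auto simp: Bij_def intro: extensionalityI)

lemma bij_betw_ginv: "bij_betw ginv \<Gamma> \<Gamma>"
proof (rule bij_betwI[where g = ginv])
  show "ginv (ginv \<gamma>) = \<gamma>" if "\<gamma> \<in> \<Gamma>" for \<gamma>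
    using that ginv_left ginv_right ginv_in maps_disc by (intro group_eqI) metis+
  then show "ginv (ginv \<gamma>) = \<gamma>" if "\<gamma> \<in> \<Gamma>" for \<gamma>
    using that by blast
qed (use ginv_in in auto)

text \<open>A Borel fundamental domain in the form that unfolding needs. Uniqueness is required of
  the group element and not only of the point \<gamma> w, so that the indicators of \<open>F\<close>
  at the points \<gamma> w add up to 1 almost everywhere.\<close>

definition tile :: "complex set \<Rightarrow> bool" where
  "tile F \<longleftrightarrow> F \<in> sets borel \<and> F \<subseteq> unit_disc \<and> (AE w in hyp. \<exists>!\<gamma>. \<gamma> \<in> \<Gamma> \<and> \<gamma> w \<in> F)"

lemma negligible_image:
  assumes "\<gamma> \<in> \<Gamma>" "negligible N" "N \<subseteq> unit_disc"
  shows "negligible (\<gamma> ` N)"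
proof (rule negligible_differentiable_image_negligible)
  show "\<gamma> differentiable_on N"
    unfolding differentiable_on_def
  proof
    fix x assume "x \<in> N"
    with assms(3) have x: "x \<in> unit_disc"
      by blast
    have "(\<gamma> has_derivative (*) (deriv \<gamma> x)) (at x)"
      using PSU11_has_field_derivative(1)[OF PSU[OF assms(1)] x]
      unfolding has_field_derivative_def .
    then show "\<gamma> differentiable (at x within N)"
      by (rule differentiable_at_withinI[OF differentiableI])
  qed
  show "negligible N"
    by fact
qed simp

text \<open>A Lebesgue set contains an \<open>fsigma\<close> set with null complement in it.
  Removing the null part from \<open>F\<close> spoils covering and disjointness only on a null set
  of points, since the group is countable and its elements map null sets to null sets.\<close>

lemma fundamental_domain_tile:
  assumes "fundamental_domain \<Gamma> F"
  obtains C where "tile C" "C \<subseteq> F" "negligible (F - C)"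
proof -
  have F: "F \<in> sets lebesgue" "F \<subseteq> unit_disc" "negligible (unit_disc - (\<Union>\<gamma>\<in>\<Gamma>. \<gamma> ` F))"
    and disj: "\<And>\<gamma>. \<gamma> \<in> \<Gamma> \<Longrightarrow> \<gamma> \<noteq> (\<lambda>z\<in>unit_disc. z) \<Longrightarrow> negligible (\<gamma> ` F \<inter> F)"
    using assms by (auto simp: fundamental_domain_def)
  obtain C N where C: "fsigma C" "N \<in> null_sets lebesgue" "C \<union> N = F" "disjnt C N"
    using lebesgue_set_almost_fsigma[OF F(1)] .
  \<comment> \<open>The exceptional points: those outside all translates of \<open>F\<close>, those
    in a translate of the null part \<open>N\<close>, and those moved into \<open>F\<close> by two
    different elements \<gamma> and \<delta>. A point \<open>w\<close> of the last kind has \<gamma>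
    w in the overlap of \<open>F\<close> with its translate by the composite of \<gamma> and the
    inverse of \<delta>.\<close>
  define E where "E = (unit_disc - (\<Union>\<gamma>\<in>\<Gamma>. \<gamma> ` F)) \<union> (\<Union>\<gamma>\<in>\<Gamma>. \<gamma> ` N) \<union>
    (\<Union>(\<gamma>, \<delta>)\<in>{(\<gamma>, \<delta>)\<in>\<Gamma> \<times> \<Gamma>. \<gamma> \<noteq> \<delta>}. ginv \<gamma> ` (compose unit_disc \<gamma> (ginv \<delta>) ` F \<inter> F))"
  have N: "negligible N" "N \<subseteq> unit_disc"
    using C F(2) by (auto simp: negligible_iff_null_sets)
  have "negligible E"
    unfolding E_def
  proof (intro negligible_Un F(3))
    show "negligible (\<Union>\<gamma>\<in>\<Gamma>. \<gamma> ` N)"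
      using countable_group N negligible_image by (intro negligible_countable_Union) auto
    have neg: "negligible (ginv \<gamma> ` (compose unit_disc \<gamma> (ginv \<delta>) ` F \<inter> F))" if "\<gamma> \<in> \<Gamma>" "\<delta> \<in> \<Gamma>" "\<gamma> \<noteq> \<delta>" for \<gamma> \<delta>
    proof (rule negligible_image[OF ginv_in[OF that(1)]])
      have "compose unit_disc \<gamma> (ginv \<delta>) \<noteq> (\<lambda>z\<in>unit_disc. z)"
      proof
        assume *: "compose unit_disc \<gamma> (ginv \<delta>) = (\<lambda>z\<in>unit_disc. z)"
        have "\<gamma> z = \<delta> z" if z: "z \<in> unit_disc" for z
          using fun_cong[OF *, of "\<delta> z"] maps_disc[OF \<open>\<delta> \<in> \<Gamma>\<close> z] ginv_left[OF \<open>\<delta> \<in> \<Gamma>\<close> z]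
          by (simp add: compose_def)
        with that show False
          using group_eqI by blast
      qed
      then show "negligible (compose unit_disc \<gamma> (ginv \<delta>) ` F \<inter> F)"
        using that by (intro disj compose_in ginv_in)
    qed (use F(2) in blast)
    have cnt: "countable {(\<gamma>, \<delta>)\<in>\<Gamma> \<times> \<Gamma>. \<gamma> \<noteq> \<delta>}"
      by (rule countable_subset[of _ "\<Gamma> \<times> \<Gamma>"]) (use countable_group in auto)
    show "negligible (\<Union>(\<gamma>, \<delta>)\<in>{(\<gamma>, \<delta>)\<in>\<Gamma> \<times> \<Gamma>. \<gamma> \<noteq> \<delta>}. ginv \<gamma> ` (compose unit_disc \<gamma> (ginv \<delta>) ` F \<inter> F))"
    proof (rule negligible_countable_Union[OF countable_image[OF cnt]])
      fix S
      assume "S \<in> (\<lambda>(\<gamma>, \<delta>). ginv \<gamma> ` (compose unit_disc \<gamma> (ginv \<delta>) ` F \<inter> F)) ` {(\<gamma>, \<delta>)\<in>\<Gamma> \<times> \<Gamma>. \<gamma> \<noteq> \<delta>}"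
      then obtain \<gamma> \<delta> where "\<gamma> \<in> \<Gamma>" "\<delta> \<in> \<Gamma>" "\<gamma> \<noteq> \<delta>"
        "S = ginv \<gamma> ` (compose unit_disc \<gamma> (ginv \<delta>) ` F \<inter> F)"
        by auto
      then show "negligible S"
        using neg by simp
    qed
  qed
  then have AE_E: "AE w in lborel. w \<notin> E"
    by (subst AE_completion_iff[symmetric], intro AE_not_in) (simp add: negligible_iff_null_sets)
  have uniq: "\<exists>!\<gamma>. \<gamma> \<in> \<Gamma> \<and> \<gamma> w \<in> C" if w: "w \<notin> E" "w \<in> unit_disc" for w
  proof -
    obtain \<gamma> x where \<gamma>: "\<gamma> \<in> \<Gamma>" "x \<in> F" "w = \<gamma> x"
    proof -
      have "w \<in> (\<Union>\<gamma>\<in>\<Gamma>. \<gamma> ` F)"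
        using w unfolding E_def by blast
      then show thesis
        using that by blast
    qed
    have "w \<notin> (\<Union>\<gamma>\<in>\<Gamma>. \<gamma> ` N)"
      using w(1) unfolding E_def by blast
    with \<gamma> have "x \<notin> N"
      by blast
    with \<gamma>(2) C(3) have "x \<in> C"
      by blast
    moreover have "ginv \<gamma> w = x"
      unfolding \<gamma>(3) using F(2) \<gamma>(2) by (intro ginv_left[OF \<gamma>(1)]) blast
    \<comment> \<open>Covering writes \<open>w\<close> as the image of a point of the domain, while
      \<open>tile\<close> asks for an element that moves \<open>w\<close> into it; hence the
      inverse.\<close>
    ultimately have "ginv \<gamma> \<in> \<Gamma> \<and> ginv \<gamma> w \<in> C"
      using ginv_in[OF \<gamma>(1)] by simp
    moreover have "\<gamma> = \<delta>" if "\<gamma> \<in> \<Gamma>" "\<gamma> w \<in> C" "\<delta> \<in> \<Gamma>" "\<delta> w \<in> C" for \<gamma> \<delta>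
    proof (rule ccontr)
      assume ne: "\<gamma> \<noteq> \<delta>"
      have "\<gamma> w = compose unit_disc \<gamma> (ginv \<delta>) (\<delta> w)"
        using maps_disc[OF that(3) w(2)] ginv_left[OF that(3) w(2)] by (simp add: compose_def)
      then have "\<gamma> w \<in> compose unit_disc \<gamma> (ginv \<delta>) ` F \<inter> F"
        using that C(3) by blast
      then have "w \<in> ginv \<gamma> ` (compose unit_disc \<gamma> (ginv \<delta>) ` F \<inter> F)"
        using ginv_left[OF that(1) w(2)] by (metis image_eqI)
      then have "w \<in> (\<Union>(\<gamma>, \<delta>)\<in>{(\<gamma>, \<delta>)\<in>\<Gamma> \<times> \<Gamma>. \<gamma> \<noteq> \<delta>}. ginv \<gamma> ` (compose unit_disc \<gamma> (ginv \<delta>) ` F \<inter> F))"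
        using that ne by (intro UN_I[of "(\<gamma>, \<delta>)"]) simp_all
      then have "w \<in> E"
        unfolding E_def by (rule UnI2)
      with w show False
        by blast
    qed
    ultimately show ?thesis
      by blast
  qed
  have "AE w in hyp. \<exists>!\<gamma>. \<gamma> \<in> \<Gamma> \<and> \<gamma> w \<in> C"
    unfolding AE_hyp_iff by (rule eventually_mono[OF AE_E]) (use uniq in blast)
  moreover have "C \<in> sets borel"
    using C(1) by cases auto
  ultimately have "tile C"
    using C(3) F(2) by (auto simp: tile_def)
  moreover have "negligible (F - C)"
    using C(3) by (intro negligible_subset[OF N(1)]) auto
  ultimately show ?thesis
    using C(3) by (intro that) auto
qed

text \<open>Inserts the factor 1, written as the sum over the group of the indicator of
  \<open>F\<close> at \<gamma> w, and exchanges this countable sum with the integral.\<close>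

lemma tile_unfold:
  assumes "tile F" and [measurable]: "u \<in> borel_measurable borel"
  shows "(\<integral>\<^sup>+w. u w \<partial>hyp) = (\<integral>\<^sup>+\<gamma>. (\<integral>\<^sup>+w. indicator F (\<gamma> w) * u w \<partial>hyp) \<partial>count_space \<Gamma>)"
proof -
  have [measurable]: "F \<in> sets borel" and ex1: "AE w in hyp. \<exists>!\<gamma>. \<gamma> \<in> \<Gamma> \<and> \<gamma> w \<in> F"
    using assms by (auto simp: tile_def)
  have "(\<integral>\<^sup>+\<gamma>. indicator F (\<gamma> w) * u w \<partial>count_space \<Gamma>) = u w"
    if ex: "\<exists>!\<gamma>. \<gamma> \<in> \<Gamma> \<and> \<gamma> w \<in> F" for w
  proof -
    obtain \<gamma> where \<gamma>: "\<gamma> \<in> \<Gamma>" "\<gamma> w \<in> F" "\<And>\<delta>. \<delta> \<in> \<Gamma> \<Longrightarrow> \<delta> w \<in> F \<Longrightarrow> \<delta> = \<gamma>"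
      using ex by blast
    have "(\<integral>\<^sup>+\<delta>. indicator F (\<delta> w) * u w \<partial>count_space \<Gamma>) = (\<integral>\<^sup>+\<delta>. u w * indicator {\<gamma>} \<delta> \<partial>count_space \<Gamma>)"
    proof (rule nn_integral_cong)
      fix \<delta> assume "\<delta> \<in> space (count_space \<Gamma>)"
      then have "\<delta> w \<in> F \<longleftrightarrow> \<delta> = \<gamma>"
        using \<gamma>(2) \<gamma>(3)[of \<delta>] by auto
      then show "indicator F (\<delta> w) * u w = u w * indicator {\<gamma>} \<delta>"
        by (simp add: indicator_def)
    qed
    also have "\<dots> = u w"
      using \<gamma>(1) by simp
    finally show ?thesis .
  qed
  then have "(\<integral>\<^sup>+w. u w \<partial>hyp) = (\<integral>\<^sup>+w. (\<integral>\<^sup>+\<gamma>. indicator F (\<gamma> w) * u w \<partial>count_space \<Gamma>) \<partial>hyp)"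
    by (intro nn_integral_cong_AE eventually_mono[OF ex1]) simp
  also have "\<dots> = (\<integral>\<^sup>+\<gamma>. (\<integral>\<^sup>+w. indicator F (\<gamma> w) * u w \<partial>hyp) \<partial>count_space \<Gamma>)"
  proof (rule nn_integral_count_space_nn_integral[OF countable_group])
    fix \<gamma> assume "\<gamma> \<in> \<Gamma>"
    note [measurable] = PSU11_borel_measurable[OF PSU[OF this]]
    show "(\<lambda>w. indicator F (\<gamma> w) * u w) \<in> borel_measurable hyp"
      by measurable
  qed
  finally show ?thesis .
qed

text \<open>Both sides are the integral of \<Phi> over the quotient of the product of two discs by
  the diagonal action of \<Gamma>: the product of \<open>F1\<close> with the disc and that of the
  disc with \<open>F2\<close> are both fundamental sets. The proof unfolds the inner integral along
  \<open>F2\<close> and folds the outer one back along \<open>F1\<close>.\<close>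

lemma tile_exchange:
  assumes F: "tile F1" "tile F2"
    and [measurable]: "case_prod \<Phi> \<in> borel_measurable (borel \<Otimes>\<^sub>M borel)"
    and inv: "\<And>\<gamma> u w. \<gamma> \<in> \<Gamma> \<Longrightarrow> u \<in> unit_disc \<Longrightarrow> w \<in> unit_disc \<Longrightarrow> \<Phi> (\<gamma> u) (\<gamma> w) = \<Phi> u w"
  shows "(\<integral>\<^sup>+u. indicator F1 u * (\<integral>\<^sup>+w. \<Phi> u w \<partial>hyp) \<partial>hyp) = (\<integral>\<^sup>+w. indicator F2 w * (\<integral>\<^sup>+u. \<Phi> u w \<partial>hyp) \<partial>hyp)"
proof -
  have [measurable]: "F1 \<in> sets borel" "F2 \<in> sets borel"
    using F by (auto simp: tile_def)
  define H where "H = (\<lambda>u. \<integral>\<^sup>+w. indicator F2 w * \<Phi> u w \<partial>hyp)"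
  have [measurable]: "H \<in> borel_measurable borel"
    unfolding H_def by measurable
  note AE_D = AE_hyp_unit_disc
  have inner: "(\<integral>\<^sup>+w. indicator F2 (\<gamma> w) * \<Phi> u w \<partial>hyp) = H (\<gamma> u)" if "\<gamma> \<in> \<Gamma>" "u \<in> unit_disc" for \<gamma> u
  proof -
    have "(\<integral>\<^sup>+w. indicator F2 (\<gamma> w) * \<Phi> u w \<partial>hyp) = (\<integral>\<^sup>+w. indicator F2 (\<gamma> w) * \<Phi> (\<gamma> u) (\<gamma> w) \<partial>hyp)"
      by (intro nn_integral_cong_AE eventually_mono[OF AE_D]) (simp add: inv[OF that])
    also have "\<dots> = H (\<gamma> u)"
      unfolding H_def using PSU[OF that(1)] by (rule nn_integral_hyp_PSU11) measurable
    finally show ?thesis .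
  qed
  have "(\<integral>\<^sup>+u. indicator F1 u * (\<integral>\<^sup>+w. \<Phi> u w \<partial>hyp) \<partial>hyp)
      = (\<integral>\<^sup>+u. indicator F1 u * (\<integral>\<^sup>+\<gamma>. H (\<gamma> u) \<partial>count_space \<Gamma>) \<partial>hyp)"
  proof (rule nn_integral_cong_AE, rule AE_mp[OF AE_D], rule AE_I2, rule impI)
    fix u :: complex assume u: "u \<in> unit_disc"
    have "(\<integral>\<^sup>+w. \<Phi> u w \<partial>hyp) = (\<integral>\<^sup>+\<gamma>. (\<integral>\<^sup>+w. indicator F2 (\<gamma> w) * \<Phi> u w \<partial>hyp) \<partial>count_space \<Gamma>)"
      by (rule tile_unfold[OF F(2)]) measurable
    also have "\<dots> = (\<integral>\<^sup>+\<gamma>. H (\<gamma> u) \<partial>count_space \<Gamma>)"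
      using u inner by (intro nn_integral_cong) auto
    finally show "indicator F1 u * (\<integral>\<^sup>+w. \<Phi> u w \<partial>hyp) = indicator F1 u * (\<integral>\<^sup>+\<gamma>. H (\<gamma> u) \<partial>count_space \<Gamma>)"
      by simp
  qed
  also have "\<dots> = (\<integral>\<^sup>+u. (\<integral>\<^sup>+\<gamma>. indicator F1 u * H (\<gamma> u) \<partial>count_space \<Gamma>) \<partial>hyp)"
    by (rule nn_integral_cong, rule nn_integral_cmult[symmetric]) simp
  also have "\<dots> = (\<integral>\<^sup>+\<gamma>. (\<integral>\<^sup>+u. indicator F1 u * H (\<gamma> u) \<partial>hyp) \<partial>count_space \<Gamma>)"
  proof (rule nn_integral_count_space_nn_integral[OF countable_group])
    fix \<gamma> assume "\<gamma> \<in> \<Gamma>"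
    note [measurable] = PSU11_borel_measurable[OF PSU[OF this]]
    show "(\<lambda>w. indicator F1 w * H (\<gamma> w)) \<in> borel_measurable hyp"
      by measurable
  qed
  \<comment> \<open>The substitution of \<gamma> u for u moves the group element from
    \<open>H\<close> to the indicator of \<open>F1\<close>. It arrives inverted, which the
    reindexing by \<open>ginv\<close> undoes, and then \<open>tile_unfold\<close> for
    \<open>F1\<close> applies backwards.\<close>
  also have "\<dots> = (\<integral>\<^sup>+\<gamma>. (\<integral>\<^sup>+u. indicator F1 (ginv \<gamma> u) * H u \<partial>hyp) \<partial>count_space \<Gamma>)"
  proof (rule nn_integral_cong)
    fix \<gamma> assume "\<gamma> \<in> space (count_space \<Gamma>)"
    then have \<gamma>: "\<gamma> \<in> \<Gamma>" by simp
    note [measurable] = PSU11_borel_measurable[OF PSU[OF ginv_in[OF \<gamma>]]]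
    have "(\<integral>\<^sup>+u. indicator F1 u * H (\<gamma> u) \<partial>hyp) = (\<integral>\<^sup>+u. indicator F1 (ginv \<gamma> (\<gamma> u)) * H (\<gamma> u) \<partial>hyp)"
      by (intro nn_integral_cong_AE eventually_mono[OF AE_D]) (simp add: ginv_left[OF \<gamma>])
    also have "\<dots> = (\<integral>\<^sup>+u. indicator F1 (ginv \<gamma> u) * H u \<partial>hyp)"
      using PSU[OF \<gamma>] by (rule nn_integral_hyp_PSU11) measurable
    finally show "(\<integral>\<^sup>+u. indicator F1 u * H (\<gamma> u) \<partial>hyp) = (\<integral>\<^sup>+u. indicator F1 (ginv \<gamma> u) * H u \<partial>hyp)" .
  qed
  also have "\<dots> = (\<integral>\<^sup>+\<gamma>. (\<integral>\<^sup>+u. indicator F1 (\<gamma> u) * H u \<partial>hyp) \<partial>count_space \<Gamma>)"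
    by (rule nn_integral_bij_count_space[OF bij_betw_ginv])
  also have "\<dots> = (\<integral>\<^sup>+u. H u \<partial>hyp)"
    by (rule tile_unfold[OF F(1), symmetric]) measurable
  also have "\<dots> = (\<integral>\<^sup>+w. (\<integral>\<^sup>+u. indicator F2 w * \<Phi> u w \<partial>hyp) \<partial>hyp)"
    unfolding H_def
    by (rule pair_sigma_finite.Fubini'[OF pair_sigma_finite.intro[OF sigma_finite_hyp sigma_finite_hyp]]) measurable
  also have "\<dots> = (\<integral>\<^sup>+w. indicator F2 w * (\<integral>\<^sup>+u. \<Phi> u w \<partial>hyp) \<partial>hyp)"
    by (rule nn_integral_cong, rule nn_integral_cmult) measurable
  finally show ?thesis .
qed

end

subsection \<open>Area integrals of power series\<close>

text \<open>A layer-cake computation in place of polar coordinates. The deficit \<rho>^m -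
  \<bar>z\<bar>^(2m) is the integral of m t^(m-1) for t from \<bar>z\<bar>^2 to \<rho>; by Tonelli
  its integral over the disc is found from the areas pi t of smaller discs. Subtracting this finite
  amount from \<rho>^m times the area pi \<rho> leaves the claim.\<close>

lemma nn_integral_cmod_power_cball:
  assumes "0 \<le> \<rho>"
  shows "(\<integral>\<^sup>+z. ennreal (((cmod z)\<^sup>2) ^ m) * indicator (cball 0 (sqrt \<rho>)) z \<partial>lborel) =
    ennreal (pi * \<rho> ^ Suc m / Suc m)"
proof -
  define D where "D = (cball 0 (sqrt \<rho>) :: complex set)"
  have D: "z \<in> D \<longleftrightarrow> (cmod z)\<^sup>2 \<le> \<rho>" for z
    unfolding D_def using real_le_rsqrt[of "cmod z" \<rho>] assms
    by (auto simp: real_sqrt_le_iff dest: sqrt_ge_absD) (metis norm_ge_zero real_sqrt_le_iff real_sqrt_unique real_sqrt_pow2 power_mono)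
  have [measurable]: "D \<in> sets borel"
    by (simp add: D_def)
  have area: "emeasure lborel {z::complex. (cmod z)\<^sup>2 \<le> t} = ennreal (pi * t)" if "0 \<le> t" for t
  proof -
    have "{z::complex. (cmod z)\<^sup>2 \<le> t} = cball 0 (sqrt t)"
      using that by (auto intro: real_le_rsqrt dest: sqrt_ge_absD)
         (metis norm_ge_zero power_mono real_sqrt_pow2)
    then show ?thesis
      using that by (simp add: emeasure_cball unit_ball_vol_2)
  qed
  let ?I = "\<integral>\<^sup>+z. ennreal (((cmod z)\<^sup>2) ^ m) * indicator D z \<partial>lborel"
  let ?d = "\<lambda>t::real. real m * t ^ (m - 1)"
  have inner: "(\<integral>\<^sup>+t. ennreal (?d t) * indicator {(cmod z)\<^sup>2..\<rho>} t \<partial>lborel) = ennreal (\<rho> ^ m - ((cmod z)\<^sup>2) ^ m)"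
    if "z \<in> D" for z
  proof (rule nn_integral_FTC_Icc)
    fix t assume "t \<in> {(cmod z)\<^sup>2..\<rho>}"
    then have "0 \<le> t"
      using order_trans[OF zero_le_power2, of "cmod z" t] by simp
    then show "0 \<le> ?d t"
      by simp
    show "((\<lambda>a. a ^ m) has_real_derivative ?d t) (at t)"
      by (auto intro!: derivative_eq_intros)
  qed (use that D in auto)
  have "(\<integral>\<^sup>+z. ennreal (\<rho> ^ m - ((cmod z)\<^sup>2) ^ m) * indicator D z \<partial>lborel)
      = (\<integral>\<^sup>+z. (\<integral>\<^sup>+t. ennreal (?d t) * indicator {0..\<rho>} t * indicator {z. (cmod z)\<^sup>2 \<le> t} z \<partial>lborel) \<partial>lborel)"
  proof (rule nn_integral_cong)
    fix z :: complex
    show "ennreal (\<rho> ^ m - ((cmod z)\<^sup>2) ^ m) * indicator D z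
      = (\<integral>\<^sup>+t. ennreal (?d t) * indicator {0..\<rho>} t * indicator {z. (cmod z)\<^sup>2 \<le> t} z \<partial>lborel)"
    proof (cases "z \<in> D")
      case True
      then have "ennreal (\<rho> ^ m - ((cmod z)\<^sup>2) ^ m) * indicator D z
          = (\<integral>\<^sup>+t. ennreal (?d t) * indicator {(cmod z)\<^sup>2..\<rho>} t \<partial>lborel)"
        unfolding inner[OF True] by simp
      also have "\<dots> = (\<integral>\<^sup>+t. ennreal (?d t) * indicator {0..\<rho>} t * indicator {z. (cmod z)\<^sup>2 \<le> t} z \<partial>lborel)"
        by (intro nn_integral_cong) (auto simp: indicator_def, meson order_trans zero_le_power2)
      finally show ?thesis .
    next
      case False
      then have "ennreal (?d t) * indicator {0..\<rho>} t * indicator {z. (cmod z)\<^sup>2 \<le> t} z = 0" for t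
        by (auto simp: D indicator_def)
      with False show ?thesis
        by (simp only:) simp
    qed
  qed
  also have "\<dots> = (\<integral>\<^sup>+t. (\<integral>\<^sup>+z. ennreal (?d t) * indicator {0..\<rho>} t * indicator {z. (cmod z)\<^sup>2 \<le> t} z \<partial>lborel) \<partial>lborel)"
    by (rule pair_sigma_finite.Fubini'[OF pair_sigma_finite.intro[OF sigma_finite_lborel sigma_finite_lborel], symmetric])
       (simp add: indicator_def)
  also have "\<dots> = (\<integral>\<^sup>+t. ennreal (pi * real m * t ^ m) * indicator {0..\<rho>} t \<partial>lborel)"
  proof (rule nn_integral_cong)
    fix t :: real
    have "(\<integral>\<^sup>+z. ennreal (?d t) * indicator {0..\<rho>} t * indicator {z. (cmod z)\<^sup>2 \<le> t} z \<partial>lborel)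
      = ennreal (?d t) * indicator {0..\<rho>} t * emeasure lborel {z::complex. (cmod z)\<^sup>2 \<le> t}"
      by (rule nn_integral_cmult_indicator) measurable
    also have "\<dots> = ennreal (pi * real m * t ^ m) * indicator {0..\<rho>} t"
    proof (cases "t \<in> {0..\<rho>}")
      case True
      \<comment> \<open>For m = 0 the exponent m - 1 is truncated to 0, but the factor m makes both
        sides vanish.\<close>
      then show ?thesis
        by (cases m) (simp_all add: area ennreal_mult'[symmetric] algebra_simps)
    qed simp
    finally show "(\<integral>\<^sup>+z. ennreal (?d t) * indicator {0..\<rho>} t * indicator {z. (cmod z)\<^sup>2 \<le> t} z \<partial>lborel) =
      ennreal (pi * real m * t ^ m) * indicator {0..\<rho>} t" .
  qed
  also have "\<dots> = ennreal (pi * real m * \<rho> ^ Suc m / Suc m - pi * real m * 0 ^ Suc m / Suc m)"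
  proof (rule nn_integral_FTC_Icc)
    fix t :: real
    have "((\<lambda>t. pi * real m * t ^ Suc m / Suc m) has_real_derivative
        pi * real m * (real (Suc m) * t ^ (Suc m - Suc 0)) / real (Suc m)) (at t)"
      by (intro DERIV_cdivide DERIV_cmult DERIV_pow)
    then show "((\<lambda>t. pi * real m * t ^ Suc m / Suc m) has_real_derivative pi * real m * t ^ m) (at t)"
      by (simp del: of_nat_Suc add: mult.assoc)
  qed (use assms in auto)
  finally have comp: "(\<integral>\<^sup>+z. ennreal (\<rho> ^ m - ((cmod z)\<^sup>2) ^ m) * indicator D z \<partial>lborel) = ennreal (pi * real m * \<rho> ^ Suc m / Suc m)"
    by simp
  have "?I + ennreal (pi * real m * \<rho> ^ Suc m / Suc m)
    = (\<integral>\<^sup>+z. ennreal (((cmod z)\<^sup>2) ^ m) * indicator D z + ennreal (\<rho> ^ m - ((cmod z)\<^sup>2) ^ m) * indicator D z \<partial>lborel)"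
    unfolding comp[symmetric] by (rule nn_integral_add[symmetric]) measurable
  also have "\<dots> = (\<integral>\<^sup>+z. ennreal (\<rho> ^ m) * indicator D z \<partial>lborel)"
    by (intro nn_integral_cong) (auto simp: indicator_def D ennreal_plus[symmetric] power_mono simp del: ennreal_plus)
  also have "\<dots> = ennreal (\<rho> ^ m) * ennreal (pi * \<rho>)"
  proof -
    have "{z. (cmod z)\<^sup>2 \<le> \<rho>} = D"
      using D by blast
    then show ?thesis
      using area[OF assms] by (simp add: nn_integral_cmult_indicator)
  qed
  also have "\<dots> = ennreal (pi * \<rho> ^ Suc m / Suc m) + ennreal (pi * real m * \<rho> ^ Suc m / Suc m)"
  proof -
    have "pi * \<rho> ^ Suc m + pi * real m * \<rho> ^ Suc m = \<rho> ^ m * (pi * \<rho>) * Suc m"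
      by (simp add: algebra_simps)
    then have "\<rho> ^ m * (pi * \<rho>) = pi * \<rho> ^ Suc m / Suc m + pi * real m * \<rho> ^ Suc m / Suc m"
      unfolding add_divide_distrib[symmetric] by (simp del: of_nat_Suc)
    then show ?thesis
      using assms by (simp add: ennreal_mult'[symmetric] ennreal_plus[symmetric] del: ennreal_plus of_nat_Suc power_Suc)
  qed
  finally have "?I + ennreal (pi * real m * \<rho> ^ Suc m / Suc m) = ennreal (pi * \<rho> ^ Suc m / Suc m) + ennreal (pi * real m * \<rho> ^ Suc m / Suc m)" .
  then show ?thesis
    unfolding D_def[symmetric] add.commute[of _ "ennreal (pi * real m * _ / _)"]
    by (simp only: ennreal_add_left_cancel) simp
qed

lemma distr_lborel_rotation:
  assumes "cmod c = 1"
  shows "distr lborel borel (\<lambda>z. c * z) = lborel"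
proof (rule measure_eqI)
  fix A assume "A \<in> sets (distr lborel borel (\<lambda>z. c * z))"
  then have [measurable]: "A \<in> sets borel" by simp
  have c: "c \<noteq> 0" using assms by auto
  have "(\<lambda>z. c * z) ` UNIV = UNIV"
    using c by (intro surjI[where f = "\<lambda>z. z / c"]) simp
  moreover have "deriv (\<lambda>z. c * z) z = c" for z
    by (simp add: DERIV_imp_deriv)
  ultimately have "(\<integral>\<^sup>+z. indicator A (c * z) \<partial>lborel) = (\<integral>\<^sup>+z. indicator A z \<partial>lborel)"
    using nn_integral_holomorphic_image[of "\<lambda>z. c * z" UNIV "indicator A"] c assms
    by (auto simp: inj_on_def intro!: holomorphic_intros)
  then show "emeasure (distr lborel borel (\<lambda>z. c * z)) A = emeasure lborel A"
    using nn_integral_distr[of "\<lambda>z. c * z" lborel borel "indicator A"] by simp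
qed simp

text \<open>The rotation by the angle \<open>t\<close> with (j - k) t = pi preserves the disc and
  Lebesgue measure and multiplies the integrand by -1, so the integral equals its own
  negative.\<close>

lemma integral_cball_monomials:
  assumes "j \<noteq> k"
  shows "(LINT z:cball 0 r|lborel. z ^ j * cnj z ^ k) = 0"
proof -
  define t where "t = pi / (real j - real k)"
  define f where "f = (\<lambda>z. indicator (cball 0 r) z *\<^sub>R (z ^ j * cnj z ^ k))"
  have [measurable]: "f \<in> borel_measurable borel"
    unfolding f_def by (intro borel_measurable_scaleR borel_measurable_indicator borel_measurable_continuous_onI continuous_intros) auto
  have "cis t ^ j * cnj (cis t) ^ k = cis (real j * t - real k * t)"
    by (simp add: cis_cnj Complex.DeMoivre cis_mult)
  also have "real j * t - real k * t = pi"
    unfolding left_diff_distrib[symmetric] using assms by (simp add: t_def)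
  finally have rot: "cis t ^ j * cnj (cis t) ^ k = -1"
    by simp
  have "f (cis t * z) = - f z" for z
  proof -
    have "f (cis t * z) = indicator (cball 0 r) z *\<^sub>R ((cis t ^ j * cnj (cis t) ^ k) * (z ^ j * cnj z ^ k))"
      by (simp add: f_def indicator_def norm_mult power_mult_distrib)
    then show ?thesis
      unfolding rot by (simp add: f_def)
  qed
  then have "integral\<^sup>L lborel f = - integral\<^sup>L lborel f"
    using integral_distr[of "\<lambda>z. cis t * z" lborel borel f] by (simp add: distr_lborel_rotation)
  then show ?thesis
    by (simp add: set_lebesgue_integral_def f_def)
qed


text \<open>Orthogonality of the monomials settles partial sums. As the closed disc lies strictly
  inside the disc of convergence, the partial sums are bounded there by the constant
  \<open>M\<close>, and dominated convergence passes to the limit.\<close>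

lemma area_parseval:
  fixes b :: "nat \<Rightarrow> complex" and g :: "complex \<Rightarrow> complex"
  assumes g: "\<And>z. z \<in> unit_disc \<Longrightarrow> (\<lambda>m. b m * z ^ m) sums g z"
    and \<rho>: "0 < \<rho>" "\<rho> < 1"
  shows "(\<integral>\<^sup>+z. ennreal ((cmod (g z))\<^sup>2) * indicator (cball 0 (sqrt \<rho>)) z \<partial>lborel) =
    (\<Sum>m. ennreal (pi * \<rho> ^ Suc m / Suc m) * ennreal ((cmod (b m))\<^sup>2))"
proof -
  define D where "D = (cball 0 (sqrt \<rho>) :: complex set)"
  define r where "r = sqrt \<rho>"
  have r: "0 < r" "r < 1" "r\<^sup>2 = \<rho>"
    using \<rho> by (auto simp: r_def)
  have D_disc: "z \<in> unit_disc" "cmod z \<le> r" if "z \<in> D" for z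
    using that r by (auto simp: D_def r_def[symmetric])
  have [measurable]: "D \<in> sets borel"
    by (simp add: D_def)
  have fin: "emeasure lborel D < \<infinity>"
    unfolding D_def by (simp add: emeasure_cball less_top[symmetric] \<rho>(1) less_imp_le)
  define G where "G N z = (\<Sum>m<N. b m * z ^ m)" for N z
  define M where "M = (\<Sum>m. cmod (b m) * r ^ m)"
  have absum: "summable (\<lambda>m. cmod (b m) * r ^ m)"
  proof -
    \<comment> \<open>Convergence at the midpoint of \<open>r\<close> and 1 gives absolute
      convergence at the smaller radius \<open>r\<close>.\<close>
    have "summable (\<lambda>m. b m * (of_real ((r + 1) / 2)) ^ m)"
      using g[of "of_real ((r + 1) / 2)"] r by (auto simp: sums_iff simp del: of_real_divide of_real_add)
    then have "summable (\<lambda>m. cmod (b m * (of_real r) ^ m))"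
      by (rule powser_insidea) (use r in \<open>simp del: of_real_divide of_real_add\<close>)
    then show ?thesis
      using r by (simp add: norm_mult norm_power)
  qed
  have GM: "cmod (G N z) \<le> M" if "z \<in> D" for N z
  proof -
    have "cmod (G N z) \<le> (\<Sum>m<N. cmod (b m * z ^ m))"
      unfolding G_def by (rule norm_sum)
    also have "\<dots> \<le> (\<Sum>m<N. cmod (b m) * r ^ m)"
      using D_disc[OF that] by (intro sum_mono) (simp add: norm_mult norm_power mult_left_mono power_mono)
    also have "\<dots> \<le> M"
      unfolding M_def using r by (intro sum_le_suminf[OF absum]) auto
    finally show ?thesis .
  qed
  have Gcont: "continuous_on UNIV (G N)" for N
    unfolding G_def by (intro continuous_intros)
  have [measurable]: "G N \<in> borel_measurable borel" for N
    by (rule borel_measurable_continuous_onI[OF Gcont])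
  have diag: "(LINT z:D|lborel. ((cmod z)\<^sup>2) ^ m) = pi * \<rho> ^ Suc m / Suc m" for m
  proof -
    have "(LINT z:D|lborel. ((cmod z)\<^sup>2) ^ m) = enn2real (\<integral>\<^sup>+z. ennreal (indicator D z *\<^sub>R ((cmod z)\<^sup>2) ^ m) \<partial>lborel)"
      unfolding set_lebesgue_integral_def by (rule integral_eq_nn_integral) auto
    also have "(\<integral>\<^sup>+z. ennreal (indicator D z *\<^sub>R ((cmod z)\<^sup>2) ^ m) \<partial>lborel) = ennreal (pi * \<rho> ^ Suc m / Suc m)"
      unfolding nn_integral_cmod_power_cball[OF less_imp_le[OF \<rho>(1)], symmetric] D_def[symmetric]
      by (intro nn_integral_cong) (simp add: indicator_def)
    finally show ?thesis
      using \<rho> by simp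
  qed
  have bint: "set_integrable lborel D f" if "continuous_on UNIV f" for f :: "complex \<Rightarrow> complex"
    unfolding set_integrable_def by (rule borel_integrable_compact) (use that continuous_on_subset in \<open>auto simp: D_def\<close>)
  have mono: "(LINT z:D|lborel. z ^ j * cnj z ^ k) = (if j = k then of_real (pi * \<rho> ^ Suc j / Suc j) else 0)" for j k
  proof (cases "j = k")
    case True
    have "(LINT z:D|lborel. z ^ j * cnj z ^ k) = (LINT z:D|lborel. complex_of_real (((cmod z)\<^sup>2) ^ j))"
    proof -
      have "z ^ j * cnj z ^ k = complex_of_real (((cmod z)\<^sup>2) ^ j)" for z
        unfolding of_real_power[of _ j] complex_norm_square power_mult_distrib using True by simp
      then show ?thesis
        by simp
    qed
    also have "\<dots> = complex_of_real (LINT z:D|lborel. ((cmod z)\<^sup>2) ^ j)"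
      by (rule set_integral_complex_of_real)
    finally show ?thesis
      using True by (simp only: diag if_True simp_thms)
  next
    case False
    then show ?thesis
      unfolding D_def by (simp add: integral_cball_monomials)
  qed
  define F where "F j k z = indicator D z *\<^sub>R ((b j * cnj (b k)) * (z ^ j * cnj z ^ k))" for j k z
  have intF: "integrable lborel (F j k)" for j k
    unfolding F_def[abs_def] by (intro bint[unfolded set_integrable_def] continuous_intros)
  have fins: "(LINT z:D|lborel. (cmod (G N z))\<^sup>2) = (\<Sum>m<N. (cmod (b m))\<^sup>2 * (pi * \<rho> ^ Suc m / Suc m))" for N
  proof -
    have "complex_of_real (LINT z:D|lborel. (cmod (G N z))\<^sup>2) = (LINT z:D|lborel. complex_of_real ((cmod (G N z))\<^sup>2))"
      by (rule set_integral_complex_of_real[symmetric])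
    also have "\<dots> = (LINT z:D|lborel. (\<Sum>j<N. \<Sum>k<N. (b j * cnj (b k)) * (z ^ j * cnj z ^ k)))"
    proof -
      have "complex_of_real ((cmod (G N z))\<^sup>2) = (\<Sum>j<N. \<Sum>k<N. (b j * cnj (b k)) * (z ^ j * cnj z ^ k))" for z
        unfolding complex_norm_square G_def cnj_sum sum_product by (simp add: mult_ac)
      then show ?thesis
        by (simp only:)
    qed
    also have "\<dots> = (LINT z|lborel. (\<Sum>j<N. \<Sum>k<N. F j k z))"
      by (simp only: set_lebesgue_integral_def scaleR_sum_right F_def)
    also have "\<dots> = (\<Sum>j<N. LINT z|lborel. (\<Sum>k<N. F j k z))"
      by (rule Bochner_Integration.integral_sum, rule Bochner_Integration.integrable_sum, rule intF)
    also have "\<dots> = (\<Sum>j<N. \<Sum>k<N. LINT z|lborel. F j k z)"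
      by (rule sum.cong[OF refl], rule Bochner_Integration.integral_sum, rule intF)
    also have "\<dots> = (\<Sum>j<N. \<Sum>k<N. (b j * cnj (b k)) * (LINT z:D|lborel. z ^ j * cnj z ^ k))"
      by (simp only: F_def set_lebesgue_integral_def mult_scaleR_right[symmetric] integral_mult_right_zero)
    also have "\<dots> = (\<Sum>j<N. (b j * cnj (b j)) * of_real (pi * \<rho> ^ Suc j / Suc j))"
      by (simp add: mono if_distrib[of "\<lambda>x. _ * x"] sum.delta cong: if_cong del: of_real_divide of_real_mult of_real_power)
    also have "\<dots> = complex_of_real (\<Sum>m<N. (cmod (b m))\<^sup>2 * (pi * \<rho> ^ Suc m / Suc m))"
      unfolding of_real_sum of_real_mult[of "(cmod _)\<^sup>2"] complex_norm_square ..
    finally show ?thesis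
      using of_real_eq_iff by blast
  qed
  define h where "h z = indicator D z *\<^sub>R (cmod (g z))\<^sup>2" for z
  have lim: "(\<lambda>N. indicator D z *\<^sub>R (cmod (G N z))\<^sup>2) \<longlonglongrightarrow> h z" for z
  proof (cases "z \<in> D")
    case True
    have "(\<lambda>N. G N z) \<longlonglongrightarrow> g z"
      using g[OF D_disc(1)[OF True]] by (simp add: G_def sums_def)
    then show ?thesis
      unfolding h_def by (intro tendsto_intros)
  qed (simp add: h_def)
  have Gm: "(\<lambda>z. indicator D z *\<^sub>R (cmod (G N z))\<^sup>2) \<in> borel_measurable lborel" for N
    by measurable
  have hm: "h \<in> borel_measurable lborel"
    by (rule borel_measurable_LIMSEQ_real[OF lim Gm])
  have dom: "AE z in lborel. norm (indicator D z *\<^sub>R (cmod (G N z))\<^sup>2) \<le> indicator D z *\<^sub>R M\<^sup>2" for N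
    using GM by (intro AE_I2) (auto simp: indicator_def intro: power_mono)
  have domi: "integrable lborel (\<lambda>z. indicator D z *\<^sub>R M\<^sup>2)"
    using fin by (intro integrable_scaleR_left) (simp add: integrable_indicator_iff)
  note dct = hm Gm domi AE_I2[OF lim] dom
  have hint: "integrable lborel h"
    by (rule integrable_dominated_convergence[OF dct])
  have "(\<lambda>N. LINT z|lborel. indicator D z *\<^sub>R (cmod (G N z))\<^sup>2) \<longlonglongrightarrow> integral\<^sup>L lborel h"
    by (rule integral_dominated_convergence[OF dct])
  then have sums: "(\<lambda>m. (cmod (b m))\<^sup>2 * (pi * \<rho> ^ Suc m / Suc m)) sums integral\<^sup>L lborel h"
    unfolding sums_def fins[unfolded set_lebesgue_integral_def] .
  have "(\<integral>\<^sup>+z. ennreal ((cmod (g z))\<^sup>2) * indicator D z \<partial>lborel) = (\<integral>\<^sup>+z. ennreal (h z) \<partial>lborel)"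
    by (intro nn_integral_cong) (simp add: h_def indicator_def)
  also have "\<dots> = ennreal (integral\<^sup>L lborel h)"
    by (rule nn_integral_eq_integral[OF hint]) (simp add: h_def)
  also have "\<dots> = (\<Sum>m. ennreal ((cmod (b m))\<^sup>2 * (pi * \<rho> ^ Suc m / Suc m)))"
    unfolding sums_unique[OF sums]
    by (rule suminf_ennreal2[symmetric]) (use \<rho>(1) sums_summable[OF sums] in \<open>simp_all del: power_Suc of_nat_Suc\<close>)
  also have "\<dots> = (\<Sum>m. ennreal (pi * \<rho> ^ Suc m / Suc m) * ennreal ((cmod (b m))\<^sup>2))"
  proof (rule suminf_cong)
    fix m
    show "ennreal ((cmod (b m))\<^sup>2 * (pi * \<rho> ^ Suc m / Suc m)) = ennreal (pi * \<rho> ^ Suc m / Suc m) * ennreal ((cmod (b m))\<^sup>2)"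
      unfolding mult.commute[of "(cmod (b m))\<^sup>2"] by (rule ennreal_mult) (use \<rho>(1) in simp_all)
  qed
  finally show ?thesis
    unfolding D_def .
qed

subsection \<open>Tangent vectors along the fiber over the origin\<close>

lemma higher_deriv_chain3:
  assumes "open S" "x \<in> S"
    and g: "\<And>y. y \<in> S \<Longrightarrow> (g has_field_derivative g1 y) (at y)"
    and g1: "\<And>y. y \<in> S \<Longrightarrow> (g1 has_field_derivative g2 y) (at y)"
    and g2: "\<And>y. y \<in> S \<Longrightarrow> (g2 has_field_derivative g3 y) (at y)"
  shows "deriv g x = g1 x" "(deriv ^^ 2) g x = g2 x" "(deriv ^^ 3) g x = g3 x"
proof -
  have 1: "deriv g y = g1 y" if "y \<in> S" for y
    using g[OF that] by (rule DERIV_imp_deriv)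
  have 2: "deriv (deriv g) y = g2 y" if "y \<in> S" for y
    by (rule DERIV_imp_deriv, rule has_field_derivative_transform_within_open[OF g1[OF that] assms(1) that]) (simp add: 1)
  have 3: "deriv (deriv (deriv g)) y = g3 y" if "y \<in> S" for y
    by (rule DERIV_imp_deriv, rule has_field_derivative_transform_within_open[OF g2[OF that] assms(1) that]) (simp add: 2)
  show "deriv g x = g1 x" "(deriv ^^ 2) g x = g2 x" "(deriv ^^ 3) g x = g3 x"
    using 1 2 3 assms(2) by (simp_all add: numeral_2_eq_2 numeral_3_eq_3)
qed

lemma holomorphic_derivs:
  assumes "v holomorphic_on S" "open S" "x \<in> S"
  shows "(v has_field_derivative deriv v x) (at x)"
    "(deriv v has_field_derivative (deriv ^^ 2) v x) (at x)"
    "((deriv ^^ 2) v has_field_derivative (deriv ^^ 3) v x) (at x)"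
  using has_field_derivative_higher_deriv[OF assms, of 0] has_field_derivative_higher_deriv[OF assms, of 1]
    has_field_derivative_higher_deriv[OF assms, of 2]
  by (simp_all add: numeral_2_eq_2 numeral_3_eq_3)

lemma one_minus_mult_nonzero:
  fixes \<zeta> x :: complex
  assumes "\<zeta> \<in> unit_disc" "x \<in> unit_disc"
  shows "1 - \<zeta> * x \<noteq> 0" "1 + \<zeta> * x \<noteq> 0"
proof -
  have "cmod (\<zeta> * x) < 1"
    using assms mult_strict_mono'[of "cmod \<zeta>" 1 "cmod x" 1] by (simp add: norm_mult)
  then show "1 - \<zeta> * x \<noteq> 0" "1 + \<zeta> * x \<noteq> 0"
    by (metis norm_one order_less_irrefl right_minus_eq,
        metis add_eq_0_iff norm_minus_cancel norm_one order_less_irrefl)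
qed

text \<open>At t = 0 the map is the Moebius map \<open>fiber_point \<zeta>\<close>. With p = 1 -
  \<zeta> x its derivatives of orders 1, 2, 3 at x are 1 / p^2, 2 \<zeta> / p^3 and 6 \<zeta>^2 /
  p^4; inserting them into the derivative of the Schwarzian in t leaves a polynomial in p.\<close>

lemma schwarzian_variation:
  assumes \<zeta>: "\<zeta> \<in> unit_disc" and x: "x \<in> unit_disc" and v: "v holomorphic_on unit_disc"
  shows "((\<lambda>t. schwarzian (\<lambda>y. fiber_point \<zeta> y + t * v y) x) has_field_derivative
    (1 - \<zeta> * x)\<^sup>2 * (deriv ^^ 3) v x - 6 * \<zeta> * (1 - \<zeta> * x) * (deriv ^^ 2) v x + 6 * \<zeta>\<^sup>2 * deriv v x) (at 0)"
proof -
  define p where "p = 1 - \<zeta> * x"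
  have p: "p \<noteq> 0"
    using one_minus_mult_nonzero[OF \<zeta> x] by (simp add: p_def)
  have A: "((\<lambda>y. fiber_point \<zeta> y + t * v y) has_field_derivative 1 / (1 - \<zeta> * y)\<^sup>2 + t * deriv v y) (at y)"
    and B: "((\<lambda>y. 1 / (1 - \<zeta> * y)\<^sup>2 + t * deriv v y) has_field_derivative 2 * \<zeta> / (1 - \<zeta> * y) ^ 3 + t * (deriv ^^ 2) v y) (at y)"
    and C: "((\<lambda>y. 2 * \<zeta> / (1 - \<zeta> * y) ^ 3 + t * (deriv ^^ 2) v y) has_field_derivative 6 * \<zeta>\<^sup>2 / (1 - \<zeta> * y) ^ 4 + t * (deriv ^^ 3) v y) (at y)"
    if y: "y \<in> unit_disc" for t y
  proof -
    note [derivative_intros] = holomorphic_derivs[OF v open_ball y]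
    have nz: "1 - \<zeta> * y \<noteq> 0"
      by (rule one_minus_mult_nonzero[OF \<zeta> y])
    define P where "P = 1 - \<zeta> * y"
    have P: "P \<noteq> 0"
      using nz by (simp add: P_def)
    have lin: "((\<lambda>y. 1 - \<zeta> * y) has_field_derivative - \<zeta>) (at y)"
      by (auto intro!: derivative_eq_intros)
    have D2: "((\<lambda>y. 1 / (1 - \<zeta> * y)\<^sup>2) has_field_derivative 2 * \<zeta> / (1 - \<zeta> * y) ^ 3) (at y)"
      by (rule derivative_eq_intros lin refl)+ (unfold P_def[symmetric], use P in \<open>simp_all add: field_simps eval_nat_numeral\<close>)
    have D3: "((\<lambda>y. 2 * \<zeta> / (1 - \<zeta> * y) ^ 3) has_field_derivative 6 * \<zeta>\<^sup>2 / (1 - \<zeta> * y) ^ 4) (at y)"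
      by (rule derivative_eq_intros lin refl)+ (unfold P_def[symmetric], use P in \<open>simp_all add: field_simps eval_nat_numeral\<close>)
    have dt: "((\<lambda>y. t * g y) has_field_derivative t * g') (at y)" if "(g has_field_derivative g') (at y)" for g g'
      by (rule DERIV_cmult[OF that])
    show "((\<lambda>y. fiber_point \<zeta> y + t * v y) has_field_derivative 1 / (1 - \<zeta> * y)\<^sup>2 + t * deriv v y) (at y)"
      unfolding fiber_point_def using nz by (auto intro!: derivative_eq_intros simp: power2_eq_square)
    show "((\<lambda>y. 1 / (1 - \<zeta> * y)\<^sup>2 + t * deriv v y) has_field_derivative 2 * \<zeta> / (1 - \<zeta> * y) ^ 3 + t * (deriv ^^ 2) v y) (at y)"
      by (intro DERIV_add D2 dt holomorphic_derivs[OF v open_ball y])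
    show "((\<lambda>y. 2 * \<zeta> / (1 - \<zeta> * y) ^ 3 + t * (deriv ^^ 2) v y) has_field_derivative 6 * \<zeta>\<^sup>2 / (1 - \<zeta> * y) ^ 4 + t * (deriv ^^ 3) v y) (at y)"
      by (intro DERIV_add D3 dt holomorphic_derivs[OF v open_ball y])
  qed
  have d: "deriv (\<lambda>y. fiber_point \<zeta> y + t * v y) x = 1 / (1 - \<zeta> * x)\<^sup>2 + t * deriv v x"
    "(deriv ^^ 2) (\<lambda>y. fiber_point \<zeta> y + t * v y) x = 2 * \<zeta> / (1 - \<zeta> * x) ^ 3 + t * (deriv ^^ 2) v x"
    "(deriv ^^ 3) (\<lambda>y. fiber_point \<zeta> y + t * v y) x = 6 * \<zeta>\<^sup>2 / (1 - \<zeta> * x) ^ 4 + t * (deriv ^^ 3) v x" for t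
    by (rule higher_deriv_chain3[OF open_ball x A B C], assumption+)+
  have "((\<lambda>t. (6 * \<zeta>\<^sup>2 / p ^ 4 + t * (deriv ^^ 3) v x) / (1 / p\<^sup>2 + t * deriv v x) -
      3 / 2 * ((2 * \<zeta> / p ^ 3 + t * (deriv ^^ 2) v x) / (1 / p\<^sup>2 + t * deriv v x))\<^sup>2) has_field_derivative
      p\<^sup>2 * (deriv ^^ 3) v x - 6 * \<zeta> * p * (deriv ^^ 2) v x + 6 * \<zeta>\<^sup>2 * deriv v x) (at 0)"
    using p by (auto intro!: derivative_eq_intros) (simp add: divide_simps, simp add: eval_nat_numeral algebra_simps)
  then show ?thesis
    unfolding schwarzian_def d p_def .
qed

text \<open>\<open>Y\<close> is \<open>v\<close> divided by the derivative of
  \<open>fiber_point \<zeta>\<close>, that is, the variation pulled back to a vector field on the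
  disc. As the factor is a quadratic polynomial, its third derivative is 0 and no multiple of
  \<open>v\<close> itself survives in the third formula, which is then exactly the variation of the
  Schwarzian.\<close>

lemma deriv3_conformal_factor:
  fixes \<zeta> :: complex
  assumes x: "x \<in> unit_disc" and v: "v holomorphic_on unit_disc"
  defines "Y \<equiv> \<lambda>x. (1 - \<zeta> * x)\<^sup>2 * v x"
  shows "deriv Y x = (1 - \<zeta> * x)\<^sup>2 * deriv v x - 2 * \<zeta> * (1 - \<zeta> * x) * v x"
    and "(deriv ^^ 2) Y x = (1 - \<zeta> * x)\<^sup>2 * (deriv ^^ 2) v x - 4 * \<zeta> * (1 - \<zeta> * x) * deriv v x + 2 * \<zeta>\<^sup>2 * v x"
    and "(deriv ^^ 3) Y x = (1 - \<zeta> * x)\<^sup>2 * (deriv ^^ 3) v x - 6 * \<zeta> * (1 - \<zeta> * x) * (deriv ^^ 2) v x + 6 * \<zeta>\<^sup>2 * deriv v x"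
proof -
  have A: "(Y has_field_derivative (1 - \<zeta> * y)\<^sup>2 * deriv v y - 2 * \<zeta> * (1 - \<zeta> * y) * v y) (at y)"
    and B: "((\<lambda>x. (1 - \<zeta> * x)\<^sup>2 * deriv v x - 2 * \<zeta> * (1 - \<zeta> * x) * v x) has_field_derivative
      (1 - \<zeta> * y)\<^sup>2 * (deriv ^^ 2) v y - 4 * \<zeta> * (1 - \<zeta> * y) * deriv v y + 2 * \<zeta>\<^sup>2 * v y) (at y)"
    and C: "((\<lambda>x. (1 - \<zeta> * x)\<^sup>2 * (deriv ^^ 2) v x - 4 * \<zeta> * (1 - \<zeta> * x) * deriv v x + 2 * \<zeta>\<^sup>2 * v x) has_field_derivative
      (1 - \<zeta> * y)\<^sup>2 * (deriv ^^ 3) v y - 6 * \<zeta> * (1 - \<zeta> * y) * (deriv ^^ 2) v y + 6 * \<zeta>\<^sup>2 * deriv v y) (at y)"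
    if y: "y \<in> unit_disc" for y
  proof -
    note [derivative_intros] = holomorphic_derivs[OF v open_ball y]
    show "(Y has_field_derivative (1 - \<zeta> * y)\<^sup>2 * deriv v y - 2 * \<zeta> * (1 - \<zeta> * y) * v y) (at y)"
      unfolding Y_def by (auto intro!: derivative_eq_intros simp: algebra_simps)
    show "((\<lambda>x. (1 - \<zeta> * x)\<^sup>2 * deriv v x - 2 * \<zeta> * (1 - \<zeta> * x) * v x) has_field_derivative
        (1 - \<zeta> * y)\<^sup>2 * (deriv ^^ 2) v y - 4 * \<zeta> * (1 - \<zeta> * y) * deriv v y + 2 * \<zeta>\<^sup>2 * v y) (at y)"
      by (auto intro!: derivative_eq_intros) (simp add: algebra_simps power2_eq_square)
    show "((\<lambda>x. (1 - \<zeta> * x)\<^sup>2 * (deriv ^^ 2) v x - 4 * \<zeta> * (1 - \<zeta> * x) * deriv v x + 2 * \<zeta>\<^sup>2 * v x) has_field_derivative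
        (1 - \<zeta> * y)\<^sup>2 * (deriv ^^ 3) v y - 6 * \<zeta> * (1 - \<zeta> * y) * (deriv ^^ 2) v y + 6 * \<zeta>\<^sup>2 * deriv v y) (at y)"
      by (auto intro!: derivative_eq_intros) (simp add: algebra_simps power2_eq_square)
  qed
  show "deriv Y x = (1 - \<zeta> * x)\<^sup>2 * deriv v x - 2 * \<zeta> * (1 - \<zeta> * x) * v x"
    "(deriv ^^ 2) Y x = (1 - \<zeta> * x)\<^sup>2 * (deriv ^^ 2) v x - 4 * \<zeta> * (1 - \<zeta> * x) * deriv v x + 2 * \<zeta>\<^sup>2 * v x"
    "(deriv ^^ 3) Y x = (1 - \<zeta> * x)\<^sup>2 * (deriv ^^ 3) v x - 6 * \<zeta> * (1 - \<zeta> * x) * (deriv ^^ 2) v x + 6 * \<zeta>\<^sup>2 * deriv v x"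
    by (rule higher_deriv_chain3[OF open_ball x A B C], assumption+)+
qed

lemma schwarzian_variation_eq_deriv3:
  assumes "\<zeta> \<in> unit_disc" "x \<in> unit_disc" "v holomorphic_on unit_disc"
  shows "((\<lambda>t. schwarzian (\<lambda>y. fiber_point \<zeta> y + t * v y) x) has_field_derivative
    (deriv ^^ 3) (\<lambda>x. (1 - \<zeta> * x)\<^sup>2 * v x) x) (at 0)"
  unfolding deriv3_conformal_factor(3)[OF assms(2,3)] by (rule schwarzian_variation[OF assms])

lemma holomorphic_primitive_disc:
  assumes "f holomorphic_on unit_disc"
  obtains g where "g holomorphic_on unit_disc" "g 0 = c"
    "\<And>z. z \<in> unit_disc \<Longrightarrow> (g has_field_derivative f z) (at z)"
proof -
  obtain g where g: "\<And>z. z \<in> unit_disc \<Longrightarrow> (g has_field_derivative f z) (at z within unit_disc)"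
    using holomorphic_convex_primitive'[OF convex_ball open_ball assms] by blast
  have *: "((\<lambda>z. g z - g 0 + c) has_field_derivative f z) (at z)" if "z \<in> unit_disc" for z
    using g[OF that] at_within_open[OF that open_ball]
    by (auto intro!: derivative_eq_intros)
  moreover have "(\<lambda>z. g z - g 0 + c) holomorphic_on unit_disc"
    unfolding holomorphic_on_open[OF open_ball] using * by blast
  ultimately show ?thesis
    by (intro that[of "\<lambda>z. g z - g 0 + c"]) simp_all
qed

text \<open>In terms of \<open>Y\<close> the conditions form the initial value problem that the
  third derivative is \<open>Q\<close> and the first three Taylor data at 0 are 0, 0 and 2 c. Three
  primitives solve it, and \<open>v\<close> is recovered by dividing by the conformal
  factor.\<close>

lemma tangent_vector_exists:
  assumes \<zeta>: "\<zeta> \<in> unit_disc" and Q: "Q holomorphic_on unit_disc"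
  shows "\<exists>v. v holomorphic_on unit_disc \<and> v 0 = 0 \<and> deriv v 0 = 0 \<and>
     (\<forall>x\<in>unit_disc. ((\<lambda>t. schwarzian (\<lambda>y. fiber_point \<zeta> y + t * v y) x) has_field_derivative Q x) (at 0)) \<and>
     (deriv ^^ 2) v 0 / 2 = c"
proof -
  \<comment> \<open>The initial value is 2 c because the coordinate \<open>c\<close> is half the
    second derivative, and the second derivatives of \<open>Y\<close> and \<open>v\<close> agree at
    0 when \<open>v\<close> and \<open>deriv v\<close> vanish there.\<close>
  obtain Y2 where Y2: "Y2 holomorphic_on unit_disc" "Y2 0 = 2 * c"
    "\<And>z. z \<in> unit_disc \<Longrightarrow> (Y2 has_field_derivative Q z) (at z)"
    using holomorphic_primitive_disc[OF Q] by metis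
  obtain Y1 where Y1: "Y1 holomorphic_on unit_disc" "Y1 0 = 0"
    "\<And>z. z \<in> unit_disc \<Longrightarrow> (Y1 has_field_derivative Y2 z) (at z)"
    using holomorphic_primitive_disc[OF Y2(1)] by metis
  obtain Y where Y: "Y holomorphic_on unit_disc" "Y 0 = 0"
    "\<And>z. z \<in> unit_disc \<Longrightarrow> (Y has_field_derivative Y1 z) (at z)"
    using holomorphic_primitive_disc[OF Y1(1)] by metis
  define v where "v x = Y x / (1 - \<zeta> * x)\<^sup>2" for x
  note nz = one_minus_mult_nonzero(1)[OF \<zeta>]
  have v: "v holomorphic_on unit_disc"
    unfolding v_def using Y(1) nz by (intro holomorphic_intros) auto
  have zero: "0 \<in> unit_disc"
    by simp
  define Z where "Z x = (1 - \<zeta> * x)\<^sup>2 * v x" for x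
  have ZY: "Z x = Y x" if "x \<in> unit_disc" for x
    using nz[OF that] by (simp add: Z_def v_def)
  have Z1: "(Z has_field_derivative Y1 x) (at x)" if "x \<in> unit_disc" for x
    by (rule has_field_derivative_transform_within_open[OF Y(3)[OF that] open_ball that]) (simp add: ZY)
  note dZ = higher_deriv_chain3[OF open_ball _ Z1 Y1(3) Y2(3)]
  note dv = deriv3_conformal_factor[OF _ v, of _ \<zeta>, folded Z_def[abs_def]]
  have v0: "v 0 = 0"
    by (simp add: v_def Y(2))
  have v1: "deriv v 0 = 0"
    using dv(1)[OF zero] dZ(1)[OF zero] v0 Y1(2) by simp
  have v2: "(deriv ^^ 2) v 0 / 2 = c"
    using dv(2)[OF zero] dZ(2)[OF zero] v0 v1 Y2(2) by simp
  have "((\<lambda>t. schwarzian (\<lambda>y. fiber_point \<zeta> y + t * v y) x) has_field_derivative Q x) (at 0)" if "x \<in> unit_disc" for x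
    using schwarzian_variation_eq_deriv3[OF \<zeta> that v] dZ(3)[OF that] by (simp add: Z_def[abs_def])
  with v v0 v1 v2 show ?thesis
    by blast
qed

text \<open>Replaces the choice in \<open>tangent_vector\<close> by its initial value problem for
  \<open>Y\<close>. This pins down \<open>Y\<close>, and with it \<open>v\<close>, on the
  disc.\<close>

lemma tangent_vector:
  fixes \<zeta> c :: complex
  assumes \<zeta>: "\<zeta> \<in> unit_disc" and Q: "Q holomorphic_on unit_disc"
  defines "v \<equiv> tangent_vector (fiber_point \<zeta>) Q c"
  defines "Y \<equiv> \<lambda>x. (1 - \<zeta> * x)\<^sup>2 * v x"
  shows "v holomorphic_on unit_disc"
    and "Y 0 = 0" "deriv Y 0 = 0" "(deriv ^^ 2) Y 0 = 2 * c"
    and "\<And>x. x \<in> unit_disc \<Longrightarrow> (deriv ^^ 3) Y x = Q x"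
proof -
  have v: "v holomorphic_on unit_disc \<and> v 0 = 0 \<and> deriv v 0 = 0 \<and>
     (\<forall>x\<in>unit_disc. ((\<lambda>t. schwarzian (\<lambda>y. fiber_point \<zeta> y + t * v y) x) has_field_derivative Q x) (at 0)) \<and>
     (deriv ^^ 2) v 0 / 2 = c"
    unfolding v_def tangent_vector_def by (rule someI_ex[OF tangent_vector_exists[OF \<zeta> Q]])
  then show hol: "v holomorphic_on unit_disc"
    by blast
  have zero: "(0::complex) \<in> unit_disc"
    by simp
  note dY = deriv3_conformal_factor[OF _ hol, of _ \<zeta>, folded Y_def]
  show "Y 0 = 0" "deriv Y 0 = 0" "(deriv ^^ 2) Y 0 = 2 * c"
    using v dY(1)[OF zero] dY(2)[OF zero] by (auto simp: Y_def)
  show "(deriv ^^ 3) Y x = Q x" if "x \<in> unit_disc" for x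
    using schwarzian_variation_eq_deriv3[OF \<zeta> that hol] v that DERIV_unique unfolding Y_def by blast
qed


section \<open>Transport of tangent vectors from the fiber to the origin\<close>

text \<open>This is \<open>Q_w\<close>, with the derivative of \<open>disc_shift w\<close> written
  out. The coefficients \<open>b m w\<close> of the overview are
  \<open>pullback_coeff Q w m\<close>.\<close>

definition disc_pullback :: "(complex \<Rightarrow> complex) \<Rightarrow> complex \<Rightarrow> complex \<Rightarrow> complex" where
  "disc_pullback Q w z = Q (disc_shift w z) * ((1 - w * cnj w) / (1 + cnj w * z)\<^sup>2)\<^sup>2"

definition pullback_coeff :: "(complex \<Rightarrow> complex) \<Rightarrow> complex \<Rightarrow> nat \<Rightarrow> complex" where
  "pullback_coeff Q w m = (deriv ^^ m) (disc_pullback Q w) 0 / fact m"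

lemma disc_shift_maps_disc: "w \<in> unit_disc \<Longrightarrow> z \<in> unit_disc \<Longrightarrow> disc_shift w z \<in> unit_disc"
  using PSU11_maps_disc[OF disc_shift_in_PSU11] by (metis restrict_apply')

lemma disc_shift_has_field_derivative:
  assumes "w \<in> unit_disc" "z \<in> unit_disc"
  shows "(disc_shift w has_field_derivative (1 - w * cnj w) / (1 + cnj w * z)\<^sup>2) (at z)"
proof -
  have "1 + cnj w * z \<noteq> 0"
    using one_minus_mult_nonzero(2)[of "cnj w" z] assms by simp
  then show ?thesis
    unfolding disc_shift_def[abs_def]
    by (auto intro!: derivative_eq_intros simp: power2_eq_square) (simp add: algebra_simps)
qed

lemma one_minus_norm_nonzero:
  assumes "w \<in> unit_disc"
  shows "1 - w * cnj w \<noteq> 0"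
  using one_minus_mult_nonzero(1)[of w "cnj w"] assms by simp

lemma disc_pullback_holomorphic:
  assumes "Q holomorphic_on unit_disc" "w \<in> unit_disc"
  shows "disc_pullback Q w holomorphic_on unit_disc"
proof -
  have "disc_shift w holomorphic_on unit_disc"
    unfolding holomorphic_on_open[OF open_ball] using disc_shift_has_field_derivative[OF assms(2)] by blast
  then have "Q \<circ> disc_shift w holomorphic_on unit_disc"
    using assms disc_shift_maps_disc by (intro holomorphic_on_compose_gen[where t = unit_disc]) auto
  then have "(\<lambda>z. Q (disc_shift w z)) holomorphic_on unit_disc"
    by (simp add: comp_def)
  moreover have "1 + cnj w * z \<noteq> 0" if "z \<in> unit_disc" for z
    using one_minus_mult_nonzero(2)[of "cnj w" z] assms that by simp
  ultimately show ?thesis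
    unfolding disc_pullback_def[abs_def] by (intro holomorphic_intros) auto
qed

text \<open>Composed with \<open>disc_shift w\<close>, the fiber point becomes the affine map (y +
  w) / k with k = 1 - w * cnj w. Differentiating the normalized quotient in t yields two
  corrections: the constant -v w keeps the value at 0, and the linear term comes from the changing
  derivative at 0 in the denominator.\<close>

lemma d_right_translate_eq:
  assumes w: "w \<in> unit_disc" and v: "v holomorphic_on unit_disc" and x: "x \<in> unit_disc"
  shows "d_right_translate (disc_shift w) (fiber_point (cnj w)) v x =
    (1 - w * cnj w) * (v (disc_shift w x) - v w - x * ((1 - w * cnj w) * deriv v w))"
proof -
  define k where "k = 1 - w * cnj w"
  have k: "k \<noteq> 0"
    using one_minus_norm_nonzero[OF w] by (simp add: k_def)
  have w0: "disc_shift w 0 = w"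
    by (simp add: disc_shift_def)
  have fp: "fiber_point (cnj w) (disc_shift w y) = (y + w) / k" if y: "y \<in> unit_disc" for y
  proof -
    have d: "1 + cnj w * y \<noteq> 0"
      using one_minus_mult_nonzero(2)[of "cnj w" y] w y by simp
    have "1 - cnj w * ((y + w) / (1 + cnj w * y)) = k / (1 + cnj w * y)"
      using d by (simp add: k_def divide_simps) (simp add: algebra_simps)
    then show ?thesis
      using d k by (simp add: fiber_point_def disc_shift_def)
  qed
  have dV: "((\<lambda>y. v (disc_shift w y)) has_field_derivative deriv v w * k) (at 0)"
    using DERIV_chain2[of v "deriv v w" "disc_shift w" 0 k UNIV] disc_shift_has_field_derivative[OF w, of 0]
      holomorphic_derivs(1)[OF v open_ball w] w0 by (simp add: k_def)
  have dF: "deriv (\<lambda>y. fiber_point (cnj w) (disc_shift w y) + t * v (disc_shift w y)) 0 = 1 / k + t * (deriv v w * k)" for t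
  proof (rule DERIV_imp_deriv, rule has_field_derivative_transform_within_open[of _ _ _ unit_disc])
    show "((\<lambda>y. (y + w) / k + t * v (disc_shift w y)) has_field_derivative 1 / k + t * (deriv v w * k)) (at 0)"
      using k by (auto intro!: derivative_eq_intros dV)
  qed (simp_all add: fp)
  have "((\<lambda>t. ((x + w) / k + t * v (disc_shift w x) - (w / k + t * v w)) / (1 / k + t * (deriv v w * k)))
      has_field_derivative k * (v (disc_shift w x) - v w - x * (k * deriv v w))) (at 0)"
    using k by (auto intro!: derivative_eq_intros) (simp add: field_simps)
  then show ?thesis
    unfolding d_right_translate_def right_translate_def dF fp[OF x] k_def[symmetric]
    using fp[of 0] w0 by (intro DERIV_imp_deriv) simp
qed

text \<open>Bol's lemma for \<gamma> = \<open>disc_shift w\<close>: the third derivative of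
  \<open>Y\<close> transported as a vector field is \<open>Q\<close> transported as a quadratic
  differential, so the third derivative of \<open>u\<close> is \<open>disc_pullback Q w\<close>. The
  index shift is 3 for the derivatives minus 1 for the convention in
  \<open>tangent_coeff\<close>.\<close>

lemma pushed_tangent_coeff:
  fixes c :: complex
  assumes w: "w \<in> unit_disc" and Q: "Q holomorphic_on unit_disc"
  defines "v \<equiv> tangent_vector (fiber_point (cnj w)) Q c"
  defines "u \<equiv> d_right_translate (disc_shift w) (fiber_point (cnj w)) v"
  defines "Y \<equiv> \<lambda>x. (1 - cnj w * x)\<^sup>2 * v x"
  defines "k \<equiv> 1 - w * cnj w"
  shows "tangent_coeff u (m + 2) = pullback_coeff Q w m / (of_nat (m + 1) * of_nat (m + 2) * of_nat (m + 3))"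
    and "tangent_coeff u 1 = (k\<^sup>2 * (deriv ^^ 2) Y w + 2 * (cnj w)\<^sup>2 * Y w + 2 * cnj w * k * deriv Y w) / (2 * k)"
proof -
  define \<zeta> where "\<zeta> = cnj w"
  have \<zeta>: "\<zeta> \<in> unit_disc"
    using w by (simp add: \<zeta>_def)
  have k: "k \<noteq> 0"
    using one_minus_norm_nonzero[OF w] by (simp add: k_def)
  have v: "v holomorphic_on unit_disc"
    using tangent_vector(1)[OF \<zeta> Q, of c] by (simp add: v_def \<zeta>_def)
  have Yhol: "Y holomorphic_on unit_disc"
    unfolding Y_def by (intro holomorphic_intros v)
  have Y3: "(deriv ^^ 3) Y x = Q x" if "x \<in> unit_disc" for x
    using tangent_vector(5)[OF \<zeta> Q that, of c] by (simp add: Y_def v_def \<zeta>_def)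
  define q where "q z = 1 + \<zeta> * z" for z
  have q: "q z \<noteq> 0" if "z \<in> unit_disc" for z
    using one_minus_mult_nonzero(2)[OF \<zeta> that] by (simp add: q_def)
  define \<gamma> where "\<gamma> = disc_shift w"
  have \<gamma>: "\<gamma> z \<in> unit_disc" "(\<gamma> has_field_derivative k / (q z)\<^sup>2) (at z)" if "z \<in> unit_disc" for z
    using disc_shift_maps_disc[OF w that] disc_shift_has_field_derivative[OF w that]
    by (simp_all add: \<gamma>_def k_def q_def \<zeta>_def)
  have pg: "1 - \<zeta> * \<gamma> z = k / q z" if "z \<in> unit_disc" for z
    using q[OF that] by (simp add: \<gamma>_def disc_shift_def q_def \<zeta>_def[symmetric] k_def divide_simps) (simp add: algebra_simps \<zeta>_def)
  define A where "A = - k * v w"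
  define B where "B = - k * (k * deriv v w)"
  \<comment> \<open>Since the derivative of \<gamma> is k / (q z)^2, the first summand is
    \<open>Y\<close> after \<gamma> divided by that derivative. The affine rest comes from the
    normalization and disappears in the second derivative.\<close>
  define U where "U z = Y (\<gamma> z) * (q z)\<^sup>2 / k + A + B * z" for z
  have uU: "u z = U z" if "z \<in> unit_disc" for z
  proof -
    have "Y (\<gamma> z) = (k / q z)\<^sup>2 * v (\<gamma> z)"
      using pg[OF that] by (simp add: Y_def \<zeta>_def)
    then have "Y (\<gamma> z) * (q z)\<^sup>2 / k = k * v (\<gamma> z)"
      using q[OF that] k by (simp add: field_simps power2_eq_square)
    then show ?thesis
      unfolding u_def d_right_translate_eq[OF w v that] U_def A_def B_def \<gamma>_def k_def
      by (simp add: algebra_simps)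
  qed
  have dY: "(Y has_field_derivative deriv Y (\<gamma> z)) (at (\<gamma> z))"
    "(deriv Y has_field_derivative (deriv ^^ 2) Y (\<gamma> z)) (at (\<gamma> z))"
    "((deriv ^^ 2) Y has_field_derivative Q (\<gamma> z)) (at (\<gamma> z))" if "z \<in> unit_disc" for z
    using holomorphic_derivs[OF Yhol open_ball \<gamma>(1)[OF that]] Y3[OF \<gamma>(1)[OF that]] by simp_all
  have comp: "((\<lambda>z. G (\<gamma> z)) has_field_derivative G' * (k / (q z)\<^sup>2)) (at z)"
    if "(G has_field_derivative G') (at (\<gamma> z))" "z \<in> unit_disc" for G G' z
    by (rule DERIV_chain2[OF that(1) \<gamma>(2)[OF that(2)]])
  have dq: "(q has_field_derivative \<zeta>) (at z)" for z
    unfolding q_def[abs_def] by (auto intro!: derivative_eq_intros)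
  have d0: "(u has_field_derivative deriv Y (\<gamma> z) + 2 * \<zeta> * q z * Y (\<gamma> z) / k + B) (at z)" if z: "z \<in> unit_disc" for z
  proof (rule has_field_derivative_transform_within_open[OF _ open_ball z])
    show "(U has_field_derivative deriv Y (\<gamma> z) + 2 * \<zeta> * q z * Y (\<gamma> z) / k + B) (at z)"
      unfolding U_def[abs_def]
      by (rule derivative_eq_intros comp[OF dY(1)[OF z] z] dq refl k)+ (use k q[OF z] in \<open>simp_all add: field_simps power2_eq_square\<close>)
  qed (simp add: uU)
  have d1: "((\<lambda>z. deriv Y (\<gamma> z) + 2 * \<zeta> * q z * Y (\<gamma> z) / k + B) has_field_derivative
      k * (deriv ^^ 2) Y (\<gamma> z) / (q z)\<^sup>2 + 2 * \<zeta>\<^sup>2 * Y (\<gamma> z) / k + 2 * \<zeta> * deriv Y (\<gamma> z) / q z) (at z)" if z: "z \<in> unit_disc" for z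
    by (rule derivative_eq_intros comp[OF dY(1)[OF z] z] comp[OF dY(2)[OF z] z] dq refl k)+
       (use k q[OF z] in \<open>simp_all add: field_simps power2_eq_square\<close>)
  have d2: "((\<lambda>z. k * (deriv ^^ 2) Y (\<gamma> z) / (q z)\<^sup>2 + 2 * \<zeta>\<^sup>2 * Y (\<gamma> z) / k + 2 * \<zeta> * deriv Y (\<gamma> z) / q z)
      has_field_derivative disc_pullback Q w z) (at z)" if z: "z \<in> unit_disc" for z
  proof -
    have "disc_pullback Q w z = Q (\<gamma> z) * (k / (q z)\<^sup>2)\<^sup>2"
      by (simp add: disc_pullback_def \<gamma>_def k_def q_def \<zeta>_def)
    then show ?thesis
      by (simp only:) ((rule derivative_eq_intros comp[OF dY(1)[OF z] z] comp[OF dY(2)[OF z] z] comp[OF dY(3)[OF z] z] dq refl k q[OF z] power_not_zero)+,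
        use k q[OF z] in \<open>simp add: field_simps eval_nat_numeral\<close>)
  qed
  note du = higher_deriv_chain3[OF open_ball _ d0 d1 d2]
  have zero: "(0::complex) \<in> unit_disc"
    by simp
  have \<gamma>0: "\<gamma> 0 = w" "q 0 = 1"
    by (simp_all add: \<gamma>_def disc_shift_def q_def)
  show "tangent_coeff u 1 = (k\<^sup>2 * (deriv ^^ 2) Y w + 2 * (cnj w)\<^sup>2 * Y w + 2 * cnj w * k * deriv Y w) / (2 * k)"
  proof -
    have "tangent_coeff u 1 = (deriv ^^ 2) u 0 / 2"
      by (simp add: tangent_coeff_def numeral_2_eq_2[symmetric])
    also have "(deriv ^^ 2) u 0 = k * (deriv ^^ 2) Y w + 2 * \<zeta>\<^sup>2 * Y w / k + 2 * \<zeta> * deriv Y w"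
      using du(2)[OF zero] by (simp add: \<gamma>0)
    finally show ?thesis
      using k by (simp add: \<zeta>_def[symmetric] field_simps power2_eq_square)
  qed
  have uhol: "u holomorphic_on unit_disc"
    unfolding holomorphic_on_open[OF open_ball] using d0 by blast
  have du3: "(deriv ^^ 3) u z = disc_pullback Q w z" if "z \<in> unit_disc" for z
    by (rule higher_deriv_chain3(3)[OF open_ball that d0 d1 d2])
  have "(deriv ^^ (m + 3)) u 0 = (deriv ^^ m) ((deriv ^^ 3) u) 0"
    by (simp add: funpow_add)
  also have "\<dots> = (deriv ^^ m) (disc_pullback Q w) 0"
    by (rule higher_deriv_transform_within_open[OF _ _ open_ball zero])
       (use du3 in \<open>auto intro!: holomorphic_higher_deriv uhol disc_pullback_holomorphic Q w simp del: mem_ball_0\<close>)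
  finally have "(deriv ^^ (m + 3)) u 0 = (deriv ^^ m) (disc_pullback Q w) 0" .
  moreover have "fact (m + 3) = (fact m * (of_nat (m + 1) * of_nat (m + 2) * of_nat (m + 3)) :: complex)"
    by (simp add: numeral_3_eq_3 algebra_simps)
  ultimately show "tangent_coeff u (m + 2) = pullback_coeff Q w m / (of_nat (m + 1) * of_nat (m + 2) * of_nat (m + 3))"
    unfolding tangent_coeff_def pullback_coeff_def by (simp add: numeral_eq_Suc)
qed


lemma zero_derivative_disc:
  assumes "\<And>z. z \<in> unit_disc \<Longrightarrow> (g has_field_derivative 0) (at z)" "z \<in> unit_disc"
  shows "g z = (g 0 :: complex)"
proof -
  obtain c where "\<forall>x\<in>unit_disc. g x = c"
    using has_field_derivative_zero_constant[OF convex_ball, of 0 1 g] assms(1) has_field_derivative_at_within by blast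
  then show ?thesis
    using assms(2) by simp
qed

text \<open>For \<open>Q\<close> = 0 and c = 1 the initial value problem has the solution z^2, and
  after transport only the mode n = 1 is left. Its coefficient is the hyperbolic length element, so
  the Velling-Kirillov metric restricts to a hyperbolic metric on the fiber.\<close>

lemma vertical_tangent_coeff:
  assumes w: "w \<in> unit_disc"
  defines "v \<equiv> tangent_vector (fiber_point (cnj w)) (\<lambda>_. 0) 1"
  defines "u \<equiv> d_right_translate (disc_shift w) (fiber_point (cnj w)) v"
  shows "tangent_coeff u (m + 2) = 0"
    and "tangent_coeff u 1 = 1 / (1 - w * cnj w)"
proof -
  have "disc_pullback (\<lambda>_. 0) w = (\<lambda>_. 0)"
    by (simp add: disc_pullback_def[abs_def])
  then have "pullback_coeff (\<lambda>_. 0) w m = 0"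
    by (simp add: pullback_coeff_def)
  then show "tangent_coeff u (m + 2) = 0"
    using pushed_tangent_coeff(1)[OF w, of "\<lambda>_. 0" 1 m] by (simp add: u_def v_def)
  define \<zeta> where "\<zeta> = cnj w"
  have \<zeta>: "\<zeta> \<in> unit_disc"
    using w by (simp add: \<zeta>_def)
  define Y where "Y x = (1 - \<zeta> * x)\<^sup>2 * v x" for x
  note tv = tangent_vector[OF \<zeta>, where Q = "\<lambda>_. 0" and c = 1, OF holomorphic_on_const, folded v_def[folded \<zeta>_def], folded Y_def[abs_def]]
  have Yhol: "Y holomorphic_on unit_disc"
    unfolding Y_def[abs_def] by (intro holomorphic_intros tv(1))
  note d = holomorphic_derivs[OF Yhol open_ball]
  have Y2: "(deriv ^^ 2) Y z = 2" if "z \<in> unit_disc" for z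
    using zero_derivative_disc[of "(deriv ^^ 2) Y" z] d(3) tv(4,5) that by simp
  have Y1: "deriv Y z = 2 * z" if "z \<in> unit_disc" for z
  proof -
    have "((\<lambda>z. deriv Y z - 2 * z) has_field_derivative 0) (at z)" if "z \<in> unit_disc" for z
      using DERIV_diff[OF d(2)[OF that] DERIV_cmult_Id[of 2]] Y2[OF that] by simp
    from zero_derivative_disc[OF this that] show ?thesis
      using tv(3) by simp
  qed
  have Y0: "Y z = z\<^sup>2" if "z \<in> unit_disc" for z
  proof -
    have "((\<lambda>z. Y z - z\<^sup>2) has_field_derivative 0) (at z)" if "z \<in> unit_disc" for z
      using Y1[OF that] by (auto intro!: derivative_eq_intros d(1)[OF that])
    moreover have "Y 0 = 0"
      using tv(2) by (simp add: Y_def)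
    ultimately show ?thesis
      using zero_derivative_disc[of "\<lambda>z. Y z - z\<^sup>2", OF _ that] by simp
  qed
  define k where "k = 1 - w * cnj w"
  have k: "k \<noteq> 0"
    using one_minus_norm_nonzero[OF w] by (simp add: k_def)
  have "tangent_coeff u 1 = (k\<^sup>2 * (deriv ^^ 2) Y w + 2 * \<zeta>\<^sup>2 * Y w + 2 * \<zeta> * k * deriv Y w) / (2 * k)"
    using pushed_tangent_coeff(2)[OF w, of "\<lambda>_. 0" 1] by (simp add: u_def v_def k_def Y_def[abs_def] \<zeta>_def)
  also have "\<dots> = (k + w * cnj w)\<^sup>2 / k"
    using k by (simp add: Y0[OF w] Y1[OF w] Y2[OF w] \<zeta>_def field_simps power2_eq_square)
  also have "k + w * cnj w = 1"
    by (simp add: k_def)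
  finally show "tangent_coeff u 1 = 1 / (1 - w * cnj w)"
    by (simp add: k_def)
qed

text \<open>If \<open>b m\<close> are the Taylor coefficients of \<open>Q_w\<close>, then \<open>a_n = b (n - 2) / (n^3 - n)\<close>, so that
  \<open>n * \<bar>a_n\<bar>^2 = S_weight m * \<bar>b m\<bar>^2\<close> for \<open>n = m + 2\<close>.\<close>

definition S_weight :: "nat \<Rightarrow> real" where
  "S_weight m = 1 / ((real m + 1)\<^sup>2 * (real m + 2) * (real m + 3)\<^sup>2)"

section \<open>The fiber density as a Gram determinant\<close>

lemma VK_hermitian_zero: "VK_hermitian_origin (\<lambda>_. 0) v = 0" "VK_hermitian_origin v (\<lambda>_. 0) = 0"
  by (simp_all add: VK_hermitian_origin_def tangent_coeff_def)

text \<open>On the lift \<open>q\<close> and the vertical vector \<open>e\<close> the six terms of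
  the wedge collapse to -1/2 times the Gram determinant of \<open>q\<close> and \<open>e\<close>. As
  \<open>e\<close> is a pure mode n = 1, the determinant cancels exactly the mode n = 1 of
  \<open>q\<close>, whose value is therefore never computed. What remains is the sum over n > 1
  times the squared length of \<open>e\<close>.\<close>

lemma fiber_density_eq:
  assumes w: "w \<in> unit_disc" and Q: "Q holomorphic_on unit_disc"
    and summable: "summable (\<lambda>m. S_weight m * (cmod (pullback_coeff Q w m))\<^sup>2)"
  shows "fiber_density Q Q (cnj w) =
    complex_of_real (- 1/2 * (\<Sum>m. S_weight m * (cmod (pullback_coeff Q w m))\<^sup>2) / (1 - (cmod w)\<^sup>2)\<^sup>2)"
proof -
  define D where "D = d_right_translate (disc_shift w) (fiber_point (cnj w))"
  define q where "q = D (tangent_vector (fiber_point (cnj w)) Q 0)"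
  define e where "e = D (tangent_vector (fiber_point (cnj w)) (\<lambda>_. 0) 1)"
  let ?H = VK_hermitian_origin
  have D0: "D (\<lambda>_. 0) = (\<lambda>_. 0)"
    by (rule ext) (simp add: D_def d_right_translate_def)
  have q: "tangent_coeff q (m + 2) = pullback_coeff Q w m / (of_nat (m + 1) * of_nat (m + 2) * of_nat (m + 3))" for m
    unfolding q_def D_def by (rule pushed_tangent_coeff[OF w Q])
  have e: "tangent_coeff e (m + 2) = 0" "tangent_coeff e 1 = 1 / (1 - w * cnj w)" for m
    unfolding e_def D_def by (rule vertical_tangent_coeff[OF w])+
  \<comment> \<open>The coefficient at n = 0 is left open since the weight n in the Hermitian form
    annihilates it.\<close>
  have e0: "n = 0 \<or> tangent_coeff e n = 0" if "n \<noteq> 1" for n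
  proof (cases "n = 0")
    case False
    then have "n - 2 + 2 = n"
      using that by simp
    then show ?thesis
      using e(1)[of "n - 2"] by (simp only: simp_thms)
  qed simp
  have H1: "?H u e = tangent_coeff u 1 * cnj (tangent_coeff e 1)" for u
  proof -
    have "of_nat n * tangent_coeff u n * cnj (tangent_coeff e n) = 0" if "n \<notin> {1}" for n
      using e0[of n] that by auto
    then show ?thesis
      unfolding VK_hermitian_origin_def by (subst suminf_finite[of "{1}"]) auto
  qed
  have H2: "?H e u = tangent_coeff e 1 * cnj (tangent_coeff u 1)" for u
  proof -
    have "of_nat n * tangent_coeff e n * cnj (tangent_coeff u n) = 0" if "n \<notin> {1}" for n
      using e0[of n] that by auto
    then show ?thesis
      unfolding VK_hermitian_origin_def by (subst suminf_finite[of "{1}"]) auto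
  qed
  define a where "a n = of_nat n * tangent_coeff q n * cnj (tangent_coeff q n)" for n
  have a: "a (m + 2) = complex_of_real (S_weight m * (cmod (pullback_coeff Q w m))\<^sup>2)" for m
  proof -
    have "a (m + 2) = of_nat (m + 2) / (of_nat (m + 1) * of_nat (m + 2) * of_nat (m + 3))\<^sup>2 * (pullback_coeff Q w m * cnj (pullback_coeff Q w m))"
      unfolding a_def q by (simp add: power2_eq_square del: of_nat_Suc of_nat_add)
    also have "of_nat (m + 2) / (of_nat (m + 1) * of_nat (m + 2) * of_nat (m + 3))\<^sup>2 = complex_of_real (S_weight m)"
    proof -
      have "complex_of_real (S_weight m) = complex_of_real (real (m + 2) / (real (m + 1) * real (m + 2) * real (m + 3))\<^sup>2)"
      proof -
        have "1 / (A\<^sup>2 * B * C\<^sup>2) = B / (A * B * C)\<^sup>2" if "B \<noteq> 0" for A B C :: real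
          using that by (simp add: power2_eq_square)
        from this[of "real m + 2" "real m + 1" "real m + 3"] show ?thesis
          unfolding S_weight_def of_real_eq_iff by (simp add: add_ac)
      qed
      then show ?thesis
        by simp
    qed
    finally show ?thesis
      unfolding of_real_mult complex_norm_square .
  qed
  have Hqq: "?H q q = complex_of_real (\<Sum>m. S_weight m * (cmod (pullback_coeff Q w m))\<^sup>2) + tangent_coeff q 1 * cnj (tangent_coeff q 1)"
  proof -
    have s: "(\<lambda>m. a (m + 2)) sums complex_of_real (\<Sum>m. S_weight m * (cmod (pullback_coeff Q w m))\<^sup>2)"
      unfolding a using summable by (intro sums_of_real summable_sums)
    then have "a sums (complex_of_real (\<Sum>m. S_weight m * (cmod (pullback_coeff Q w m))\<^sup>2) + (\<Sum>i<2. a i))"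
      by (simp only: sums_iff_shift)
    then show ?thesis
      unfolding VK_hermitian_origin_def a_def[abs_def, symmetric]
      by (simp add: sums_iff a_def numeral_2_eq_2)
  qed
  have kappa: "kappa (cnj w) (hol_part x) (conj_part y) = \<i>/2 * ?H (D x) (D y)"
    "kappa (cnj w) (conj_part y) (hol_part x) = - \<i>/2 * ?H (D x) (D y)"
    "kappa (cnj w) (hol_part x) (hol_part y) = 0"
    "kappa (cnj w) (conj_part x) (conj_part y) = 0" for x y
    by (simp_all add: kappa_def D_def[symmetric] hol_part_def conj_part_def kappa_origin_def D0 VK_hermitian_zero Let_def)
  have "fiber_density Q Q (cnj w) = - 1/2 * (?H q q * ?H e e - ?H q e * ?H e q)"
    unfolding fiber_density_def Let_def wedge_2_2_def kappa q_def[symmetric] e_def[symmetric]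
    by (simp add: algebra_simps)
  also have "\<dots> = - 1/2 * (complex_of_real (\<Sum>m. S_weight m * (cmod (pullback_coeff Q w m))\<^sup>2) * (tangent_coeff e 1 * cnj (tangent_coeff e 1)))"
    unfolding Hqq H1 H2 by (simp add: algebra_simps)
  also have "tangent_coeff e 1 * cnj (tangent_coeff e 1) = complex_of_real (1 / (1 - (cmod w)\<^sup>2)\<^sup>2)"
    unfolding e of_real_divide of_real_power cmod_sq_eq by (simp add: power2_eq_square mult.commute)
  finally show ?thesis
    by simp
qed

subsection \<open>Taylor coefficients of the pulled back differentials\<close>

text \<open>Needed for measurability in \<open>w\<close>, on which the coefficients depend through
  \<open>cnj w\<close> as well. Differentiating in z reproduces the same family with
  \<open>deriv R\<close> and exponent b + 2, and with \<open>R\<close> and exponent b + 1, so the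
  induction runs over all \<open>R\<close> and \<open>b\<close>.\<close>

lemma pullback_higher_deriv_continuous:
  assumes "R holomorphic_on unit_disc"
  shows "continuous_on unit_disc (\<lambda>w. (deriv ^^ m) (\<lambda>z. R (disc_shift w z) / (1 + cnj w * z) ^ b) 0)"
  using assms
proof (induction m arbitrary: R b)
  case 0
  then show ?case
    by (simp add: disc_shift_def holomorphic_on_imp_continuous_on)
next
  case (Suc m)
  define g where "g R b w z = R (disc_shift w z) / (1 + cnj w * z) ^ b" for R b w z
  have zero: "(0::complex) \<in> unit_disc"
    by simp
  have nz: "1 + cnj w * z \<noteq> 0" if "w \<in> unit_disc" "z \<in> unit_disc" for w z
    using one_minus_mult_nonzero(2)[of "cnj w" z] that by simp
  have ghol: "g R b w holomorphic_on unit_disc" if R: "R holomorphic_on unit_disc" and w: "w \<in> unit_disc" for R b w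
  proof -
    have "disc_shift w holomorphic_on unit_disc"
      unfolding holomorphic_on_open[OF open_ball] using disc_shift_has_field_derivative[OF w] by blast
    then have "R \<circ> disc_shift w holomorphic_on unit_disc"
      using R w disc_shift_maps_disc by (intro holomorphic_on_compose_gen[where t = unit_disc]) auto
    then show ?thesis
      unfolding g_def[abs_def] comp_def using nz[OF w] by (intro holomorphic_intros) auto
  qed
  have R': "deriv R holomorphic_on unit_disc"
    by (intro holomorphic_deriv Suc.prems open_ball)
  have step: "(deriv ^^ Suc m) (g R b w) 0 =
      (1 - w * cnj w) * (deriv ^^ m) (g (deriv R) (b + 2) w) 0 - of_nat b * cnj w * (deriv ^^ m) (g R (b + 1) w) 0"
    if w: "w \<in> unit_disc" for w
  proof -
    have d: "deriv (g R b w) z = (1 - w * cnj w) * g (deriv R) (b + 2) w z - (of_nat b * cnj w) * g R (b + 1) w z"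
      if z: "z \<in> unit_disc" for z
    proof (rule DERIV_imp_deriv)
      define q where "q = 1 + cnj w * z"
      have q: "q \<noteq> 0"
        using nz[OF w z] by (simp add: q_def)
      have 1: "((\<lambda>z. R (disc_shift w z)) has_field_derivative deriv R (disc_shift w z) * ((1 - w * cnj w) / q\<^sup>2)) (at z)"
        unfolding q_def
        by (rule DERIV_chain2[OF holomorphic_derivs(1)[OF Suc.prems open_ball disc_shift_maps_disc[OF w z]]
              disc_shift_has_field_derivative[OF w z]])
      have "((\<lambda>z. (1 + cnj w * z) ^ b) has_field_derivative of_nat b * q ^ (b - 1) * cnj w) (at z)"
        unfolding q_def by (auto intro!: derivative_eq_intros)
      from DERIV_divide[OF 1 this] q
      have "(g R b w has_field_derivative
          (deriv R (disc_shift w z) * ((1 - w * cnj w) / q\<^sup>2) * q ^ b - R (disc_shift w z) * (of_nat b * q ^ (b - 1) * cnj w)) / (q ^ b * q ^ b)) (at z)"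
        by (simp add: g_def[abs_def] q_def)
      also have "(deriv R (disc_shift w z) * ((1 - w * cnj w) / q\<^sup>2) * q ^ b - R (disc_shift w z) * (of_nat b * q ^ (b - 1) * cnj w)) / (q ^ b * q ^ b)
          = (1 - w * cnj w) * g (deriv R) (b + 2) w z - (of_nat b * cnj w) * g R (b + 1) w z"
        using q unfolding g_def q_def[symmetric]
        by (cases b) (simp_all add: field_simps power2_eq_square)
      finally show "(g R b w has_field_derivative (1 - w * cnj w) * g (deriv R) (b + 2) w z - (of_nat b * cnj w) * g R (b + 1) w z) (at z)" .
    qed
    note h1 = ghol[OF R' w, of "b + 2"] and h2 = ghol[OF Suc.prems w, of "b + 1"]
    have "(deriv ^^ Suc m) (g R b w) 0 = (deriv ^^ m) (deriv (g R b w)) 0"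
      by (simp only: funpow_Suc_right comp_apply)
    also have "\<dots> = (deriv ^^ m) (\<lambda>z. (1 - w * cnj w) * g (deriv R) (b + 2) w z - (of_nat b * cnj w) * g R (b + 1) w z) 0"
      by (rule higher_deriv_transform_within_open[OF _ _ open_ball zero d])
         (intro holomorphic_intros holomorphic_deriv ghol Suc.prems w h1 h2 open_ball)+
    also have "\<dots> = (deriv ^^ m) (\<lambda>z. (1 - w * cnj w) * g (deriv R) (b + 2) w z) 0 - (deriv ^^ m) (\<lambda>z. (of_nat b * cnj w) * g R (b + 1) w z) 0"
      by (rule higher_deriv_diff[OF _ _ open_ball zero]) (intro holomorphic_intros h1 h2)+
    also have "(deriv ^^ m) (\<lambda>z. (1 - w * cnj w) * g (deriv R) (b + 2) w z) 0 = (1 - w * cnj w) * (deriv ^^ m) (g (deriv R) (b + 2) w) 0"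
      by (rule higher_deriv_cmult[OF h1 zero open_ball])
    also have "(deriv ^^ m) (\<lambda>z. (of_nat b * cnj w) * g R (b + 1) w z) 0 = (of_nat b * cnj w) * (deriv ^^ m) (g R (b + 1) w) 0"
      by (rule higher_deriv_cmult[OF h2 zero open_ball])
    finally show ?thesis .
  qed
  have "continuous_on unit_disc (\<lambda>w. (1 - w * cnj w) * (deriv ^^ m) (g (deriv R) (b + 2) w) 0 - of_nat b * cnj w * (deriv ^^ m) (g R (b + 1) w) 0)"
    using Suc.IH[OF R', of "b + 2"] Suc.IH[OF Suc.prems, of "b + 1"]
    unfolding g_def[abs_def] by (intro continuous_intros)
  then have "continuous_on unit_disc (\<lambda>w. (deriv ^^ Suc m) (g R b w) 0)"
    by (rule continuous_on_eq) (simp only: step)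
  then show ?case
    unfolding g_def[abs_def] .
qed

lemma pullback_coeff_continuous:
  assumes Q: "Q holomorphic_on unit_disc"
  shows "continuous_on unit_disc (\<lambda>w. pullback_coeff Q w m)"
proof -
  have zero: "(0::complex) \<in> unit_disc"
    by simp
  have eq: "pullback_coeff Q w m = (1 - w * cnj w)\<^sup>2 * (deriv ^^ m) (\<lambda>z. Q (disc_shift w z) / (1 + cnj w * z) ^ 4) 0 / fact m"
    if w: "w \<in> unit_disc" for w
  proof -
    have nz: "1 + cnj w * z \<noteq> 0" if "z \<in> unit_disc" for z
      using one_minus_mult_nonzero(2)[of "cnj w" z] w that by simp
    have k: "1 - w * cnj w \<noteq> 0"
      by (rule one_minus_norm_nonzero[OF w])
    have eq: "disc_pullback Q w = (\<lambda>z. (1 - w * cnj w)\<^sup>2 * (Q (disc_shift w z) / (1 + cnj w * z) ^ 4))"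
      by (simp add: fun_eq_iff disc_pullback_def power_divide power_mult[symmetric])
    have "(\<lambda>z. (1 / (1 - w * cnj w)\<^sup>2) * disc_pullback Q w z) holomorphic_on unit_disc"
      by (intro holomorphic_intros disc_pullback_holomorphic[OF Q w])
    also have "(\<lambda>z. (1 / (1 - w * cnj w)\<^sup>2) * disc_pullback Q w z) = (\<lambda>z. Q (disc_shift w z) / (1 + cnj w * z) ^ 4)"
      unfolding eq using k by (simp add: fun_eq_iff)
    finally show ?thesis
      unfolding pullback_coeff_def eq by (subst higher_deriv_cmult[OF _ zero open_ball]) simp_all
  qed
  have "continuous_on unit_disc
      (\<lambda>w. (1 - w * cnj w)\<^sup>2 * (deriv ^^ m) (\<lambda>z. Q (disc_shift w z) / (1 + cnj w * z) ^ 4) 0 / fact m)"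
    by (intro continuous_intros pullback_higher_deriv_continuous Q) simp
  then show ?thesis
    by (rule continuous_on_eq) (simp only: eq)
qed

lemma disc_pullback_sums:
  assumes "Q holomorphic_on unit_disc" "w \<in> unit_disc" "z \<in> unit_disc"
  shows "(\<lambda>m. pullback_coeff Q w m * z ^ m) sums disc_pullback Q w z"
  using holomorphic_power_series[OF disc_pullback_holomorphic[OF assms(1,2)] assms(3)]
  by (simp add: pullback_coeff_def)

subsection \<open>Point-pair invariants\<close>

text \<open>This is \<open>1 - \<bar>disc_shift (- w) u\<bar>^2\<close>, written so that the symmetry is visible.\<close>

definition pair_invariant :: "complex \<Rightarrow> complex \<Rightarrow> real" where
  "pair_invariant u w = (1 - (cmod u)\<^sup>2) * (1 - (cmod w)\<^sup>2) / (cmod (1 - cnj w * u))\<^sup>2"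

lemma pair_invariant_commute: "pair_invariant u w = pair_invariant w u"
proof -
  have "cmod (1 - cnj w * u) = cmod (cnj (1 - cnj w * u))"
    by (rule complex_mod_cnj[symmetric])
  then show ?thesis
    by (simp add: pair_invariant_def mult.commute)
qed

text \<open>The polarised identity divides 1 - cnj w * u by the automorphy factors
  \<open>cnj (d w)\<close> and \<open>d u\<close>, and its diagonal case divides each factor of the
  numerator by the squared modulus of its own factor. In the quotient they cancel.\<close>

lemma pair_invariant_PSU11:
  assumes "g \<in> PSU11" and u: "u \<in> unit_disc" and w: "w \<in> unit_disc"
  shows "pair_invariant (g u) (g w) = pair_invariant u w"
proof -
  obtain a b where ab: "(a, b) \<in> su11" and g: "g = (\<lambda>z\<in>unit_disc. (a * z + b) / (cnj b * z + cnj a))"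
    using assms(1) by (rule PSU11_cases)
  define d where "d z = cnj b * z + cnj a" for z
  have d: "d u \<noteq> 0" "d w \<noteq> 0"
    using su11_den[OF ab u] su11_den[OF ab w] by (simp_all add: d_def)
  have gz: "g z = (a * z + b) / d z" if "z \<in> unit_disc" for z
    unfolding g d_def using that by (rule restrict_apply')
  have "1 - cnj (g w) * g u = (1 - cnj w * u) / (cnj (d w) * d u)"
    unfolding gz[OF u] gz[OF w] d_def by (rule su11_polarized[OF ab u w])
  moreover have "1 - (cmod (g u))\<^sup>2 = (1 - (cmod u)\<^sup>2) / (cmod (d u))\<^sup>2" "1 - (cmod (g w))\<^sup>2 = (1 - (cmod w)\<^sup>2) / (cmod (d w))\<^sup>2"
    unfolding gz[OF u] gz[OF w] d_def by (rule su11_one_minus_cmod_sq[OF ab], fact)+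
  ultimately show ?thesis
    unfolding pair_invariant_def using d
    by (simp add: norm_divide norm_mult power_divide power_mult_distrib)
qed

text \<open>Integrating the invariant density \<open>\<bar>Q\<bar>^2 (1 - \<bar>u\<bar>^2)^4\<close> against this kernel at \<open>w\<close> gives the plain area
  integral of \<open>\<bar>Q_w\<bar>^2\<close> over the disc of radius \<open>sqrt \<rho>\<close>.\<close>

definition disc_kernel :: "real \<Rightarrow> complex \<Rightarrow> complex \<Rightarrow> ennreal" where
  "disc_kernel \<rho> u w = (if 1 - \<rho> \<le> pair_invariant u w then ennreal (1 / (pair_invariant u w)\<^sup>2) else 0)"

lemma borel_measurable_disc_kernel [measurable]:
  "case_prod (disc_kernel \<rho>) \<in> borel_measurable (borel \<Otimes>\<^sub>M borel)"
proof -
  have [measurable]: "(\<lambda>(u, w). cmod (1 - cnj w * u)) \<in> borel_measurable (borel \<Otimes>\<^sub>M borel :: (complex \<times> complex) measure)"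
    unfolding borel_prod split_beta by (intro borel_measurable_continuous_onI continuous_intros)
  have [measurable]: "(\<lambda>(u, w). pair_invariant u w) \<in> borel_measurable (borel \<Otimes>\<^sub>M borel :: (complex \<times> complex) measure)"
    unfolding pair_invariant_def split_beta by measurable
  show ?thesis
    unfolding disc_kernel_def split_beta by measurable
qed

lemma disc_kernel_commute: "disc_kernel \<rho> u w = disc_kernel \<rho> w u"
  by (simp add: disc_kernel_def pair_invariant_commute)

lemma disc_kernel_PSU11:
  "g \<in> PSU11 \<Longrightarrow> u \<in> unit_disc \<Longrightarrow> w \<in> unit_disc \<Longrightarrow> disc_kernel \<rho> (g u) (g w) = disc_kernel \<rho> u w"
  unfolding disc_kernel_def by (simp only: pair_invariant_PSU11)

text \<open>By invariance \<open>w\<close> may be moved to 0, where the invariant of z and 0 is 1 -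
  \<bar>z\<bar>^2, so that the threshold 1 - \<rho> describes a disc about 0.\<close>

lemma disc_kernel_disc_shift:
  assumes "w \<in> unit_disc" "z \<in> unit_disc"
  shows "disc_kernel \<rho> (disc_shift w z) w = indicator (cball 0 (sqrt \<rho>)) z * ennreal (1 / (1 - (cmod z)\<^sup>2)\<^sup>2)"
proof -
  have "disc_kernel \<rho> (disc_shift w z) (disc_shift w 0) = disc_kernel \<rho> z 0"
    using disc_kernel_PSU11[OF disc_shift_in_PSU11[OF assms(1)] assms(2), of 0 \<rho>] assms(2) by simp
  moreover have "cmod z \<le> sqrt \<rho> \<longleftrightarrow> (cmod z)\<^sup>2 \<le> \<rho>"
    by (metis norm_ge_zero real_sqrt_le_iff real_sqrt_unique)
  ultimately show ?thesis
    by (simp add: disc_kernel_def pair_invariant_def disc_shift_def)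
qed

text \<open>Substitution of \<open>disc_shift w z\<close> for \<open>u\<close>. Of the exponent 4,
  two come from the kernel and two from the density of \<open>hyp\<close>.\<close>

lemma nn_integral_disc_kernel:
  assumes w: "w \<in> unit_disc" and [measurable]: "f \<in> borel_measurable borel"
  shows "(\<integral>\<^sup>+u. f u * disc_kernel \<rho> u w \<partial>hyp) =
    (\<integral>\<^sup>+z. f (disc_shift w z) * ennreal (1 / (1 - (cmod z)\<^sup>2) ^ 4) * indicator unit_disc z * indicator (cball 0 (sqrt \<rho>)) z \<partial>lborel)"
proof -
  define g where "g = (\<lambda>z\<in>unit_disc. disc_shift w z)"
  have g: "g \<in> PSU11"
    unfolding g_def by (rule disc_shift_in_PSU11[OF w])
  note [measurable] = PSU11_borel_measurable[OF g]
  have [measurable]: "(\<lambda>u. disc_kernel \<rho> u w) \<in> borel_measurable borel"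
    using measurable_Pair2[OF borel_measurable_disc_kernel, of w] by simp
  have "(\<integral>\<^sup>+u. f u * disc_kernel \<rho> u w \<partial>hyp) = (\<integral>\<^sup>+z. f (g z) * disc_kernel \<rho> (g z) w \<partial>hyp)"
    by (rule nn_integral_hyp_PSU11[OF g, symmetric]) measurable
  also have "\<dots> = (\<integral>\<^sup>+z. ennreal (1 / (1 - (cmod z)\<^sup>2)\<^sup>2) * indicator unit_disc z * (f (g z) * disc_kernel \<rho> (g z) w) \<partial>lborel)"
    by (rule nn_integral_hyp) measurable
  also have "\<dots> = (\<integral>\<^sup>+z. f (disc_shift w z) * ennreal (1 / (1 - (cmod z)\<^sup>2) ^ 4) * indicator unit_disc z * indicator (cball 0 (sqrt \<rho>)) z \<partial>lborel)"
  proof (rule nn_integral_cong)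
    fix z :: complex
    show "ennreal (1 / (1 - (cmod z)\<^sup>2)\<^sup>2) * indicator unit_disc z * (f (g z) * disc_kernel \<rho> (g z) w) =
      f (disc_shift w z) * ennreal (1 / (1 - (cmod z)\<^sup>2) ^ 4) * indicator unit_disc z * indicator (cball 0 (sqrt \<rho>)) z"
    proof (cases "z \<in> unit_disc")
      case True
      have "ennreal (1 / (1 - (cmod z)\<^sup>2) ^ 4) = ennreal (1 / (1 - (cmod z)\<^sup>2)\<^sup>2) * ennreal (1 / (1 - (cmod z)\<^sup>2)\<^sup>2)"
        by (simp add: ennreal_mult[symmetric] power_add[symmetric])
      then show ?thesis
        using True disc_kernel_disc_shift[OF w True] by (simp add: g_def mult_ac)
    qed simp
  qed
  finally show ?thesis .
qed

subsection \<open>Integrals over fundamental domains\<close>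

definition mass_coeff :: "nat \<Rightarrow> real" where
  "mass_coeff m = (real m + 1) * (real m + 2) * (real m + 3) / 6"

text \<open>The Cauchy product with the geometric series. Nonnegativity of the coefficients turns
  convergence into the absolute convergence that the product requires.\<close>

lemma sums_partial_sums_powser:
  fixes a :: "nat \<Rightarrow> real"
  assumes a: "\<And>m. 0 \<le> a m" "(\<lambda>m. a m * s ^ m) sums A" and s: "0 \<le> s" "s < 1"
  shows "(\<lambda>m. (\<Sum>i\<le>m. a i) * s ^ m) sums (A / (1 - s))"
proof -
  have "(\<lambda>k. \<Sum>i\<le>k. (a i * s ^ i) * s ^ (k - i)) sums ((\<Sum>k. a k * s ^ k) * (\<Sum>k. s ^ k))"
    using a s by (intro Cauchy_product_sums) (auto simp: sums_iff abs_mult)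
  also have "(\<lambda>k. \<Sum>i\<le>k. (a i * s ^ i) * s ^ (k - i)) = (\<lambda>m. (\<Sum>i\<le>m. a i) * s ^ m)"
    by (intro ext) (auto simp: sum_distrib_right mult.assoc power_add[symmetric] intro!: sum.cong)
  finally show ?thesis
    using a(2) s by (simp add: sums_iff suminf_geometric)
qed

text \<open>Each division by 1 - s replaces the coefficients by their partial sums. From the
  constant 1 this leads through m + 1 and the triangular numbers to the tetrahedral numbers
  C(m+3,3), which are \<open>mass_coeff\<close>.\<close>

lemma mass_coeff_sums:
  assumes s: "0 \<le> s" "s < (1::real)"
  shows "(\<lambda>m. mass_coeff m * s ^ m) sums (1 / (1 - s) ^ 4)"
proof -
  have 1: "(\<lambda>m. 1 * s ^ m) sums (1 / (1 - s))"
    using geometric_sums[of s] s by simp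
  have "(\<lambda>m. (\<Sum>i\<le>m. 1) * s ^ m) sums (1 / (1 - s) / (1 - s))"
    by (rule sums_partial_sums_powser[OF _ 1 s]) simp
  then have 2: "(\<lambda>m. (real m + 1) * s ^ m) sums (1 / (1 - s) / (1 - s))"
    by (simp add: add.commute)
  have e2: "(\<Sum>i\<le>m. real i + 1) = (real m + 1) * (real m + 2) / 2" for m
    by (induction m) (simp_all add: field_simps)
  have 3: "(\<lambda>m. (real m + 1) * (real m + 2) / 2 * s ^ m) sums (1 / (1 - s) / (1 - s) / (1 - s))"
    using sums_partial_sums_powser[OF _ 2 s] unfolding e2 by simp
  have e3: "(\<Sum>i\<le>m. (real i + 1) * (real i + 2) / 2) = mass_coeff m" for m
    by (induction m) (simp_all add: mass_coeff_def field_simps)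
  have "(\<lambda>m. mass_coeff m * s ^ m) sums (1 / (1 - s) / (1 - s) / (1 - s) / (1 - s))"
    using sums_partial_sums_powser[OF _ 3 s] unfolding e3 by simp
  then show ?thesis
    by (simp add: power4_eq_xxxx)
qed

definition area_weight :: "real \<Rightarrow> nat \<Rightarrow> real" where
  "area_weight \<rho> m = pi * \<rho> ^ Suc m / Suc m"

lemma cball_sqrt_disc: "\<rho> < 1 \<Longrightarrow> cball 0 (sqrt \<rho>) \<subseteq> unit_disc"
proof
  fix z :: complex assume "\<rho> < 1" "z \<in> cball 0 (sqrt \<rho>)"
  then have "cmod z \<le> sqrt \<rho>" "sqrt \<rho> < 1"
    by simp_all
  then have "cmod z < 1"
    by (rule le_less_trans)
  then show "z \<in> unit_disc"
    by simp
qed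

text \<open>The mass does not depend on \<open>w\<close>, by invariance. It is the integral of (1 -
  \<bar>z\<bar>^2)^(-4) over the disc of radius sqrt \<rho>, expanded in powers of \<bar>z\<bar>^2
  and integrated termwise.\<close>

lemma disc_kernel_mass:
  assumes w: "w \<in> unit_disc" and \<rho>: "0 < \<rho>" "\<rho> < 1"
  shows "(\<integral>\<^sup>+u. disc_kernel \<rho> u w \<partial>hyp) = (\<Sum>m. ennreal (area_weight \<rho> m) * ennreal (mass_coeff m))"
proof -
  have [measurable]: "(cball 0 (sqrt \<rho>) :: complex set) \<in> sets borel"
    by simp
  have "(\<integral>\<^sup>+u. disc_kernel \<rho> u w \<partial>hyp) =
    (\<integral>\<^sup>+z. ennreal (1 / (1 - (cmod z)\<^sup>2) ^ 4) * indicator unit_disc z * indicator (cball 0 (sqrt \<rho>)) z \<partial>lborel)"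
    using nn_integral_disc_kernel[OF w, of "\<lambda>_. 1" \<rho>] by simp
  also have "\<dots> = (\<integral>\<^sup>+z. (\<Sum>m. ennreal (mass_coeff m) * (ennreal (((cmod z)\<^sup>2) ^ m) * indicator (cball 0 (sqrt \<rho>)) z)) \<partial>lborel)"
  proof (rule nn_integral_cong)
    fix z :: complex
    show "ennreal (1 / (1 - (cmod z)\<^sup>2) ^ 4) * indicator unit_disc z * indicator (cball 0 (sqrt \<rho>)) z =
      (\<Sum>m. ennreal (mass_coeff m) * (ennreal (((cmod z)\<^sup>2) ^ m) * indicator (cball 0 (sqrt \<rho>)) z))"
    proof (cases "z \<in> cball 0 (sqrt \<rho>)")
      case True
      then have z: "z \<in> unit_disc"
        using cball_sqrt_disc[OF \<rho>(2)] by blast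
      then have "(cmod z)\<^sup>2 < 1"
        by (simp add: abs_square_less_1)
      then have s: "(\<lambda>m. mass_coeff m * ((cmod z)\<^sup>2) ^ m) sums (1 / (1 - (cmod z)\<^sup>2) ^ 4)"
        by (intro mass_coeff_sums) simp_all
      have "(\<Sum>m. ennreal (mass_coeff m * ((cmod z)\<^sup>2) ^ m)) = ennreal (1 / (1 - (cmod z)\<^sup>2) ^ 4)"
        unfolding sums_unique[OF s] by (rule suminf_ennreal2[OF _ sums_summable[OF s]]) (simp add: mass_coeff_def)
      moreover have "ennreal (mass_coeff m * ((cmod z)\<^sup>2) ^ m) = ennreal (mass_coeff m) * ennreal (((cmod z)\<^sup>2) ^ m)" for m
        by (rule ennreal_mult) (simp_all add: mass_coeff_def)
      ultimately show ?thesis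
        using True z by simp
    qed simp
  qed
  also have "\<dots> = (\<Sum>m. \<integral>\<^sup>+z. ennreal (mass_coeff m) * (ennreal (((cmod z)\<^sup>2) ^ m) * indicator (cball 0 (sqrt \<rho>)) z) \<partial>lborel)"
    by (rule nn_integral_suminf) measurable
  also have "\<dots> = (\<Sum>m. ennreal (area_weight \<rho> m) * ennreal (mass_coeff m))"
  proof (rule suminf_cong)
    fix m
    have "(\<integral>\<^sup>+z. ennreal (mass_coeff m) * (ennreal (((cmod z)\<^sup>2) ^ m) * indicator (cball 0 (sqrt \<rho>)) z) \<partial>lborel)
      = ennreal (mass_coeff m) * (\<integral>\<^sup>+z. (ennreal (((cmod z)\<^sup>2) ^ m) * indicator (cball 0 (sqrt \<rho>)) z) \<partial>lborel)"
      by (rule nn_integral_cmult) measurable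
    then show "(\<integral>\<^sup>+z. ennreal (mass_coeff m) * (ennreal (((cmod z)\<^sup>2) ^ m) * indicator (cball 0 (sqrt \<rho>)) z) \<partial>lborel)
      = ennreal (area_weight \<rho> m) * ennreal (mass_coeff m)"
      unfolding nn_integral_cmod_power_cball[OF less_imp_le[OF \<rho>(1)]] area_weight_def by (simp only: mult.commute)
  qed
  finally show ?thesis .
qed

text \<open>Cut off outside the disc, where \<open>Q\<close> need not be measurable.\<close>

definition WP_density :: "(complex \<Rightarrow> complex) \<Rightarrow> complex \<Rightarrow> real" where
  "WP_density Q u = (if u \<in> unit_disc then (cmod (Q u))\<^sup>2 * (1 - (cmod u)\<^sup>2) ^ 4 else 0)"

lemma WP_density_nonneg: "0 \<le> WP_density Q u"
  by (simp add: WP_density_def)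

lemma WP_density_measurable:
  assumes "Q holomorphic_on unit_disc"
  shows "WP_density Q \<in> borel_measurable borel"
  unfolding WP_density_def[abs_def]
  by (intro borel_measurable_continuous_on_if continuous_intros holomorphic_on_imp_continuous_on assms) auto

text \<open>By Schwarz-Pick equality the fourth power of 1 - \<bar>disc_shift w z\<bar>^2
  contributes the fourth power of the modulus of the derivative, which is what the squared modulus
  of \<open>Q_w\<close> contains.\<close>

lemma WP_density_disc_shift:
  assumes w: "w \<in> unit_disc" and z: "z \<in> unit_disc"
  shows "WP_density Q (disc_shift w z) = (cmod (disc_pullback Q w z))\<^sup>2 * (1 - (cmod z)\<^sup>2) ^ 4"
proof -
  define g where "g = (\<lambda>z\<in>unit_disc. disc_shift w z)"
  have g: "g \<in> PSU11"
    unfolding g_def by (rule disc_shift_in_PSU11[OF w])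
  have gz: "g z = disc_shift w z"
    unfolding g_def using z by (rule restrict_apply')
  have "(g has_field_derivative (1 - w * cnj w) / (1 + cnj w * z)\<^sup>2) (at z)"
    by (rule has_field_derivative_transform_within_open[OF disc_shift_has_field_derivative[OF w z] open_ball z])
       (simp add: g_def)
  then have dg: "deriv g z = (1 - w * cnj w) / (1 + cnj w * z)\<^sup>2"
    by (rule DERIV_imp_deriv)
  have "(cmod z)\<^sup>2 < 1"
    using z by (simp add: abs_square_less_1)
  then have "1 - (cmod (disc_shift w z))\<^sup>2 = cmod ((1 - w * cnj w) / (1 + cnj w * z)\<^sup>2) * (1 - (cmod z)\<^sup>2)"
    using PSU11_has_field_derivative(2)[OF g z] unfolding dg gz by simp
  then show ?thesis
    unfolding WP_density_def disc_pullback_def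
    using disc_shift_maps_disc[OF w z]
    by (simp only: if_True norm_mult norm_power power_mult_distrib) (simp add: mult.assoc power_mult[symmetric])
qed

lemma WP_density_kernel_integral:
  assumes w: "w \<in> unit_disc" and \<rho>: "0 < \<rho>" "\<rho> < 1" and Q: "Q holomorphic_on unit_disc"
  shows "(\<integral>\<^sup>+u. ennreal (WP_density Q u) * disc_kernel \<rho> u w \<partial>hyp) =
    (\<Sum>m. ennreal (area_weight \<rho> m) * ennreal ((cmod (pullback_coeff Q w m))\<^sup>2))"
proof -
  note [measurable] = WP_density_measurable[OF Q]
  have "(\<integral>\<^sup>+u. ennreal (WP_density Q u) * disc_kernel \<rho> u w \<partial>hyp) =
    (\<integral>\<^sup>+z. ennreal (WP_density Q (disc_shift w z)) * ennreal (1 / (1 - (cmod z)\<^sup>2) ^ 4) * indicator unit_disc z * indicator (cball 0 (sqrt \<rho>)) z \<partial>lborel)"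
    by (rule nn_integral_disc_kernel[OF w]) measurable
  also have "\<dots> = (\<integral>\<^sup>+z. ennreal ((cmod (disc_pullback Q w z))\<^sup>2) * indicator (cball 0 (sqrt \<rho>)) z \<partial>lborel)"
  proof (rule nn_integral_cong)
    fix z :: complex
    show "ennreal (WP_density Q (disc_shift w z)) * ennreal (1 / (1 - (cmod z)\<^sup>2) ^ 4) * indicator unit_disc z * indicator (cball 0 (sqrt \<rho>)) z
      = ennreal ((cmod (disc_pullback Q w z))\<^sup>2) * indicator (cball 0 (sqrt \<rho>)) z"
    proof (cases "z \<in> cball 0 (sqrt \<rho>)")
      case True
      then have z: "z \<in> unit_disc"
        using cball_sqrt_disc[OF \<rho>(2)] by blast
      then have pos: "1 - (cmod z)\<^sup>2 > 0"
        by (simp add: abs_square_less_1)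
      have "ennreal (WP_density Q (disc_shift w z)) * ennreal (1 / (1 - (cmod z)\<^sup>2) ^ 4) = ennreal ((cmod (disc_pullback Q w z))\<^sup>2)"
        unfolding WP_density_disc_shift[OF w z] using pos by (subst ennreal_mult[symmetric]) simp_all
      then show ?thesis
        using True z by simp
    qed simp
  qed
  also have "\<dots> = (\<Sum>m. ennreal (area_weight \<rho> m) * ennreal ((cmod (pullback_coeff Q w m))\<^sup>2))"
    unfolding area_weight_def by (rule area_parseval[OF disc_pullback_sums[OF Q w] \<rho>])
  finally show ?thesis .
qed

text \<open>A nonzero coefficient would make 0 an isolated zero of the sum of the series, but the
  sum vanishes on all of the interval from 0 to 1.\<close>

lemma powser_coeffs_zero:
  fixes c :: "nat \<Rightarrow> real"
  assumes "\<And>\<rho>. 0 < \<rho> \<Longrightarrow> \<rho> < 1 \<Longrightarrow> (\<lambda>m. c m * \<rho> ^ Suc m) sums 0"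
  shows "c m = 0"
proof (rule ccontr)
  assume "c m \<noteq> 0"
  \<comment> \<open>The exponents start at 1, so a coefficient 0 is put in front; it also makes 0 a
    zero of \<open>f\<close>.\<close>
  define a where "a n = (case n of 0 \<Rightarrow> 0 | Suc k \<Rightarrow> c k)" for n
  define f where "f x = (\<Sum>n. a n * x ^ n)" for x
  have a: "(\<lambda>n. a n * \<rho> ^ n) sums 0" if "0 < \<rho>" "\<rho> < 1" for \<rho>
    using assms[OF that] sums_Suc_iff[of "\<lambda>n. a n * \<rho> ^ n" 0] by (simp add: a_def)
  have sm: "(\<lambda>n. a n * (x - 0) ^ n) sums f x" if "norm (x - 0) < 1" for x
  proof -
    have "summable (\<lambda>n. a n * x ^ n)"
      by (rule powser_inside[OF sums_summable[OF a[of "(1 + \<bar>x\<bar>) / 2"]]]) (use that in auto)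
    then show ?thesis
      by (simp add: f_def summable_sums)
  qed
  have f0: "f \<rho> = 0" if "0 < \<rho>" "\<rho> < 1" for \<rho>
    using sums_unique[OF a[OF that]] by (simp add: f_def)
  have "f 0 = 0"
    using powser_zero[of a] by (simp add: f_def a_def)
  then obtain s where s: "0 < s" "\<And>z. z \<in> cball 0 s - {0} \<Longrightarrow> f z \<noteq> 0"
    using powser_0_nonzero[of 1 0 a f "Suc m", OF _ sm] \<open>c m \<noteq> 0\<close> by (auto simp: a_def)
  have "f (min s (1/2)) \<noteq> 0"
    using s(1) by (intro s(2)) auto
  then show False
    using f0[of "min s (1/2)"] s(1) by auto
qed

lemma area_weight_pos: "0 < \<rho> \<Longrightarrow> 0 < area_weight \<rho> m"
  by (simp add: area_weight_def)

lemma mass_coeff_nonneg: "0 \<le> mass_coeff m"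
  by (simp add: mass_coeff_def)

definition total_mass :: "real \<Rightarrow> ennreal" where
  "total_mass \<rho> = (\<Sum>m. ennreal (area_weight \<rho> m) * ennreal (mass_coeff m))"

lemma total_mass_sums:
  assumes \<rho>: "0 < \<rho>" "\<rho> < 1"
  shows "summable (\<lambda>m. area_weight \<rho> m * mass_coeff m)"
    and "total_mass \<rho> = ennreal (\<Sum>m. area_weight \<rho> m * mass_coeff m)"
proof -
  have "summable (\<lambda>m. pi * \<rho> * (mass_coeff m * \<rho> ^ m))"
    using mass_coeff_sums[of \<rho>] \<rho> by (intro summable_mult) (auto simp: sums_iff)
  then show s: "summable (\<lambda>m. area_weight \<rho> m * mass_coeff m)"
  proof (rule summable_comparison_test')
    fix m :: nat
    have "area_weight \<rho> m \<le> pi * \<rho> ^ Suc m"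
      unfolding area_weight_def using \<rho> divide_left_mono[of 1 "real (Suc m)" "pi * \<rho> ^ Suc m"] by simp
    then have "area_weight \<rho> m * mass_coeff m \<le> pi * \<rho> ^ Suc m * mass_coeff m"
      by (rule mult_right_mono[OF _ mass_coeff_nonneg])
    then show "norm (area_weight \<rho> m * mass_coeff m) \<le> pi * \<rho> * (mass_coeff m * \<rho> ^ m)"
      using area_weight_pos[OF \<rho>(1), of m] mass_coeff_nonneg[of m] by (simp add: abs_mult mult_ac)
  qed
  have "ennreal (area_weight \<rho> m) * ennreal (mass_coeff m) = ennreal (area_weight \<rho> m * mass_coeff m)" for m
    using area_weight_pos[OF \<rho>(1), of m] mass_coeff_nonneg[of m] by (simp add: ennreal_mult)
  then show "total_mass \<rho> = ennreal (\<Sum>m. area_weight \<rho> m * mass_coeff m)"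
    unfolding total_mass_def
    using area_weight_pos[OF \<rho>(1)] mass_coeff_nonneg by (simp add: suminf_ennreal2[OF _ s] less_imp_le)
qed

lemma total_mass_pos:
  assumes \<rho>: "0 < \<rho>" "\<rho> < 1"
  shows "total_mass \<rho> \<noteq> 0" "total_mass \<rho> \<noteq> \<infinity>"
proof -
  have "0 < (\<Sum>m. area_weight \<rho> m * mass_coeff m)"
    by (rule suminf_pos2[OF total_mass_sums(1)[OF \<rho>], where i = 0])
       (use area_weight_pos[OF \<rho>(1)] mass_coeff_nonneg in \<open>auto simp: mass_coeff_def less_imp_le\<close>)
  then show "total_mass \<rho> \<noteq> 0" "total_mass \<rho> \<noteq> \<infinity>"
    unfolding total_mass_sums(2)[OF \<rho>] by simp_all
qed

text \<open>The product is 1 / (6 (m+1) (m+3)), a difference of reciprocals two steps apart. It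
  telescopes with \<open>f\<close>, which adds two neighbouring reciprocals, and the sum is
  \<open>f 0\<close> = (1 + 1/2) / 12.\<close>

lemma S_weight_mass_sums: "(\<lambda>m. S_weight m * mass_coeff m) sums (1 / 8)"
proof -
  define f where "f m = (1 / (real m + 1) + 1 / (real m + 2)) / 12" for m
  have "f \<longlonglongrightarrow> 0"
    unfolding f_def by real_asymp
  from telescope_sums'[OF this] have "(\<lambda>m. f m - f (Suc m)) sums (1 / 8)"
    by (simp add: f_def)
  also have "(\<lambda>m. f m - f (Suc m)) = (\<lambda>m. S_weight m * mass_coeff m)"
  proof
    fix m
    have "S_weight m * mass_coeff m = 1 / (6 * (real m + 1) * (real m + 3))"
    proof -
      have "1 / (A\<^sup>2 * B * C\<^sup>2) * (A * B * C / 6) = 1 / (6 * A * C)" if "A \<noteq> 0" "B \<noteq> 0" "C \<noteq> 0" for A B C :: real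
        using that by (simp add: power2_eq_square)
      from this[of "real m + 1" "real m + 2" "real m + 3"] show ?thesis
        by (simp add: S_weight_def mass_coeff_def add_eq_0_iff)
    qed
    also have "\<dots> = f m - f (Suc m)"
      unfolding f_def by (simp add: divide_simps) (simp add: algebra_simps)
    finally show "f m - f (Suc m) = S_weight m * mass_coeff m" ..
  qed
  finally show ?thesis .
qed

lemma pullback_coeff_measurable:
  assumes "Q holomorphic_on unit_disc"
  shows "(\<lambda>w. ennreal ((cmod (pullback_coeff Q w m))\<^sup>2) * indicator unit_disc w) \<in> borel_measurable borel"
proof -
  have "(\<lambda>w. if w \<in> unit_disc then (cmod (pullback_coeff Q w m))\<^sup>2 else 0) \<in> borel_measurable borel"
    by (intro borel_measurable_continuous_on_if continuous_intros pullback_coeff_continuous assms) auto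
  then have "(\<lambda>w. ennreal (if w \<in> unit_disc then (cmod (pullback_coeff Q w m))\<^sup>2 else 0)) \<in> borel_measurable borel"
    by measurable
  then show ?thesis
    by (rule measurable_cong[THEN iffD1, rotated]) (auto simp: indicator_def)
qed

section \<open>Averaging the kernels over a tile and comparing coefficients\<close>

context fuchsian
begin

lemma WP_density_invariant:
  assumes Q: "Q \<in> A_inf_inv \<Gamma>" and \<gamma>: "\<gamma> \<in> \<Gamma>" and u: "u \<in> unit_disc"
  shows "WP_density Q (\<gamma> u) = WP_density Q u"
proof -
  have "Q (\<gamma> u) * (deriv \<gamma> u)\<^sup>2 = Q u"
    using Q \<gamma> u by (auto simp: A_inf_inv_def)
  then have "(cmod (Q u))\<^sup>2 = (cmod (Q (\<gamma> u)))\<^sup>2 * (cmod (deriv \<gamma> u)) ^ 4"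
  proof -
    assume *: "Q (\<gamma> u) * (deriv \<gamma> u)\<^sup>2 = Q u"
    have "cmod (Q u) = cmod (Q (\<gamma> u)) * (cmod (deriv \<gamma> u))\<^sup>2"
      unfolding *[symmetric] norm_mult norm_power ..
    then show ?thesis
      by (simp add: power_mult_distrib)
  qed
  moreover have "1 - (cmod (\<gamma> u))\<^sup>2 = cmod (deriv \<gamma> u) * (1 - (cmod u)\<^sup>2)"
  proof -
    have "(cmod u)\<^sup>2 < 1"
      using u by (simp add: abs_square_less_1)
    then show ?thesis
      using PSU11_has_field_derivative(2)[OF PSU[OF \<gamma>] u] by simp
  qed
  ultimately show ?thesis
    using u maps_disc[OF \<gamma> u] by (simp add: WP_density_def power_mult_distrib)
qed

text \<open>Apply \<open>tile_exchange\<close> to the kernel alone: both sides are the hyperbolic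
  area of a tile times the mass of the kernel. Any \<rho> between 0 and 1 gives a finite nonzero
  mass to cancel; 1/2 is one choice.\<close>

lemma tile_hyp_eq:
  assumes "tile F1" "tile F2"
  shows "emeasure hyp F1 = emeasure hyp F2"
proof -
  have [measurable]: "F1 \<in> sets borel" "F2 \<in> sets borel" and sub: "F1 \<subseteq> unit_disc" "F2 \<subseteq> unit_disc"
    using assms by (auto simp: tile_def)
  have mass: "(\<integral>\<^sup>+u. disc_kernel (1/2) u w \<partial>hyp) = total_mass (1/2)" if "w \<in> unit_disc" for w
    unfolding total_mass_def by (rule disc_kernel_mass[OF that]) simp_all
  have mass': "(\<integral>\<^sup>+w. disc_kernel (1/2) u w \<partial>hyp) = total_mass (1/2)" if "u \<in> unit_disc" for u
    by (subst disc_kernel_commute) (rule mass[OF that])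
  have "(\<integral>\<^sup>+u. indicator F1 u * (\<integral>\<^sup>+w. disc_kernel (1/2) u w \<partial>hyp) \<partial>hyp) =
      (\<integral>\<^sup>+w. indicator F2 w * (\<integral>\<^sup>+u. disc_kernel (1/2) u w \<partial>hyp) \<partial>hyp)"
    by (rule tile_exchange[OF assms borel_measurable_disc_kernel disc_kernel_PSU11[OF PSU]])
  also have "(\<integral>\<^sup>+u. indicator F1 u * (\<integral>\<^sup>+w. disc_kernel (1/2) u w \<partial>hyp) \<partial>hyp) = (\<integral>\<^sup>+u. total_mass (1/2) * indicator F1 u \<partial>hyp)"
    by (rule nn_integral_cong) (use sub(1) mass' in \<open>auto simp: indicator_def subset_eq simp del: mem_ball_0\<close>)
  also have "\<dots> = total_mass (1/2) * emeasure hyp F1"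
    by (rule nn_integral_cmult_indicator) simp
  also have "(\<integral>\<^sup>+w. indicator F2 w * (\<integral>\<^sup>+u. disc_kernel (1/2) u w \<partial>hyp) \<partial>hyp) = (\<integral>\<^sup>+u. total_mass (1/2) * indicator F2 u \<partial>hyp)"
    by (rule nn_integral_cong) (use sub(2) mass in \<open>auto simp: indicator_def subset_eq simp del: mem_ball_0\<close>)
  also have "\<dots> = total_mass (1/2) * emeasure hyp F2"
    by (rule nn_integral_cmult_indicator) simp
  finally show ?thesis
    using total_mass_pos[of "1/2"] by (simp add: ennreal_mult_cancel_left)
qed

text \<open>\<open>tile_exchange\<close> for the product of the invariant density at
  \<open>u\<close> and the kernel. Integrating over \<open>w\<close> inside produces the mass of the
  kernel, integrating over \<open>u\<close> inside produces Parseval's series for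
  \<open>Q_w\<close>.\<close>

lemma tile_coefficient_integral:
  assumes F: "tile F" and Q: "Q \<in> A_inf_inv \<Gamma>" and \<rho>: "0 < \<rho>" "\<rho> < 1"
  defines "b \<equiv> \<lambda>m. \<integral>\<^sup>+w. indicator F w * ennreal ((cmod (pullback_coeff Q w m))\<^sup>2) \<partial>hyp"
  shows "(\<Sum>m. ennreal (area_weight \<rho> m) * b m) =
    (\<integral>\<^sup>+u. indicator F u * ennreal (WP_density Q u) \<partial>hyp) * total_mass \<rho>"
proof -
  have [measurable]: "F \<in> sets borel" and sub: "F \<subseteq> unit_disc"
    using F by (auto simp: tile_def)
  have Qhol: "Q holomorphic_on unit_disc"
    using Q by (simp add: A_inf_inv_def A_inf_def)
  note [measurable] = WP_density_measurable[OF Qhol]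
  have [measurable]: "(\<lambda>w. indicator F w * ennreal ((cmod (pullback_coeff Q w m))\<^sup>2)) \<in> borel_measurable borel" for m
  proof -
    note [measurable] = pullback_coeff_measurable[OF Qhol, of m]
    have "(\<lambda>w. indicator F w * (ennreal ((cmod (pullback_coeff Q w m))\<^sup>2) * indicator unit_disc w)) \<in> borel_measurable borel"
      by measurable
    then show ?thesis
      by (rule measurable_cong[THEN iffD1, rotated]) (use sub in \<open>auto simp: indicator_def\<close>)
  qed
  have "(\<integral>\<^sup>+u. indicator F u * (\<integral>\<^sup>+w. ennreal (WP_density Q u) * disc_kernel \<rho> u w \<partial>hyp) \<partial>hyp) =
      (\<integral>\<^sup>+w. indicator F w * (\<integral>\<^sup>+u. ennreal (WP_density Q u) * disc_kernel \<rho> u w \<partial>hyp) \<partial>hyp)"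
  proof (rule tile_exchange[OF F F])
    show "(\<lambda>(u, w). ennreal (WP_density Q u) * disc_kernel \<rho> u w) \<in> borel_measurable (borel \<Otimes>\<^sub>M borel)"
      by measurable
  qed (simp only: WP_density_invariant[OF Q] disc_kernel_PSU11[OF PSU])
  also have "(\<integral>\<^sup>+u. indicator F u * (\<integral>\<^sup>+w. ennreal (WP_density Q u) * disc_kernel \<rho> u w \<partial>hyp) \<partial>hyp) =
      (\<integral>\<^sup>+u. indicator F u * ennreal (WP_density Q u) * total_mass \<rho> \<partial>hyp)"
  proof (rule nn_integral_cong)
    fix u :: complex
    have [measurable]: "(\<lambda>w. disc_kernel \<rho> w u) \<in> borel_measurable borel"
      using measurable_Pair2[OF borel_measurable_disc_kernel, of u] by simp
    show "indicator F u * (\<integral>\<^sup>+w. ennreal (WP_density Q u) * disc_kernel \<rho> u w \<partial>hyp) = indicator F u * ennreal (WP_density Q u) * total_mass \<rho>"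
    proof (cases "u \<in> F")
      case True
      then have u: "u \<in> unit_disc"
        using sub by blast
      have "(\<integral>\<^sup>+w. ennreal (WP_density Q u) * disc_kernel \<rho> w u \<partial>hyp) = ennreal (WP_density Q u) * (\<integral>\<^sup>+w. disc_kernel \<rho> w u \<partial>hyp)"
        by (rule nn_integral_cmult) measurable
      then show ?thesis
        using True disc_kernel_mass[OF u \<rho>] by (simp add: disc_kernel_commute[of \<rho> u] total_mass_def)
    qed simp
  qed
  also have "\<dots> = (\<integral>\<^sup>+u. indicator F u * ennreal (WP_density Q u) \<partial>hyp) * total_mass \<rho>"
    by (rule nn_integral_multc) measurable
  also have "(\<integral>\<^sup>+w. indicator F w * (\<integral>\<^sup>+u. ennreal (WP_density Q u) * disc_kernel \<rho> u w \<partial>hyp) \<partial>hyp) =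
      (\<integral>\<^sup>+w. (\<Sum>m. ennreal (area_weight \<rho> m) * (indicator F w * ennreal ((cmod (pullback_coeff Q w m))\<^sup>2))) \<partial>hyp)"
  proof (rule nn_integral_cong)
    fix w :: complex
    show "indicator F w * (\<integral>\<^sup>+u. ennreal (WP_density Q u) * disc_kernel \<rho> u w \<partial>hyp) =
      (\<Sum>m. ennreal (area_weight \<rho> m) * (indicator F w * ennreal ((cmod (pullback_coeff Q w m))\<^sup>2)))"
    proof (cases "w \<in> F")
      case True
      then have "w \<in> unit_disc"
        using sub by blast
      from WP_density_kernel_integral[OF this \<rho> Qhol] True show ?thesis
        by simp
    qed simp
  qed
  also have "\<dots> = (\<Sum>m. \<integral>\<^sup>+w. ennreal (area_weight \<rho> m) * (indicator F w * ennreal ((cmod (pullback_coeff Q w m))\<^sup>2)) \<partial>hyp)"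
    by (rule nn_integral_suminf) measurable
  also have "\<dots> = (\<Sum>m. ennreal (area_weight \<rho> m) * b m)"
    unfolding b_def by (intro suminf_cong nn_integral_cmult) measurable
  finally show ?thesis ..
qed

end

context fuchsian
begin

text \<open>Both sides of \<open>tile_coefficient_integral\<close> are power series in \<rho>, so
  their coefficients agree. Finiteness of the integral of the density allows the passage to real
  series and the subtraction.\<close>

lemma tile_coefficient_integral_eq:
  assumes F: "tile F" and Q: "Q \<in> A_inf_inv \<Gamma>"
    and fin: "(\<integral>\<^sup>+u. indicator F u * ennreal (WP_density Q u) \<partial>hyp) \<noteq> \<infinity>"
  shows "(\<integral>\<^sup>+w. indicator F w * ennreal ((cmod (pullback_coeff Q w m))\<^sup>2) \<partial>hyp) =
    ennreal (mass_coeff m) * (\<integral>\<^sup>+u. indicator F u * ennreal (WP_density Q u) \<partial>hyp)"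
proof -
  define b where "b m = (\<integral>\<^sup>+w. indicator F w * ennreal ((cmod (pullback_coeff Q w m))\<^sup>2) \<partial>hyp)" for m
  obtain \<beta> where \<beta>: "0 \<le> \<beta>" "(\<integral>\<^sup>+u. indicator F u * ennreal (WP_density Q u) \<partial>hyp) = ennreal \<beta>"
    using fin by (cases "\<integral>\<^sup>+u. indicator F u * ennreal (WP_density Q u) \<partial>hyp") auto
  have main: "(\<Sum>m. ennreal (area_weight \<rho> m) * b m) = ennreal (\<beta> * (\<Sum>m. area_weight \<rho> m * mass_coeff m))"
    if "0 < \<rho>" "\<rho> < 1" for \<rho>
    using tile_coefficient_integral[OF F Q that] \<beta> unfolding b_def total_mass_sums(2)[OF that]
    by (simp add: ennreal_mult')
  \<comment> \<open>One infinite term would make the whole series infinite, since its weight is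
    positive; the value \<rho> = 1/2 is enough to exclude this.\<close>
  have "b m \<noteq> \<infinity>" for m
  proof
    assume "b m = \<infinity>"
    then have "ennreal (area_weight (1/2) m) * b m = \<infinity>"
      using area_weight_pos[of "1/2" m] by (simp add: ennreal_mult_top)
    moreover have "ennreal (area_weight (1/2) m) * b m \<le> (\<Sum>m. ennreal (area_weight (1/2) m) * b m)"
      using sum_le_suminf[of "\<lambda>m. ennreal (area_weight (1/2) m) * b m" "{m}"] by simp
    ultimately show False
      using main[of "1/2"] by (simp add: top_unique)
  qed
  then have "\<exists>r. b m = ennreal r \<and> 0 \<le> r" for m
    by (cases "b m") auto
  then obtain \<beta>' where \<beta>': "\<And>m. b m = ennreal (\<beta>' m)" "\<And>m. 0 \<le> \<beta>' m"
    by metis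
  have "(\<beta>' m - \<beta> * mass_coeff m) / Suc m = 0" for m
  proof (rule powser_coeffs_zero[where c = "\<lambda>m. (\<beta>' m - \<beta> * mass_coeff m) / Suc m"])
    fix \<rho> :: real assume \<rho>: "0 < \<rho>" "\<rho> < 1"
    have nn: "0 \<le> area_weight \<rho> m * \<beta>' m" for m
      using area_weight_pos[OF \<rho>(1), of m] \<beta>'(2)[of m] by simp
    have eq: "(\<Sum>m. ennreal (area_weight \<rho> m * \<beta>' m)) = ennreal (\<beta> * (\<Sum>m. area_weight \<rho> m * mass_coeff m))"
      using main[OF \<rho>] area_weight_pos[OF \<rho>(1)] \<beta>'(2) by (simp add: \<beta>'(1) ennreal_mult less_imp_le)
    have s: "summable (\<lambda>m. area_weight \<rho> m * \<beta>' m)"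
      by (rule summable_suminf_not_top[OF nn]) (simp add: eq)
    have nn2: "0 \<le> (\<Sum>m. area_weight \<rho> m * mass_coeff m)"
      by (rule suminf_nonneg[OF total_mass_sums(1)[OF \<rho>]])
         (use area_weight_pos[OF \<rho>(1)] mass_coeff_nonneg in \<open>simp add: less_imp_le\<close>)
    have "(\<Sum>m. area_weight \<rho> m * \<beta>' m) = \<beta> * (\<Sum>m. area_weight \<rho> m * mass_coeff m)"
      using eq unfolding suminf_ennreal2[OF nn s]
      by (rule ennreal_inj[THEN iffD1, rotated 2]) (use suminf_nonneg[OF s nn] nn2 \<beta>(1) in simp_all)
    then have "(\<lambda>m. area_weight \<rho> m * \<beta>' m) sums (\<beta> * (\<Sum>m. area_weight \<rho> m * mass_coeff m))"
      using summable_sums[OF s] by simp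
    from sums_diff[OF this sums_mult[OF summable_sums[OF total_mass_sums(1)[OF \<rho>]], of \<beta>]]
    have "(\<lambda>m. area_weight \<rho> m * \<beta>' m - \<beta> * (area_weight \<rho> m * mass_coeff m)) sums 0"
      by simp
    then have *: "(\<lambda>m. 1 / pi * (area_weight \<rho> m * \<beta>' m - \<beta> * (area_weight \<rho> m * mass_coeff m))) sums (1 / pi * 0)"
      by (rule sums_mult)
    have "1 / pi * (pi * X / N * b - \<beta> * (pi * X / N * d)) = (b - \<beta> * d) / N * X" for X N b d :: real
      by (simp add: diff_divide_distrib left_diff_distrib right_diff_distrib mult_ac)
    then have "1 / pi * (area_weight \<rho> m * \<beta>' m - \<beta> * (area_weight \<rho> m * mass_coeff m)) =
        (\<beta>' m - \<beta> * mass_coeff m) / Suc m * \<rho> ^ Suc m" for m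
      unfolding area_weight_def .
    with * show "(\<lambda>m. (\<beta>' m - \<beta> * mass_coeff m) / Suc m * \<rho> ^ Suc m) sums 0"
      by (simp only: mult_zero_right)
  qed
  then have "\<beta>' m = \<beta> * mass_coeff m"
    by (simp del: of_nat_Suc)
  then show ?thesis
    using \<beta>(1) mass_coeff_nonneg[of m] by (simp add: b_def[symmetric] \<beta>(2) \<beta>'(1) ennreal_mult mult.commute)
qed

text \<open>The squared norm of \<open>Q_w\<close> in the explicit formula. With values in
  [0,\<infinity>] it is defined before anything is known about convergence, and finiteness almost
  everywhere is deduced from its integral. The indicator restricts to the disc, where the
  coefficients are continuous in \<open>w\<close>.\<close>

definition S_norm_density :: "(complex \<Rightarrow> complex) \<Rightarrow> complex \<Rightarrow> ennreal" where
  "S_norm_density Q w = (\<Sum>m. ennreal (S_weight m) * (ennreal ((cmod (pullback_coeff Q w m))\<^sup>2) * indicator unit_disc w))"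

lemma S_norm_density_measurable:
  assumes "Q holomorphic_on unit_disc"
  shows "S_norm_density Q \<in> borel_measurable borel"
  unfolding S_norm_density_def[abs_def]
  by (intro borel_measurable_suminf_order borel_measurable_times_ennreal pullback_coeff_measurable[OF assms]) simp

lemma S_weight_nonneg: "0 \<le> S_weight m"
  by (simp add: S_weight_def)

lemma tile_S_norm_integral:
  assumes F: "tile F" and Q: "Q \<in> A_inf_inv \<Gamma>"
    and fin: "(\<integral>\<^sup>+u. indicator F u * ennreal (WP_density Q u) \<partial>hyp) \<noteq> \<infinity>"
  shows "(\<integral>\<^sup>+w. indicator F w * S_norm_density Q w \<partial>hyp) =
    ennreal (1 / 8) * (\<integral>\<^sup>+u. indicator F u * ennreal (WP_density Q u) \<partial>hyp)"
proof -
  have [measurable]: "F \<in> sets borel" and sub: "F \<subseteq> unit_disc"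
    using F by (auto simp: tile_def)
  have Qhol: "Q holomorphic_on unit_disc"
    using Q by (simp add: A_inf_inv_def A_inf_def)
  let ?B = "\<integral>\<^sup>+u. indicator F u * ennreal (WP_density Q u) \<partial>hyp"
  let ?p = "\<lambda>m w. ennreal ((cmod (pullback_coeff Q w m))\<^sup>2) * indicator unit_disc w"
  have [measurable]: "?p m \<in> borel_measurable borel" for m
    by (rule pullback_coeff_measurable[OF Qhol])
  have "(\<integral>\<^sup>+w. indicator F w * S_norm_density Q w \<partial>hyp) = (\<integral>\<^sup>+w. (\<Sum>m. ennreal (S_weight m) * (indicator F w * ?p m w)) \<partial>hyp)"
    unfolding S_norm_density_def by (intro nn_integral_cong) (simp add: indicator_def)
  also have "\<dots> = (\<Sum>m. \<integral>\<^sup>+w. ennreal (S_weight m) * (indicator F w * ?p m w) \<partial>hyp)"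
    by (rule nn_integral_suminf) measurable
  also have "\<dots> = (\<Sum>m. ennreal (S_weight m * mass_coeff m) * ?B)"
  proof (rule suminf_cong)
    fix m
    have "(\<integral>\<^sup>+w. ennreal (S_weight m) * (indicator F w * ?p m w) \<partial>hyp) = ennreal (S_weight m) * (\<integral>\<^sup>+w. indicator F w * ?p m w \<partial>hyp)"
      by (rule nn_integral_cmult) measurable
    also have "(\<integral>\<^sup>+w. indicator F w * ?p m w \<partial>hyp) = (\<integral>\<^sup>+w. indicator F w * ennreal ((cmod (pullback_coeff Q w m))\<^sup>2) \<partial>hyp)"
      by (rule nn_integral_cong) (use sub in \<open>auto simp: indicator_def\<close>)
    also have "\<dots> = ennreal (mass_coeff m) * ?B"
      by (rule tile_coefficient_integral_eq[OF F Q fin])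
    finally show "(\<integral>\<^sup>+w. ennreal (S_weight m) * (indicator F w * ?p m w) \<partial>hyp) = ennreal (S_weight m * mass_coeff m) * ?B"
      by (simp add: ennreal_mult S_weight_nonneg mass_coeff_nonneg mult.assoc)
  qed
  also have "\<dots> = (\<Sum>m. ennreal (S_weight m * mass_coeff m)) * ?B"
    by simp
  also have "(\<Sum>m. ennreal (S_weight m * mass_coeff m)) = ennreal (1 / 8)"
    unfolding sums_unique[OF S_weight_mass_sums]
    by (rule suminf_ennreal2[OF _ sums_summable[OF S_weight_mass_sums]]) (simp add: S_weight_nonneg mass_coeff_nonneg)
  finally show ?thesis .
qed

end

section \<open>From tiles back to the norms over the chosen fundamental domain\<close>

text \<open>Completeness of Lebesgue measure: preimages under \<open>f\<close> and \<open>g\<close>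
  differ by null sets. It serves integrands such as \<open>fiber_density\<close> that are identified
  only almost everywhere.\<close>

lemma borel_measurable_lebesgue_AE:
  fixes f g :: "'a::euclidean_space \<Rightarrow> 'b::topological_space"
  assumes "g \<in> borel_measurable lebesgue" "AE x in lebesgue. f x = g x"
  shows "f \<in> borel_measurable lebesgue"
proof (rule measurableI)
  fix A :: "'b set" assume "A \<in> sets borel"
  then have "g -` A \<inter> space lebesgue \<in> sets lebesgue"
    by (rule measurable_sets[OF assms(1)])
  then show "f -` A \<inter> space lebesgue \<in> sets lebesgue"
    by (rule completion.in_sets_AE[rotated]) (use assms(2) in \<open>auto elim: eventually_mono\<close>)
qed simp

context fuchsian
begin

text \<open>Discarding the null set \<open>F - C\<close> and changing \<open>g\<close> on a null set
  replaces the Lebesgue integral over \<open>F\<close> by a Borel integral. Measurability of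
  \<open>g\<close> on \<open>F\<close> is inherited from \<open>G\<close>.\<close>

lemma fundamental_domain_integral:
  fixes g G :: "complex \<Rightarrow> 'b::{banach,second_countable_topology}"
  assumes "tile C" "C \<subseteq> F" "negligible (F - C)"
    and G: "(\<lambda>w. indicator C w *\<^sub>R G w) \<in> borel_measurable borel"
    and eq: "AE w in lborel. w \<in> C \<longrightarrow> g w = G w"
  shows "(LINT w:F|lebesgue. g w) = (LINT w|lborel. indicator C w *\<^sub>R G w)"
proof -
  have "AE w in lebesgue. w \<notin> F - C"
    using assms(3) by (intro AE_not_in) (simp add: negligible_iff_null_sets)
  moreover have "AE w in lebesgue. w \<in> C \<longrightarrow> g w = G w"
    using eq by (simp add: AE_completion)
  ultimately have AE: "AE w in lebesgue. indicator F w *\<^sub>R g w = indicator C w *\<^sub>R G w"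
    by eventually_elim (use assms(2) in \<open>auto simp: indicator_def\<close>)
  have Gm: "(\<lambda>w. indicator C w *\<^sub>R G w) \<in> borel_measurable lebesgue"
    using G by (simp add: measurable_completion)
  have "(LINT w:F|lebesgue. g w) = (LINT w|lebesgue. indicator C w *\<^sub>R G w)"
    unfolding set_lebesgue_integral_def
    by (rule integral_cong_AE[OF borel_measurable_lebesgue_AE[OF Gm AE] Gm AE])
  also have "\<dots> = (LINT w|lborel. indicator C w *\<^sub>R G w)"
    using G by (intro integral_completion) simp
  finally show ?thesis .
qed


lemma S_norm_density_finite:
  assumes w: "w \<in> unit_disc" and fin: "S_norm_density Q w \<noteq> \<infinity>"
  shows "summable (\<lambda>m. S_weight m * (cmod (pullback_coeff Q w m))\<^sup>2)"
    and "(\<Sum>m. S_weight m * (cmod (pullback_coeff Q w m))\<^sup>2) = enn2real (S_norm_density Q w)"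
proof -
  have nn: "0 \<le> S_weight m * (cmod (pullback_coeff Q w m))\<^sup>2" for m
    by (simp add: S_weight_nonneg)
  have eq: "S_norm_density Q w = (\<Sum>m. ennreal (S_weight m * (cmod (pullback_coeff Q w m))\<^sup>2))"
    using w by (simp add: S_norm_density_def ennreal_mult S_weight_nonneg)
  show s: "summable (\<lambda>m. S_weight m * (cmod (pullback_coeff Q w m))\<^sup>2)"
    by (rule summable_suminf_not_top[OF nn]) (use fin eq in simp)
  show "(\<Sum>m. S_weight m * (cmod (pullback_coeff Q w m))\<^sup>2) = enn2real (S_norm_density Q w)"
    unfolding eq suminf_ennreal2[OF nn s] using suminf_nonneg[OF s nn] by simp
qed

text \<open>Cofiniteness speaks of some fundamental domain, while \<open>quotient_integral\<close>
  may choose another. \<open>tile_hyp_eq\<close> carries the finite area over.\<close>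

lemma cofinite_tile_finite:
  assumes "cofinite_group \<Gamma>" "tile C"
  shows "emeasure hyp C \<noteq> \<infinity>"
proof -
  obtain F where F: "fundamental_domain \<Gamma> F" "set_integrable lebesgue F (\<lambda>w. 4 / (1 - (cmod w)\<^sup>2)\<^sup>2)"
    using assms(1) by (auto simp: cofinite_group_def)
  obtain C0 where C0: "tile C0" "C0 \<subseteq> F"
    using fundamental_domain_tile[OF F(1)] by metis
  have [measurable]: "C0 \<in> sets borel"
    using C0(1) by (simp add: tile_def)
  have "emeasure hyp C0 = (\<integral>\<^sup>+w. indicator C0 w \<partial>hyp)"
    by simp
  also have "\<dots> = (\<integral>\<^sup>+w. ennreal (1 / (1 - (cmod w)\<^sup>2)\<^sup>2) * indicator unit_disc w * indicator C0 w \<partial>lborel)"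
    by (rule nn_integral_hyp) measurable
  \<comment> \<open>The density of \<open>hyp\<close> lacks the factor 4 of the area form in
    \<open>cofinite_group\<close>, so only an inequality is claimed.\<close>
  also have "\<dots> \<le> (\<integral>\<^sup>+w. ennreal (norm (indicator F w *\<^sub>R (4 / (1 - (cmod w)\<^sup>2)\<^sup>2))) \<partial>lborel)"
    by (rule nn_integral_mono) (use C0(2) in \<open>auto simp: indicator_def intro!: ennreal_leI divide_right_mono\<close>)
  also have "\<dots> = (\<integral>\<^sup>+w. ennreal (norm (indicator F w *\<^sub>R (4 / (1 - (cmod w)\<^sup>2)\<^sup>2))) \<partial>lebesgue)"
    by (rule nn_integral_completion[symmetric])
  also have "\<dots> < \<infinity>"
    using F(2) by (simp add: set_integrable_def integrable_iff_bounded)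
  finally show ?thesis
    using tile_hyp_eq[OF C0(1) assms(2)] by simp
qed

text \<open>The density is the square of the quantity bounded in \<open>A_inf\<close>, and the tile
  has finite area.\<close>

lemma WP_integral_finite:
  assumes "cofinite_group \<Gamma>" "tile C" and Q: "Q \<in> A_inf_inv \<Gamma>"
  shows "(\<integral>\<^sup>+u. indicator C u * ennreal (WP_density Q u) \<partial>hyp) \<noteq> \<infinity>"
proof -
  have [measurable]: "C \<in> sets borel"
    using assms(2) by (simp add: tile_def)
  obtain b where b: "\<And>z. z \<in> unit_disc \<Longrightarrow> cmod (Q z * complex_of_real ((1 - (cmod z)\<^sup>2)\<^sup>2)) \<le> b"
    using Q unfolding A_inf_inv_def A_inf_def by blast
  have bound: "WP_density Q u \<le> b\<^sup>2" for u
  proof (cases "u \<in> unit_disc")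
    case True
    have "WP_density Q u = (cmod (Q u * complex_of_real ((1 - (cmod u)\<^sup>2)\<^sup>2)))\<^sup>2"
      using True by (simp add: WP_density_def norm_mult norm_power power_mult_distrib flip: power_mult del: of_real_diff of_real_power)
    also have "\<dots> \<le> b\<^sup>2"
      by (rule power_mono[OF b[OF True]]) simp
    finally show ?thesis .
  qed (simp add: WP_density_def)
  have "(\<integral>\<^sup>+u. indicator C u * ennreal (WP_density Q u) \<partial>hyp) \<le> (\<integral>\<^sup>+u. ennreal (b\<^sup>2) * indicator C u \<partial>hyp)"
    by (rule nn_integral_mono) (auto simp: indicator_def intro: ennreal_leI bound)
  also have "\<dots> = ennreal (b\<^sup>2) * emeasure hyp C"
    by (rule nn_integral_cmult_indicator) simp
  also have "\<dots> < \<infinity>"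
    using cofinite_tile_finite[OF assms(1,2)] by (simp add: ennreal_mult_less_top less_top)
  finally show ?thesis
    by simp
qed

text \<open>Two of the four factors 1 - \<bar>w\<bar>^2 in \<open>WP_density\<close> are absorbed by
  the density of \<open>hyp\<close>, which leaves the Weil-Petersson integrand.\<close>

lemma WP_norm_sq_eq:
  assumes C: "tile C" "C \<subseteq> F" "negligible (F - C)" and F: "F = (SOME F. fundamental_domain \<Gamma> F)"
    and Q: "Q \<in> A_inf_inv \<Gamma>"
  shows "WP_norm_sq \<Gamma> Q = 1/4 * enn2real (\<integral>\<^sup>+u. indicator C u * ennreal (WP_density Q u) \<partial>hyp)"
proof -
  have [measurable]: "C \<in> sets borel" and sub: "C \<subseteq> unit_disc"
    using C(1) by (auto simp: tile_def)
  have Qhol: "Q holomorphic_on unit_disc"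
    using Q by (simp add: A_inf_inv_def A_inf_def)
  note [measurable] = WP_density_measurable[OF Qhol]
  define G where "G w = WP_density Q w / (1 - (cmod w)\<^sup>2)\<^sup>2" for w
  have eq: "(cmod (Q w))\<^sup>2 * (1 - (cmod w)\<^sup>2)\<^sup>2 = G w" if "w \<in> C" for w
  proof -
    have w: "w \<in> unit_disc"
      using sub that by blast
    then have "(cmod w)\<^sup>2 < 1"
      by (simp add: abs_square_less_1)
    then show ?thesis
      using w by (simp add: G_def WP_density_def power2_eq_square power4_eq_xxxx)
  qed
  have Gm: "(\<lambda>w. indicator C w *\<^sub>R G w) \<in> borel_measurable borel"
    unfolding G_def by measurable
  have "quotient_integral \<Gamma> (\<lambda>w. (cmod (Q w))\<^sup>2 * (1 - (cmod w)\<^sup>2)\<^sup>2) = (LINT w|lborel. indicator C w *\<^sub>R G w)"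
    unfolding quotient_integral_def F[symmetric]
    by (rule fundamental_domain_integral[OF C Gm]) (simp add: eq)
  also have "\<dots> = enn2real (\<integral>\<^sup>+w. ennreal (indicator C w *\<^sub>R G w) \<partial>lborel)"
    using Gm by (intro integral_eq_nn_integral) (auto simp: G_def WP_density_nonneg)
  also have "(\<integral>\<^sup>+w. ennreal (indicator C w *\<^sub>R G w) \<partial>lborel)
      = (\<integral>\<^sup>+w. ennreal (1 / (1 - (cmod w)\<^sup>2)\<^sup>2) * indicator unit_disc w * (indicator C w * ennreal (WP_density Q w)) \<partial>lborel)"
  proof (rule nn_integral_cong)
    fix w :: complex
    show "ennreal (indicator C w *\<^sub>R G w) = ennreal (1 / (1 - (cmod w)\<^sup>2)\<^sup>2) * indicator unit_disc w * (indicator C w * ennreal (WP_density Q w))"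
    proof (cases "w \<in> C")
      case True
      then have "w \<in> unit_disc"
        using sub by blast
      then show ?thesis
        using True WP_density_nonneg[of Q w] by (simp add: G_def ennreal_mult[symmetric])
    qed simp
  qed
  also have "\<dots> = (\<integral>\<^sup>+u. indicator C u * ennreal (WP_density Q u) \<partial>hyp)"
    by (rule nn_integral_hyp[symmetric]) measurable
  finally show ?thesis
    by (simp add: WP_norm_sq_def)
qed

text \<open>The constant is (-1/2) (-2 \<i>) (-2 \<i>) = 2: from the Gram determinant, from the
  orientation of the fiber, and from the definition of the norm.\<close>

lemma V_norm_sq_eq:
  assumes C: "tile C" "C \<subseteq> F" "negligible (F - C)" and F: "F = (SOME F. fundamental_domain \<Gamma> F)"
    and Q: "Q \<in> A_inf_inv \<Gamma>"
    and fin: "(\<integral>\<^sup>+w. indicator C w * S_norm_density Q w \<partial>hyp) \<noteq> \<infinity>"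
  shows "V_norm_sq \<Gamma> Q = complex_of_real (2 * enn2real (\<integral>\<^sup>+w. indicator C w * S_norm_density Q w \<partial>hyp))"
proof -
  have [measurable]: "C \<in> sets borel" and sub: "C \<subseteq> unit_disc"
    using C(1) by (auto simp: tile_def)
  have Qhol: "Q holomorphic_on unit_disc"
    using Q by (simp add: A_inf_inv_def A_inf_def)
  note [measurable] = S_norm_density_measurable[OF Qhol]
  define r where "r w = indicator C w * (enn2real (S_norm_density Q w) / (1 - (cmod w)\<^sup>2)\<^sup>2)" for w
  define G where "G w = \<i> * complex_of_real (enn2real (S_norm_density Q w) / (1 - (cmod w)\<^sup>2)\<^sup>2)" for w
  have [measurable]: "r \<in> borel_measurable borel"
    unfolding r_def by measurable
  have Gr: "indicator C w *\<^sub>R G w = \<i> * complex_of_real (r w)" for w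
    by (simp add: G_def r_def indicator_def)
  have Gm: "(\<lambda>w. indicator C w *\<^sub>R G w) \<in> borel_measurable borel"
    unfolding Gr by measurable
  have "AE w in hyp. indicator C w * S_norm_density Q w \<noteq> \<infinity>"
    by (rule nn_integral_PInf_AE) (use fin in simp_all)
  then have AE: "AE w in lborel. w \<in> C \<longrightarrow> S_norm_density Q w \<noteq> \<infinity>"
    unfolding AE_hyp_iff by (rule eventually_mono) (use sub in auto)
  have eq: "AE w in lborel. w \<in> C \<longrightarrow> fiber_density Q Q (cnj w) * (- 2 * \<i>) = G w"
    using AE
  proof (rule eventually_mono, intro impI)
    fix w assume "w \<in> C \<longrightarrow> S_norm_density Q w \<noteq> \<infinity>" "w \<in> C"
    then have fin_w: "S_norm_density Q w \<noteq> \<infinity>" and w: "w \<in> unit_disc"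
      using sub by auto
    show "fiber_density Q Q (cnj w) * (- 2 * \<i>) = G w"
      unfolding fiber_density_eq[OF w Qhol S_norm_density_finite(1)[OF w fin_w]] S_norm_density_finite(2)[OF w fin_w] G_def
      by simp
  qed
  have "omega_origin \<Gamma> Q Q = (LINT w|lborel. indicator C w *\<^sub>R G w)"
    unfolding omega_origin_def quotient_integral_def F[symmetric]
    by (rule fundamental_domain_integral[OF C Gm eq])
  also have "\<dots> = \<i> * complex_of_real (LINT w|lborel. r w)"
    unfolding Gr by simp
  also have "(LINT w|lborel. r w) = enn2real (\<integral>\<^sup>+w. ennreal (r w) \<partial>lborel)"
    by (rule integral_eq_nn_integral) (auto simp: r_def)
  also have "(\<integral>\<^sup>+w. ennreal (r w) \<partial>lborel)
      = (\<integral>\<^sup>+w. ennreal (1 / (1 - (cmod w)\<^sup>2)\<^sup>2) * indicator unit_disc w * (indicator C w * S_norm_density Q w) \<partial>lborel)"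
  proof (rule nn_integral_cong_AE, rule eventually_mono[OF AE])
    fix w assume *: "w \<in> C \<longrightarrow> S_norm_density Q w \<noteq> \<infinity>"
    show "ennreal (r w) = ennreal (1 / (1 - (cmod w)\<^sup>2)\<^sup>2) * indicator unit_disc w * (indicator C w * S_norm_density Q w)"
    proof (cases "w \<in> C")
      case True
      then have w: "w \<in> unit_disc"
        using sub by blast
      have "ennreal (enn2real (S_norm_density Q w)) = S_norm_density Q w"
        using * True by (simp add: less_top)
      moreover have "ennreal (1 / (1 - (cmod w)\<^sup>2)\<^sup>2 * enn2real (S_norm_density Q w)) =
          ennreal (1 / (1 - (cmod w)\<^sup>2)\<^sup>2) * ennreal (enn2real (S_norm_density Q w))"
        by (rule ennreal_mult) simp_all
      ultimately show ?thesis
        using True w by (simp add: r_def)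
    qed (simp add: r_def)
  qed
  also have "\<dots> = (\<integral>\<^sup>+w. indicator C w * S_norm_density Q w \<partial>hyp)"
    by (rule nn_integral_hyp[symmetric]) measurable
  finally show ?thesis
    by (simp add: V_norm_sq_def)
qed

end

theorem theorem4p10:
  fixes \<Gamma> :: "(complex \<Rightarrow> complex) set" and Q :: "complex \<Rightarrow> complex"
  assumes "fuchsian_group \<Gamma>" and "cofinite_group \<Gamma>" and "Q \<in> A_inf_inv \<Gamma>"
  shows "V_norm_sq \<Gamma> Q = complex_of_real (WP_norm_sq \<Gamma> Q)"
proof -
  interpret fuchsian \<Gamma>
    by unfold_locales fact
  define F where "F = (SOME F. fundamental_domain \<Gamma> F)"
  \<comment> \<open>Cofiniteness provides a fundamental domain, so the choice made inside
    \<open>quotient_integral\<close> is a genuine one.\<close>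
  have "\<exists>F. fundamental_domain \<Gamma> F"
    using assms(2) unfolding cofinite_group_def by blast
  then have "fundamental_domain \<Gamma> F"
    unfolding F_def by (rule someI_ex)
  then obtain C where C: "tile C" "C \<subseteq> F" "negligible (F - C)"
    by (rule fundamental_domain_tile)
  let ?B = "\<integral>\<^sup>+u. indicator C u * ennreal (WP_density Q u) \<partial>hyp"
  have fin: "?B \<noteq> \<infinity>"
    by (rule WP_integral_finite[OF assms(2) C(1) assms(3)])
  have S: "(\<integral>\<^sup>+w. indicator C w * S_norm_density Q w \<partial>hyp) = ennreal (1 / 8) * ?B"
    by (rule tile_S_norm_integral[OF C(1) assms(3) fin])
  then have "(\<integral>\<^sup>+w. indicator C w * S_norm_density Q w \<partial>hyp) \<noteq> \<infinity>"
    using fin by (simp add: ennreal_mult_eq_top_iff)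
  \<comment> \<open>The factor 2 of the Velling norm times the sum 1/8 of the series is the 1/4 in
    the Weil-Petersson norm.\<close>
  from V_norm_sq_eq[OF C F_def assms(3) this]
  have "V_norm_sq \<Gamma> Q = complex_of_real (1/4 * enn2real ?B)"
    unfolding S by (simp add: enn2real_mult)
  then show ?thesis
    unfolding WP_norm_sq_eq[OF C F_def assms(3)] .
qed

end
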